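(* Let $m>0$, $a\in\mathbb{R}$ with $|a|<m$, and let $(\sigma,k,\lambda,s)\in(\mathbb{R}\setminus\{0\})\times\mathbb{Z}\times(0,\infty)\times\mathbb{R}$. Let $u:(r_+,\infty)\to\mathbb{C}$ be a smooth solution of $\mathrm{P}u=0$, where $$\mathrm{P}=-\partial_r\mu(r)\partial_r+\frac{1}{\mu(r)}\Big(i\big((r^2+a^2)\sigma+ak\big)+(r-m)s\Big)^2-4sir\sigma+\lambda ,$$ such that $e^{H(r)}u(r)$ extends to a smooth function on $[r_+,\infty)$ and $e^{-H(r)}u(r)$ is conormal at $r=\infty$. Then $u=0$.
   Context: $\mu(r)=r^2-2mr+a^2$ and $r_+=m+\sqrt{m^2-a^2}$ is its largest root. $H$ is a smooth complex-valued function on $(r_+,\infty)$ with $$H'(r)=\frac{i\big((r^2+a^2)\sigma+ak\big)+(r-m)s}{\mu(r)} .$$ The function $e^{-H}u$ is conormal at $r=\infty$ if there is $\beta\in\mathbb{R}$ such that $(r\partial_r)^j\big(r^{\beta}e^{-H(r)}u(r)\big)$ is uniformly bounded on $(r_++1,\infty)$ for every $j\in\mathbb{N}_0$. *)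

theory Defs
  imports "HOL-Analysis.Analysis"
begin

text \<open>
  Derivatives are taken within \<open>S\<close>: for open \<open>S\<close> they are the usual ones, on
  \<open>[r\<^sub>+, \<infinity>)\<close> they are one-sided at the endpoint.  Only the values of \<open>f\<close> on
  \<open>S\<close> matter.
\<close>

definition smooth_on :: "real set \<Rightarrow> (real \<Rightarrow> complex) \<Rightarrow> bool" where
  "smooth_on S f \<longleftrightarrow>
     (\<exists>D :: nat \<Rightarrow> real \<Rightarrow> complex.
        (\<forall>x\<in>S. D 0 x = f x) \<and>
        (\<forall>n. \<forall>x\<in>S. (D n has_vector_derivative D (Suc n) x) (at x within S)))"

definition kerr_\<mu> :: "real \<Rightarrow> real \<Rightarrow> real \<Rightarrow> real" where
  "kerr_\<mu> m a r = r\<^sup>2 - 2 * m * r + a\<^sup>2"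

definition r_plus :: "real \<Rightarrow> real \<Rightarrow> real" where
  "r_plus m a = m + sqrt (m\<^sup>2 - a\<^sup>2)"

text \<open>The expression shared by \<open>H' = kerr_K / kerr_\<mu>\<close> and the potential of \<open>kerr_P\<close>.\<close>

definition kerr_K :: "real \<Rightarrow> real \<Rightarrow> real \<Rightarrow> int \<Rightarrow> real \<Rightarrow> real \<Rightarrow> complex" where
  "kerr_K m a \<sigma> k s r =
     \<i> * of_real ((r\<^sup>2 + a\<^sup>2) * \<sigma> + a * of_int k) + of_real ((r - m) * s)"

definition kerr_P ::
  "real \<Rightarrow> real \<Rightarrow> real \<Rightarrow> int \<Rightarrow> real \<Rightarrow> real \<Rightarrow> (real \<Rightarrow> complex) \<Rightarrow> real \<Rightarrow> complex" where
  "kerr_P m a \<sigma> k \<Lambda> s u r =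
     - vector_derivative (\<lambda>x. of_real (kerr_\<mu> m a x) * vector_derivative u (at x)) (at r)
     + (1 / of_real (kerr_\<mu> m a r) * (kerr_K m a \<sigma> k s r)\<^sup>2
        - 4 * of_real s * \<i> * of_real r * of_real \<sigma> + of_real \<Lambda>) * u r"

definition r_deriv :: "(real \<Rightarrow> complex) \<Rightarrow> real \<Rightarrow> complex" where
  "r_deriv f r = of_real r * vector_derivative f (at r)"

text \<open>Conormality at infinity of a smooth function on \<open>(r\<^sub>0, \<infinity>)\<close>, \<open>r\<^sub>0 \<ge> 0\<close>.\<close>

definition conormal_at_infinity :: "real \<Rightarrow> (real \<Rightarrow> complex) \<Rightarrow> bool" where
  "conormal_at_infinity r0 f \<longleftrightarrow>
     (\<exists>\<beta>::real. \<forall>j::nat.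
        bounded ((r_deriv ^^ j) (\<lambda>r. of_real (r powr \<beta>) * f r) ` {r0 + 1<..}))"

end

theory Submission
  imports Defs "HOL-Complex_Analysis.Conformal_Mappings"
begin

text \<open>
  In the variable \<open>z = (r - r\<^sub>+) / (r - r\<^sub>-)\<close>, and after removing explicit factors, \<open>u\<close> becomes a solution
  \<open>W\<close> of a confluent Heun equation on \<open>(0, 1)\<close> that is smooth at \<open>z = 0\<close> and conormal at the irregular
  singular point \<open>z = 1\<close>.  Its Taylor coefficients \<open>c n\<close> at \<open>0\<close> satisfy a three-term recurrence.

  The coefficients decay rapidly: the moments \<open>m n\<close> of \<open>W\<close> against the oscillating weight that makes
  the equation symmetric solve the transposed recurrence, and testing with Taylor polynomials of \<open>W\<close>
  shows that \<open>c n\<close> and a rescaling of \<open>m n\<close> are proportional for large \<open>n\<close>.  Conormality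
  and repeated integration by parts give \<open>m n = O(n\<^sup>-\<^sup>K)\<close> for all \<open>K\<close>, and not all \<open>m n\<close> vanish unless \<open>W = 0\<close>.

  Rescaling \<open>c n\<close> by quotients of Gamma functions gives the coefficients of a solution of another
  confluent Heun equation, this time with a real potential in Liouville form (the hidden symmetry behind
  Whiting's transformation).  Its conserved flux has opposite signs at the two ends, because
  the flux at infinity is proportional to \<open>\<sigma>\<close> and the one at the horizon to \<open>- m \<sigma>\<close>.  Hence the rescaled
  solution vanishes at \<open>z = 0\<close>, the recurrence gives \<open>c = 0\<close>, and \<open>W = 0\<close> because it is flat at a regular singular point.
  If \<open>(r\<^sub>+\<^sup>2 + a\<^sup>2) \<sigma> + a k = 0\<close> and \<open>s\<close> is a positive integer, this only gives \<open>c n = 0\<close> for \<open>n < s\<close>; the remaining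
  coefficients are rescaled differently, and then the flux shows that the solution is flat at infinity.
\<close>

text \<open>The radial equation itself admits no flux argument. For s nonzero its potential is not
  real, and even for s = 0 the flux at the horizon is governed by (r_+^2 + a^2) \<sigma> + a k,
  whose sign relative to \<sigma> is arbitrary (superradiance). After the rescaling this quantity
  drops out of both boundary values. On Taylor coefficients the rescaling is harmless, since
  quotients of Gamma functions grow at most like a power of n. But the flux argument needs the
  rescaled solution and its first derivative to stay bounded up to z = 1, and this is what rapid
  decay of \<open>c\<close> provides. Decay cannot be read off from conormality directly, because
  conormality controls \<open>W\<close> only on the segment (0, 1) and not on the unit circle. The
  moments use only the segment, and they are tied to \<open>c\<close> by a vanishing Casoratian: two
  solutions of the same second-order recurrence with Casoratian zero are proportional.\<close>

section \<open>Symbols with respect to a vector field\<close>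

text \<open>
  \<open>symb \<phi> S n f\<close>: the functions \<open>(\<phi> d/dx)\<^sup>j f\<close>, \<open>j \<le> n\<close>, exist and are bounded on \<open>S\<close>.  Recursion on a
  finite order makes closure under products an easy induction.
\<close>

primrec symb :: "(real \<Rightarrow> real) \<Rightarrow> real set \<Rightarrow> nat \<Rightarrow> (real \<Rightarrow> complex) \<Rightarrow> bool" where
  "symb \<phi> S 0 f \<longleftrightarrow> bounded (f ` S)"
| "symb \<phi> S (Suc n) f \<longleftrightarrow> bounded (f ` S) \<and> (\<forall>x\<in>S. f differentiable (at x)) \<and>
     symb \<phi> S n (\<lambda>x. of_real (\<phi> x) * vector_derivative f (at x))"

lemma vector_derivative_cong_open:
  fixes f g :: "real \<Rightarrow> complex"
  assumes "open S" "\<And>x. x \<in> S \<Longrightarrow> f x = g x" "x \<in> S"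
  shows "(f has_vector_derivative D) (at x) \<longleftrightarrow> (g has_vector_derivative D) (at x)"
    and "vector_derivative f (at x) = vector_derivative g (at x)"
    and "f differentiable (at x) \<longleftrightarrow> g differentiable (at x)"
proof -
  have *: "(f has_vector_derivative D) (at x) \<longleftrightarrow> (g has_vector_derivative D) (at x)" for D
    using has_vector_derivative_transform_within_open[OF _ assms(1,3), of f D g]
      has_vector_derivative_transform_within_open[OF _ assms(1,3), of g D f] assms(2) by auto
  then show "(f has_vector_derivative D) (at x) \<longleftrightarrow> (g has_vector_derivative D) (at x)" .
  from * show "vector_derivative f (at x) = vector_derivative g (at x)"
    unfolding vector_derivative_def by simp
  from * show "f differentiable (at x) \<longleftrightarrow> g differentiable (at x)"
    by (meson differentiableI_vector vector_derivative_works)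
qed

lemma symb_bounded: "symb \<phi> S n f \<Longrightarrow> bounded (f ` S)"
  by (cases n) auto

lemma symb_bound:
  assumes "symb \<phi> S n f"
  obtains B where "B > 0" "\<And>x. x \<in> S \<Longrightarrow> norm (f x) \<le> B"
  using symb_bounded[OF assms] by (auto simp: bounded_pos)

lemma symb_cong:
  assumes "open S" "\<And>x. x \<in> S \<Longrightarrow> f x = g x"
  shows "symb \<phi> S n f \<longleftrightarrow> symb \<phi> S n g"
  using assms(2)
proof (induction n arbitrary: f g)
  case 0
  then have "f ` S = g ` S" by auto
  then show ?case by simp
next
  case (Suc n)
  have "f ` S = g ` S" using Suc.prems by auto
  moreover have "(\<forall>x\<in>S. f differentiable (at x)) \<longleftrightarrow> (\<forall>x\<in>S. g differentiable (at x))"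
    using vector_derivative_cong_open(3)[OF assms(1)] Suc.prems by blast
  moreover have "symb \<phi> S n (\<lambda>x. of_real (\<phi> x) * vector_derivative f (at x)) \<longleftrightarrow>
      symb \<phi> S n (\<lambda>x. of_real (\<phi> x) * vector_derivative g (at x))"
    using vector_derivative_cong_open(2)[OF assms(1) Suc.prems] by (intro Suc.IH) auto
  ultimately show ?case by simp
qed

lemma symb_SucI:
  assumes "open S" "bounded (f ` S)"
    and "\<And>x. x \<in> S \<Longrightarrow> (f has_vector_derivative f' x) (at x)"
    and "symb \<phi> S n (\<lambda>x. of_real (\<phi> x) * f' x)"
  shows "symb \<phi> S (Suc n) f"
proof -
  have "vector_derivative f (at x) = f' x" if "x \<in> S" for x
    using assms(3)[OF that] by (rule vector_derivative_at)
  then have "symb \<phi> S n (\<lambda>x. of_real (\<phi> x) * vector_derivative f (at x))"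
    using symb_cong[OF assms(1), of "\<lambda>x. of_real (\<phi> x) * vector_derivative f (at x)" "\<lambda>x. of_real (\<phi> x) * f' x"]
      assms(4) by simp
  moreover have "f differentiable (at x)" if "x \<in> S" for x
    using assms(3)[OF that] by (rule differentiableI_vector)
  ultimately show ?thesis using assms(2) by simp
qed

lemma symb_SucD:
  assumes "symb \<phi> S (Suc n) f"
  shows "bounded (f ` S)"
    and "\<And>x. x \<in> S \<Longrightarrow> (f has_vector_derivative vector_derivative f (at x)) (at x)"
    and "symb \<phi> S n (\<lambda>x. of_real (\<phi> x) * vector_derivative f (at x))"
proof -
  show "bounded (f ` S)" "symb \<phi> S n (\<lambda>x. of_real (\<phi> x) * vector_derivative f (at x))"
    using assms by simp_all
  show "(f has_vector_derivative vector_derivative f (at x)) (at x)" if "x \<in> S" for x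
    using assms that by (simp add: vector_derivative_works[symmetric])
qed

lemma symb_Suc_imp: "symb \<phi> S (Suc n) f \<Longrightarrow> symb \<phi> S n f"
proof (induction n arbitrary: f)
  case (Suc n)
  have "bounded (f ` S)" "\<forall>x\<in>S. f differentiable (at x)" using Suc.prems by simp_all
  then show ?case using Suc.IH[OF symb_SucD(3)[OF Suc.prems]] by simp
qed simp

lemma symb_subset: "symb \<phi> S n f \<Longrightarrow> T \<subseteq> S \<Longrightarrow> symb \<phi> T n f"
proof (induction n arbitrary: f)
  case 0
  then show ?case by (auto intro: bounded_subset image_mono)
next
  case (Suc n)
  then have "bounded (f ` T)" by (meson bounded_subset image_mono symb_SucD(1))
  then show ?case using Suc by auto
qed

lemma symb_Un: "symb \<phi> S n f \<Longrightarrow> symb \<phi> T n f \<Longrightarrow> symb \<phi> (S \<union> T) n f"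
  by (induction n arbitrary: f) (auto simp: image_Un)

lemma symb_const [intro]: "symb \<phi> S n (\<lambda>x. c)"
proof (induction n arbitrary: c)
  case 0
  have "bounded ((\<lambda>x. c) ` S)" by (rule finite_imp_bounded) (auto intro: finite_subset[of _ "{c}"])
  then show ?case by simp
next
  case (Suc n)
  have "bounded ((\<lambda>x. c) ` S)" by (rule finite_imp_bounded) (auto intro: finite_subset[of _ "{c}"])
  then show ?case using Suc[of 0] by simp
qed

lemma symb_add:
  assumes "open S"
  shows "symb \<phi> S n f \<Longrightarrow> symb \<phi> S n g \<Longrightarrow> symb \<phi> S n (\<lambda>x. f x + g x)"
proof (induction n arbitrary: f g)
  case 0
  then show ?case by (simp add: bounded_plus_comp)
next
  case (Suc n)
  show ?case
  proof (rule symb_SucI[OF assms])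
    show "bounded ((\<lambda>x. f x + g x) ` S)"
      using Suc.prems by (simp add: bounded_plus_comp)
    show "((\<lambda>x. f x + g x) has_vector_derivative
       (vector_derivative f (at x) + vector_derivative g (at x))) (at x)" if "x \<in> S" for x
      using Suc.prems[THEN symb_SucD(2), OF that] by (rule has_vector_derivative_add)
    show "symb \<phi> S n (\<lambda>x. of_real (\<phi> x) * (vector_derivative f (at x) + vector_derivative g (at x)))"
      using Suc.IH[OF Suc.prems[THEN symb_SucD(3)]] by (simp add: algebra_simps)
  qed
qed

lemma bounded_mult_comp:
  fixes f g :: "'a \<Rightarrow> 'b::real_normed_algebra"
  assumes "bounded (f ` S)" "bounded (g ` S)"
  shows "bounded ((\<lambda>x. f x * g x) ` S)"
proof -
  obtain A B where "\<And>x. x \<in> S \<Longrightarrow> norm (f x) \<le> A" "\<And>x. x \<in> S \<Longrightarrow> norm (g x) \<le> B"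
    using assms by (auto simp: bounded_iff)
  then have "norm (f x * g x) \<le> \<bar>A\<bar> * \<bar>B\<bar>" if "x \<in> S" for x
    using that by (intro order_trans[OF norm_mult_ineq] mult_mono order_trans[OF _ abs_ge_self] abs_ge_zero norm_ge_zero) auto
  then show ?thesis by (auto simp: bounded_iff)
qed

lemma symb_mult:
  assumes "open S"
  shows "symb \<phi> S n f \<Longrightarrow> symb \<phi> S n g \<Longrightarrow> symb \<phi> S n (\<lambda>x. f x * g x)"
proof (induction n arbitrary: f g)
  case 0
  then show ?case by (simp add: bounded_mult_comp)
next
  case (Suc n)
  show ?case
  proof (rule symb_SucI[OF assms])
    show "bounded ((\<lambda>x. f x * g x) ` S)"
      using Suc.prems by (simp add: bounded_mult_comp)
    show "((\<lambda>x. f x * g x) has_vector_derivative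
       (f x * vector_derivative g (at x) + vector_derivative f (at x) * g x)) (at x)" if "x \<in> S" for x
      using Suc.prems[THEN symb_SucD(2), OF that] by (rule has_vector_derivative_mult)
    have "symb \<phi> S n (\<lambda>x. f x * (of_real (\<phi> x) * vector_derivative g (at x)) +
            (of_real (\<phi> x) * vector_derivative f (at x)) * g x)"
      using Suc.prems by (intro symb_add assms Suc.IH symb_SucD(3) symb_Suc_imp[of _ _ n f] symb_Suc_imp[of _ _ n g])
    then show "symb \<phi> S n (\<lambda>x. of_real (\<phi> x) * (f x * vector_derivative g (at x) + vector_derivative f (at x) * g x))"
      by (simp add: algebra_simps)
  qed
qed

lemma symb_cmult: "open S \<Longrightarrow> symb \<phi> S n f \<Longrightarrow> symb \<phi> S n (\<lambda>x. c * f x)"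
  by (rule symb_mult) auto

lemma symb_uminus: "open S \<Longrightarrow> symb \<phi> S n f \<Longrightarrow> symb \<phi> S n (\<lambda>x. - f x)"
  using symb_cmult[of S \<phi> n f "-1"] by simp

lemma symb_diff: "open S \<Longrightarrow> symb \<phi> S n f \<Longrightarrow> symb \<phi> S n g \<Longrightarrow> symb \<phi> S n (\<lambda>x. f x - g x)"
  using symb_add[of S \<phi> n f "\<lambda>x. - g x"] symb_uminus[of S \<phi> n g] by simp

lemma symb_power: "open S \<Longrightarrow> symb \<phi> S n f \<Longrightarrow> symb \<phi> S n (\<lambda>x. f x ^ k)"
  by (induction k) (auto intro: symb_mult)

lemma symb_sum:
  assumes "open S" "\<And>i. i \<in> I \<Longrightarrow> symb \<phi> S n (f i)"
  shows "symb \<phi> S n (\<lambda>x. \<Sum>i\<in>I. f i x)"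
proof (cases "finite I")
  case True
  then show ?thesis using assms(2)
    by (induction I) (auto intro!: symb_add[OF assms(1)])
qed auto

text \<open>Applying the new field means applying the old one and multiplying by
  \<open>\<rho>\<close>, and symbols are closed under products. In particular smoothness up to an
  endpoint, that is the field 1, yields symbol bounds for fields that degenerate there.\<close>

lemma symb_change_field:
  assumes "open S" "\<And>x. x \<in> S \<Longrightarrow> \<psi> x = \<rho> x * \<phi> x" "symb \<phi> S n (\<lambda>x. of_real (\<rho> x))"
  shows "symb \<phi> S n f \<Longrightarrow> symb \<psi> S n f"
  using assms(3)
proof (induction n arbitrary: f)
  case (Suc n)
  show ?case
  proof (rule symb_SucI[OF assms(1) symb_SucD(1)[OF Suc.prems(1)] symb_SucD(2)[OF Suc.prems(1)]])
    have "symb \<phi> S n (\<lambda>x. of_real (\<rho> x) * (of_real (\<phi> x) * vector_derivative f (at x)))"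
      using Suc.prems by (intro symb_mult assms symb_SucD(3) symb_Suc_imp[of _ _ n "\<lambda>x. of_real (\<rho> x)"])
    then have "symb \<phi> S n (\<lambda>x. of_real (\<psi> x) * vector_derivative f (at x))"
      by (subst symb_cong[OF assms(1), where g = "\<lambda>x. of_real (\<rho> x) * (of_real (\<phi> x) * vector_derivative f (at x))"])
         (auto simp: assms(2))
    then show "symb \<psi> S n (\<lambda>x. of_real (\<psi> x) * vector_derivative f (at x))"
      using Suc.IH Suc.prems(2) symb_Suc_imp by blast
  qed
qed simp

text \<open>The last hypothesis on the maps says that the two fields are \<open>g\<close>-related,
  so differentiation along them commutes with composition, order by order.\<close>

lemma symb_compose:
  assumes "open S" "\<And>x. x \<in> S \<Longrightarrow> (g has_real_derivative g' x) (at x)"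
    "\<And>x. x \<in> S \<Longrightarrow> g x \<in> T" "\<And>x. x \<in> S \<Longrightarrow> \<psi> x * g' x = \<phi> (g x)"
  shows "symb \<phi> T n f \<Longrightarrow> symb \<psi> S n (\<lambda>x. f (g x))"
proof (induction n arbitrary: f)
  case 0
  have "(\<lambda>x. f (g x)) ` S \<subseteq> f ` T" using assms(3) by auto
  then show ?case using 0 by (auto intro: bounded_subset)
next
  case (Suc n)
  show ?case
  proof (rule symb_SucI[OF assms(1)])
    have "(\<lambda>x. f (g x)) ` S \<subseteq> f ` T" using assms(3) by auto
    then show "bounded ((\<lambda>x. f (g x)) ` S)" using Suc.prems by (auto intro: bounded_subset)
    show "((\<lambda>x. f (g x)) has_vector_derivative of_real (g' x) * vector_derivative f (at (g x))) (at x)"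
      if "x \<in> S" for x
    proof -
      have "(g has_vector_derivative g' x) (at x)"
        using assms(2)[OF that] by (simp add: has_real_derivative_iff_has_vector_derivative)
      from vector_diff_chain_at[OF this symb_SucD(2)[OF Suc.prems assms(3)[OF that]]]
      show ?thesis by (simp add: o_def scaleR_conv_of_real)
    qed
    have "symb \<psi> S n (\<lambda>x. of_real (\<phi> (g x)) * vector_derivative f (at (g x)))"
      using Suc.IH[OF symb_SucD(3)[OF Suc.prems]] .
    then show "symb \<psi> S n (\<lambda>x. of_real (\<psi> x) * (of_real (g' x) * vector_derivative f (at (g x))))"
      by (subst symb_cong[OF assms(1), where g = "\<lambda>x. of_real (\<phi> (g x)) * vector_derivative f (at (g x))"])
         (auto simp flip: assms(4))
  qed
qed

lemma symb_exp:
  assumes "open S"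
  shows "symb \<phi> S n h \<Longrightarrow> symb \<phi> S n (\<lambda>x. exp (h x))"
proof (induction n)
  case 0
  obtain B where "\<And>x. x \<in> S \<Longrightarrow> norm (h x) \<le> B" using symb_bound[OF 0] by metis
  then have "norm (exp (h x)) \<le> exp B" if "x \<in> S" for x
    using that norm_exp[of "h x"] by (meson exp_le_cancel_iff order_trans)
  then show ?case by (auto simp: bounded_iff)
next
  case (Suc n)
  have e: "symb \<phi> S n (\<lambda>x. exp (h x))" using Suc symb_Suc_imp by blast
  show ?case
  proof (rule symb_SucI[OF assms symb_bounded[OF e]])
    show "((\<lambda>x. exp (h x)) has_vector_derivative vector_derivative h (at x) * exp (h x)) (at x)" if "x \<in> S" for x
      using field_vector_diff_chain_at[OF symb_SucD(2)[OF Suc.prems that] DERIV_exp] by (simp add: o_def)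
    have "symb \<phi> S n (\<lambda>x. (of_real (\<phi> x) * vector_derivative h (at x)) * exp (h x))"
      by (intro symb_mult assms e symb_SucD(3) Suc.prems)
    then show "symb \<phi> S n (\<lambda>x. of_real (\<phi> x) * (vector_derivative h (at x) * exp (h x)))"
      by (simp add: algebra_simps)
  qed
qed

lemma symb_inverse:
  assumes "open S" "\<delta> > 0" "\<And>x. x \<in> S \<Longrightarrow> norm (h x) \<ge> \<delta>"
  shows "symb \<phi> S n h \<Longrightarrow> symb \<phi> S n (\<lambda>x. inverse (h x))"
proof (induction n)
  case 0
  have "norm (inverse (h x)) \<le> inverse \<delta>" if "x \<in> S" for x
    using assms(2) assms(3)[OF that] by (simp add: norm_inverse le_imp_inverse_le)
  then show ?case by (auto simp: bounded_iff)
next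
  case (Suc n)
  have e: "symb \<phi> S n (\<lambda>x. inverse (h x))" using Suc symb_Suc_imp by blast
  show ?case
  proof (rule symb_SucI[OF assms(1) symb_bounded[OF e]])
    show "((\<lambda>x. inverse (h x)) has_vector_derivative vector_derivative h (at x) * (- (inverse (h x) ^ 2))) (at x)"
      if "x \<in> S" for x
    proof -
      have "h x \<noteq> 0" using assms(2,3) that by force
      from field_vector_diff_chain_at[OF symb_SucD(2)[OF Suc.prems that] DERIV_inverse[OF this]]
      show ?thesis by (simp add: o_def numeral_2_eq_2)
    qed
    have "symb \<phi> S n (\<lambda>x. - ((of_real (\<phi> x) * vector_derivative h (at x)) * (inverse (h x))^2))"
      by (intro symb_uminus symb_mult symb_power assms e symb_SucD(3) Suc.prems)
    then show "symb \<phi> S n (\<lambda>x. of_real (\<phi> x) * (vector_derivative h (at x) * (- (inverse (h x) ^ 2))))"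
      by (simp add: algebra_simps)
  qed
qed

lemma symb_ln:
  assumes "open S" "\<delta> > 0" "\<And>x. x \<in> S \<Longrightarrow> h x \<ge> \<delta>" "symb \<phi> S n (\<lambda>x. of_real (h x))"
    "\<And>x. x \<in> S \<Longrightarrow> (h has_real_derivative h' x) (at x)"
  shows "symb \<phi> S n (\<lambda>x. of_real (ln (h x)))"
proof -
  obtain B where B: "\<And>x. x \<in> S \<Longrightarrow> norm (complex_of_real (h x)) \<le> B" "B > 0"
    using symb_bound[OF assms(4)] by metis
  have bd: "norm (complex_of_real (ln (h x))) \<le> max \<bar>ln \<delta>\<bar> \<bar>ln B\<bar>" if "x \<in> S" for x
  proof -
    have "ln \<delta> \<le> ln (h x)" using assms(2) assms(3)[OF that] by simp
    moreover have "ln (h x) \<le> ln B" using assms(2) assms(3)[OF that] B(1)[OF that] by (auto)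
    ultimately show ?thesis by auto
  qed
  then have bdd: "bounded ((\<lambda>x. complex_of_real (ln (h x))) ` S)" by (auto simp: bounded_iff)
  show ?thesis
  proof (cases n)
    case 0
    then show ?thesis using bdd by simp
  next
    case (Suc k)
    have vd: "((\<lambda>x. complex_of_real (h x)) has_vector_derivative of_real (h' x)) (at x)" if "x \<in> S" for x
      using assms(5)[OF that] by (simp add: has_vector_derivative_complex_iff
          has_real_derivative_iff_has_vector_derivative)
    have "symb \<phi> S k (\<lambda>x. (of_real (\<phi> x) * vector_derivative (\<lambda>x. complex_of_real (h x)) (at x)) * inverse (of_real (h x)))"
      using assms(4)[unfolded Suc]
      by (intro symb_mult assms(1) symb_SucD(3) symb_inverse[OF assms(1,2)] symb_Suc_imp[of _ _ k])
         (use assms(2,3) in force)+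
    then have *: "symb \<phi> S k (\<lambda>x. of_real (\<phi> x) * of_real (h' x / h x))"
      by (subst symb_cong[OF assms(1), where g = "\<lambda>x. (of_real (\<phi> x) * vector_derivative (\<lambda>x. complex_of_real (h x)) (at x)) * inverse (of_real (h x))"])
         (auto simp: vector_derivative_at[OF vd] divide_inverse)
    show ?thesis unfolding Suc
    proof (rule symb_SucI[OF assms(1) bdd _ *])
      fix x assume x: "x \<in> S"
      have "((\<lambda>x. ln (h x)) has_real_derivative h' x / h x) (at x)"
        using assms(5)[OF x] assms(2) assms(3)[OF x]
        by (auto intro!: derivative_eq_intros simp: divide_inverse)
      then show "((\<lambda>x. complex_of_real (ln (h x))) has_vector_derivative of_real (h' x / h x)) (at x)"
        by (simp add: has_vector_derivative_complex_iff has_real_derivative_iff_has_vector_derivative)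
    qed
  qed
qed

lemma symb_id:
  assumes "open S" "bounded S" "\<And>n. symb \<phi> S n (\<lambda>x. of_real (\<phi> x))"
  shows "symb \<phi> S n (\<lambda>x. of_real x)"
proof -
  have b: "bounded (complex_of_real ` S)" using assms(2) by (auto simp: bounded_iff)
  show ?thesis
  proof (cases n)
    case (Suc k)
    show ?thesis unfolding Suc
    proof (rule symb_SucI[OF assms(1) b])
      show "((\<lambda>x. complex_of_real x) has_vector_derivative 1) (at x)" for x
        by (simp add: has_vector_derivative_complex_iff)
      show "symb \<phi> S k (\<lambda>x. of_real (\<phi> x) * 1)" using assms(3) by simp
    qed
  qed (use b in simp)
qed

section \<open>Taylor expansion at an endpoint\<close>

lemma vector_derivative_lipschitz_bound:
  fixes f f' :: "real \<Rightarrow> complex"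
  assumes "convex S" "\<And>x. x \<in> S \<Longrightarrow> (f has_vector_derivative f' x) (at x within S)"
    "\<And>x. x \<in> S \<Longrightarrow> norm (f' x) \<le> B" "x \<in> S" "y \<in> S"
  shows "norm (f x - f y) \<le> B * norm (x - y)"
proof (rule differentiable_bound[OF assms(1) _ _ assms(4,5)])
  show "(f has_derivative (\<lambda>h. h *\<^sub>R f' x)) (at x within S)" if "x \<in> S" for x
    using assms(2)[OF that] by (simp add: has_vector_derivative_def)
  show "onorm (\<lambda>h. h *\<^sub>R f' x) \<le> B" if "x \<in> S" for x
    using assms(3)[OF that] by (simp add: onorm_scaleR_left bounded_linear_ident onorm_id)
qed

text \<open>The equation is (z^k h)' = z^(k-1) F. Integrating from 0, where z^k h tends to 0, gives
  |z^k h| <= B z^k.\<close>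

lemma weighted_primitive_bound:
  fixes h h' F :: "real \<Rightarrow> complex"
  assumes "k \<ge> (1::nat)"
    and h: "\<And>z. z \<in> {0<..<\<delta>} \<Longrightarrow> (h has_vector_derivative h' z) (at z)"
    and F: "\<And>z. z \<in> {0<..<\<delta>} \<Longrightarrow> of_real z * h' z + of_nat k * h z = F z"
    and lim: "((\<lambda>z. of_real z ^ k * h z) \<longlongrightarrow> 0) (at_right 0)"
    and B: "\<And>z. z \<in> {0<..<\<delta>} \<Longrightarrow> norm (F z) \<le> B"
    and z: "z \<in> {0<..<\<delta>}"
  shows "norm (h z) \<le> B"
proof -
  define \<phi> where "\<phi> = (\<lambda>z. of_real z ^ k * h z)"
  have d\<phi>: "(\<phi> has_vector_derivative of_real x ^ (k-1) * F x) (at x)" if "x \<in> {0<..<\<delta>}" for x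
  proof -
    have "((\<lambda>x. complex_of_real x ^ k) has_vector_derivative of_nat k * of_real x ^ (k-1)) (at x)"
      by (rule has_vector_derivative_real_field) (auto intro!: derivative_eq_intros)
    from has_vector_derivative_mult[OF this h[OF that]]
    have "(\<phi> has_vector_derivative of_real x ^ k * h' x + of_nat k * of_real x ^ (k-1) * h x) (at x)"
      unfolding \<phi>_def .
    moreover have "of_real x ^ k = complex_of_real x ^ (k-1) * of_real x"
      using assms(1) by (cases k) auto
    then have "of_real x ^ k * h' x + of_nat k * of_real x ^ (k-1) * h x = of_real x ^ (k-1) * F x"
      unfolding F[OF that, symmetric] by (simp add: algebra_simps)
    ultimately show ?thesis by simp
  qed
  have B0: "B \<ge> 0" using B[OF z] norm_ge_zero order_trans by blast
  have est: "norm (\<phi> z - \<phi> \<epsilon>) \<le> B * z ^ k" if e: "0 < \<epsilon>" "\<epsilon> < z" for \<epsilon>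
  proof -
    have "norm (\<phi> z - \<phi> \<epsilon>) \<le> (B * z ^ (k-1)) * norm (z - \<epsilon>)"
    proof (rule vector_derivative_lipschitz_bound[of "{\<epsilon>..z}"])
      fix x assume x: "x \<in> {\<epsilon>..z}"
      then have x': "x \<in> {0<..<\<delta>}" using e z by auto
      show "(\<phi> has_vector_derivative of_real x ^ (k-1) * F x) (at x within {\<epsilon>..z})"
        by (rule has_vector_derivative_at_within[OF d\<phi>[OF x']])
      have "norm (of_real x ^ (k-1) * F x) = x ^ (k-1) * norm (F x)"
        using x' by (simp add: norm_mult norm_power)
      also have "\<dots> \<le> z ^ (k-1) * B"
        using x x' B[OF x'] by (intro mult_mono power_mono) auto
      finally show "norm (of_real x ^ (k-1) * F x) \<le> B * z ^ (k-1)" by (simp add: mult.commute)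
    qed (use e in auto)
    also have "\<dots> \<le> (B * z ^ (k-1)) * z"
      using e z B0 by (intro mult_left_mono) auto
    also have "\<dots> = B * z ^ k" using assms(1) by (cases k) auto
    finally show ?thesis .
  qed
  have "((\<lambda>\<epsilon>. norm (\<phi> z - \<phi> \<epsilon>)) \<longlongrightarrow> norm (\<phi> z - 0)) (at_right 0)"
    using lim unfolding \<phi>_def by (intro tendsto_intros)
  moreover have "eventually (\<lambda>\<epsilon>. norm (\<phi> z - \<phi> \<epsilon>) \<le> B * z ^ k) (at_right 0)"
    using z est by (auto simp: eventually_at_right_field intro!: exI[of _ z])
  ultimately have "norm (\<phi> z - 0) \<le> B * z ^ k"
    by (intro tendsto_upperbound[of _ _ "at_right 0"]) auto
  then show ?thesis using z unfolding \<phi>_def by (simp add: norm_mult norm_power mult.commute)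
qed

text \<open>Differentiating z h' + k h = F gives z h'' + (k + 1) h' = F', an equation of the same
  form for h'. Hence the induction raises \<open>k\<close>; the limit condition survives because
  z^(k+1) h' = z^k (F - k h) and h is already bounded.\<close>

lemma symb_weighted_primitive:
  assumes "\<delta> > 0" "k \<ge> (1::nat)"
    and h: "\<And>z. z \<in> {0<..<\<delta>} \<Longrightarrow> (h has_vector_derivative h' z) (at z)"
    and F: "\<And>z. z \<in> {0<..<\<delta>} \<Longrightarrow> of_real z * h' z + of_nat k * h z = F z"
    and lim: "((\<lambda>z. of_real z ^ k * h z) \<longlongrightarrow> 0) (at_right 0)"
  shows "symb (\<lambda>_. 1) {0<..<\<delta>} n F \<Longrightarrow> symb (\<lambda>_. 1) {0<..<\<delta>} n h"
  using assms(2-)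
proof (induction n arbitrary: k h h' F)
  case (0 k h h' F)
  obtain B where "\<And>z. z \<in> {0<..<\<delta>} \<Longrightarrow> norm (F z) \<le> B" using symb_bound[OF 0(1)] by metis
  from weighted_primitive_bound[where \<delta> = \<delta>, OF 0(2-5) this] have "\<forall>z\<in>{0<..<\<delta>}. norm (h z) \<le> B" by blast
  then show ?case by (auto simp: bounded_iff)
next
  case (Suc n k h h' F)
  note prems = Suc.prems
  define F1 where "F1 = (\<lambda>z. vector_derivative F (at z))"
  obtain B where B: "\<And>z. z \<in> {0<..<\<delta>} \<Longrightarrow> norm (F z) \<le> B" using symb_bound[OF prems(1)] by metis
  have hB: "norm (h z) \<le> B" if "z \<in> {0<..<\<delta>}" for z
    using weighted_primitive_bound[where \<delta> = \<delta>, OF prems(2-5) B] that by blast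
  have h'_eq: "h' z = (F z - of_nat k * h z) / of_real z" if "z \<in> {0<..<\<delta>}" for z
    using prems(4)[OF that] that by (auto simp: field_simps)
  have dh': "(h' has_vector_derivative (F1 z - of_nat (Suc k) * h' z) / of_real z) (at z)" if z: "z \<in> {0<..<\<delta>}" for z
  proof -
    have "((\<lambda>z. (F z - of_nat k * h z) * inverse (of_real z)) has_vector_derivative
       ((F z - of_nat k * h z) * (- (inverse (of_real z) ^ 2)) + (F1 z - of_nat k * h' z) * inverse (of_real z))) (at z)"
    proof (rule has_vector_derivative_mult)
      show "((\<lambda>z. F z - of_nat k * h z) has_vector_derivative F1 z - of_nat k * h' z) (at z)"
        unfolding F1_def
        by (intro has_vector_derivative_diff symb_SucD(2)[OF prems(1) z] has_vector_derivative_mult_right prems(3)[OF z])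
      show "((\<lambda>z. inverse (complex_of_real z)) has_vector_derivative - (inverse (of_real z) ^ 2)) (at z)"
        using z by (intro has_vector_derivative_real_field)
          (auto intro!: derivative_eq_intros simp: numeral_2_eq_2)
    qed
    moreover have "(F z - of_nat k * h z) * (- (inverse (of_real z) ^ 2)) + (F1 z - of_nat k * h' z) * inverse (of_real z)
       = (F1 z - of_nat (Suc k) * h' z) / of_real z"
    proof -
      have "F z - of_nat k * h z = of_real z * h' z" using prems(4)[OF z] by (simp add: algebra_simps)
      then show ?thesis using z by (simp add: field_simps power2_eq_square)
    qed
    ultimately have "((\<lambda>z. (F z - of_nat k * h z) * inverse (of_real z)) has_vector_derivative
       (F1 z - of_nat (Suc k) * h' z) / of_real z) (at z)" by simp
    then show ?thesis
      by (subst vector_derivative_cong_open(1)[of "{0<..<\<delta>}" _ "\<lambda>z. (F z - of_nat k * h z) * inverse (of_real z)"])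
         (use z h'_eq in \<open>auto simp: divide_inverse\<close>)
  qed
  have "symb (\<lambda>_. 1) {0<..<\<delta>} n h'"
  proof (rule Suc.IH[of F1 "Suc k" h' "\<lambda>z. (F1 z - of_nat (Suc k) * h' z) / of_real z"])
    show "symb (\<lambda>_. 1) {0<..<\<delta>} n F1" using symb_SucD(3)[OF prems(1)] by (simp add: F1_def)
    show "of_real z * ((F1 z - of_nat (Suc k) * h' z) / of_real z) + of_nat (Suc k) * h' z = F1 z"
      if "z \<in> {0<..<\<delta>}" for z using that by simp
    have "((\<lambda>z. of_real z ^ k * (F z - of_nat k * h z)) \<longlongrightarrow> 0) (at_right 0)"
    proof -
      have "((\<lambda>z::real. z ^ k * (B + of_nat k * B)) \<longlongrightarrow> 0 ^ k * (B + of_nat k * B)) (at_right 0)"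
        by (intro tendsto_intros)
      then have t0: "((\<lambda>z::real. z ^ k * (B + of_nat k * B)) \<longlongrightarrow> 0) (at_right 0)"
        using prems(2) by (simp add: power_0_left)
      have "eventually (\<lambda>z. norm (of_real z ^ k * (F z - of_nat k * h z)) \<le> z ^ k * (B + of_nat k * B)) (at_right 0)"
        unfolding eventually_at_right_field
      proof (intro exI[of _ \<delta>] conjI assms(1) allI impI)
        fix z assume "0 < z" "z < \<delta>"
        then have z: "z \<in> {0<..<\<delta>}" by auto
        have "norm (F z - of_nat k * h z) \<le> B + of_nat k * B"
          using B[OF z] hB[OF z] mult_left_mono[OF hB[OF z], of "of_nat k"]
          by (intro order_trans[OF norm_triangle_ineq4] add_mono) (auto simp: norm_mult)
        then show "norm (of_real z ^ k * (F z - of_nat k * h z)) \<le> z ^ k * (B + of_nat k * B)"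
          using z by (simp add: norm_mult norm_power mult_left_mono)
      qed
      from Lim_null_comparison[OF this t0] show ?thesis .
    qed
    moreover have "eventually (\<lambda>z. of_real z ^ k * (F z - of_nat k * h z) = of_real z ^ Suc k * h' z) (at_right 0)"
      unfolding eventually_at_right_field
      using assms(1) by (intro exI[of _ \<delta>]) (auto simp: h'_eq)
    ultimately show "((\<lambda>z. of_real z ^ Suc k * h' z) \<longlongrightarrow> 0) (at_right 0)"
      by (rule Lim_transform_eventually)
  qed (use dh' in auto)
  moreover have "bounded (h ` {0<..<\<delta>})" using hB by (intro boundedI[of _ B]) auto
  ultimately show ?case
    using prems(3) by (intro symb_SucI[where f' = h']) auto
qed

text \<open>Hadamard's division lemma: with c the limit of f at 0, the quotient h satisfies z h' + h
  = f', so \<open>symb_weighted_primitive\<close> applies with k = 1.\<close>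

lemma smooth_quotient:
  assumes "\<delta> > 0" "\<And>n. symb (\<lambda>_. 1) {0<..<\<delta>} n f"
  obtains c where "\<And>n. symb (\<lambda>_. 1) {0<..<\<delta>} n (\<lambda>z. (f z - c) / of_real z)"
proof -
  define f' where "f' = (\<lambda>z. vector_derivative f (at z))"
  have df: "(f has_vector_derivative f' z) (at z)" if "z \<in> {0<..<\<delta>}" for z
    unfolding f'_def by (rule symb_SucD(2)[OF assms(2) that])
  have sf': "symb (\<lambda>_. 1) {0<..<\<delta>} n f'" for n
    using symb_SucD(3)[OF assms(2)] by (simp add: f'_def)
  obtain B where B: "B > 0" "\<And>z. z \<in> {0<..<\<delta>} \<Longrightarrow> norm (f' z) \<le> B"
    using symb_bound[OF sf'[of 0]] by metis
  have "B-lipschitz_on {0<..<\<delta>} f"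
  proof (rule lipschitz_onI)
    show "dist (f x) (f y) \<le> B * dist x y" if "x \<in> {0<..<\<delta>}" "y \<in> {0<..<\<delta>}" for x y
      unfolding dist_norm
      by (rule vector_derivative_lipschitz_bound[OF _ has_vector_derivative_at_within[OF df] B(2) that]) auto
  qed (use B in auto)
  then have "uniformly_continuous_on {0<..<\<delta>} f" by (rule lipschitz_on_uniformly_continuous)
  moreover have "0 \<in> closure {0<..<\<delta>}" using assms(1) by simp
  ultimately obtain c where "(f \<longlongrightarrow> c) (at 0 within {0<..<\<delta>})"
    by (rule uniformly_continuous_on_extension_at_closure)
  moreover have "at 0 within {0<..<\<delta>} = at_right 0"
    using assms(1) by (intro at_within_nhd[of 0 "{..<\<delta>}"]) auto
  ultimately have lim: "(f \<longlongrightarrow> c) (at_right 0)" by simp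
  show ?thesis
  proof (rule that[of c], rule symb_weighted_primitive[OF assms(1) order_refl _ _ _ sf'])
    fix z assume z: "z \<in> {0<..<\<delta>}"
    show "((\<lambda>z. (f z - c) / of_real z) has_vector_derivative (f' z - (f z - c) / of_real z) / of_real z) (at z)"
    proof -
      have "((\<lambda>z. (f z - c) * inverse (of_real z)) has_vector_derivative
         ((f z - c) * (- (inverse (of_real z) ^ 2)) + f' z * inverse (of_real z))) (at z)"
      proof (rule has_vector_derivative_mult)
        show "((\<lambda>z. f z - c) has_vector_derivative f' z) (at z)"
          using has_vector_derivative_diff[OF df[OF z] has_vector_derivative_const[of c]] by simp
        show "((\<lambda>z. inverse (complex_of_real z)) has_vector_derivative - (inverse (of_real z) ^ 2)) (at z)"
          using z by (intro has_vector_derivative_real_field)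
            (auto intro!: derivative_eq_intros simp: numeral_2_eq_2)
      qed
      then show ?thesis using z by (simp add: field_simps power2_eq_square)
    qed
    show "of_real z * ((f' z - (f z - c) / of_real z) / of_real z) + of_nat 1 * ((f z - c) / of_real z) = f' z"
      using z by (simp add: field_simps)
  next
    have "((\<lambda>z. f z - c) \<longlongrightarrow> c - c) (at_right 0)" by (intro tendsto_intros lim)
    then have "((\<lambda>z. f z - c) \<longlongrightarrow> 0) (at_right 0)" by simp
    moreover have "eventually (\<lambda>z. f z - c = of_real z ^ 1 * ((f z - c) / of_real z)) (at_right 0)"
      unfolding eventually_at_right_field by (intro exI[of _ 1]) auto
    ultimately show "((\<lambda>z. of_real z ^ 1 * ((f z - c) / of_real z)) \<longlongrightarrow> 0) (at_right 0)"
      by (rule Lim_transform_eventually)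
  qed
qed

text \<open>Repeated division by z instead of Taylor's formula: each remainder then has bounded
  derivatives of all orders near 0, and later estimates do differentiate the remainders.\<close>

lemma taylor_remainders:
  assumes "\<delta> > 0" "\<And>n. symb (\<lambda>_. 1) {0<..<\<delta>} n f"
  obtains c :: "nat \<Rightarrow> complex" and g :: "nat \<Rightarrow> real \<Rightarrow> complex"
  where "\<And>N n. symb (\<lambda>_. 1) {0<..<\<delta>} n (g N)"
    "\<And>N z. z \<in> {0<..<\<delta>} \<Longrightarrow> f z = (\<Sum>i<N. c i * of_real z ^ i) + of_real z ^ N * g N z"
proof -
  \<comment> \<open>The constant is chosen as a function of \<open>f\<close>, so that the division
    can be iterated by primitive recursion.\<close>
  define q where "q = (\<lambda>f. SOME c. \<forall>n. symb (\<lambda>_. 1) {0<..<\<delta>} n (\<lambda>z. (f z - c) / of_real z))"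
  define g where "g = rec_nat f (\<lambda>_ h z. (h z - q h) / complex_of_real z)"
  define c where "c = (\<lambda>N. q (g N))"
  have g0: "g 0 = f" and gS: "g (Suc N) = (\<lambda>z. (g N z - c N) / complex_of_real z)" for N
    by (simp_all add: g_def c_def)
  have sg: "\<forall>n. symb (\<lambda>_. 1) {0<..<\<delta>} n (g N)" for N
  proof (induction N)
    case 0
    then show ?case using assms(2) by (simp add: g0)
  next
    case (Suc N)
    have "\<exists>c. \<forall>n. symb (\<lambda>_. 1) {0<..<\<delta>} n (\<lambda>z. (g N z - c) / of_real z)"
      using smooth_quotient[OF assms(1), of "g N"] Suc by metis
    from someI_ex[OF this] show ?case unfolding gS c_def q_def .
  qed
  have "f z = (\<Sum>i<N. c i * of_real z ^ i) + of_real z ^ N * g N z" if "z \<in> {0<..<\<delta>}" for z N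
  proof (induction N)
    case (Suc N)
    have "of_real z ^ N * g N z = c N * of_real z ^ N + of_real z ^ Suc N * g (Suc N) z"
      using that by (simp add: gS field_simps)
    then show ?case using Suc by simp
  qed (simp add: g0)
  then show ?thesis using that sg by blast
qed

section \<open>Regularised oscillatory integrals\<close>

definition bsym :: "(real \<Rightarrow> complex) \<Rightarrow> bool" where
  "bsym b \<longleftrightarrow> (\<forall>n. symb (\<lambda>z. z * (1 - z)) {0<..<1} n b)"

definition mon :: "int \<Rightarrow> int \<Rightarrow> real \<Rightarrow> real" where
  "mon i j z = z powi i * (1 - z) powi j"

text \<open>Integer weights suffice: for complex powers of z and 1 - z the exponents are rounded,
  and the remaining powers are absorbed by the conormal factor, see
  \<open>bsym_exp_ln\<close>.\<close>

definition wsym :: "int \<Rightarrow> int \<Rightarrow> (real \<Rightarrow> complex) \<Rightarrow> bool" where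
  "wsym i j f \<longleftrightarrow> (\<exists>b. bsym b \<and> (\<forall>z\<in>{0<..<1}. f z = of_real (mon i j z) * b z))"

lemma bsymD: "bsym b \<Longrightarrow> symb (\<lambda>z. z * (1 - z)) {0<..<1} n b"
  by (simp add: bsym_def)

lemma bsym_const [intro]: "bsym (\<lambda>_. c)"
  by (auto simp: bsym_def)

lemma bsym_add: "bsym f \<Longrightarrow> bsym g \<Longrightarrow> bsym (\<lambda>z. f z + g z)"
  by (simp add: bsym_def symb_add)

lemma bsym_mult: "bsym f \<Longrightarrow> bsym g \<Longrightarrow> bsym (\<lambda>z. f z * g z)"
  by (simp add: bsym_def symb_mult)

lemma bsym_power: "bsym f \<Longrightarrow> bsym (\<lambda>z. f z ^ k)"
  by (simp add: bsym_def symb_power)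

lemma bsym_z: "bsym (\<lambda>z. of_real z)"
  unfolding bsym_def
proof
  fix n show "symb (\<lambda>z. z * (1 - z)) {0<..<1} n (\<lambda>z. of_real z)"
  proof (induction n)
    case 0
    show ?case by (simp, rule boundedI[of _ 1]) auto
  next
    case (Suc n)
    have "symb (\<lambda>z. z * (1 - z)) {0<..<1} n (\<lambda>z. of_real z * (1 - of_real z))"
      by (intro symb_mult symb_diff Suc) auto
    moreover have "bounded (complex_of_real ` {0<..<1})" by (rule boundedI[of _ 1]) auto
    moreover have "(complex_of_real has_vector_derivative 1) (at x)" for x
      by (simp add: has_vector_derivative_complex_iff)
    ultimately show ?case by (intro symb_SucI[where f' = "\<lambda>_. 1"]) auto
  qed
qed

lemma bsym_z': "bsym (\<lambda>z. of_real (1 - z))"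
  using bsym_add[OF bsym_const[of 1] bsym_mult[OF bsym_const[of "-1"] bsym_z]] by simp

lemma bsym_deriv:
  assumes "bsym b"
  shows "bsym (\<lambda>z. of_real (z * (1 - z)) * vector_derivative b (at z))"
    and "z \<in> {0<..<1} \<Longrightarrow> (b has_vector_derivative vector_derivative b (at z)) (at z)"
  using symb_SucD(2,3)[OF bsymD[OF assms]] by (auto simp: bsym_def)

lemma bsym_bound:
  assumes "bsym b"
  obtains B where "B > 0" "\<And>z. z \<in> {0<..<1} \<Longrightarrow> norm (b z) \<le> B"
  using symb_bound[OF bsymD[OF assms]] by metis

lemma mon_add: "z \<in> {0<..<1} \<Longrightarrow> mon (i + i') (j + j') z = mon i j z * mon i' j' z"
  by (simp add: mon_def power_int_add)

lemma mon_nat: "mon (int i) (int j) z = z ^ i * (1 - z) ^ j"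
  by (simp add: mon_def)

lemma wsymI: "bsym b \<Longrightarrow> (\<And>z. z \<in> {0<..<1} \<Longrightarrow> f z = of_real (mon i j z) * b z) \<Longrightarrow> wsym i j f"
  unfolding wsym_def by blast

lemma wsymE:
  assumes "wsym i j f"
  obtains b where "bsym b" "\<And>z. z \<in> {0<..<1} \<Longrightarrow> f z = of_real (mon i j z) * b z"
  using assms unfolding wsym_def by blast

lemma wsym_cong: "(\<And>z. z \<in> {0<..<1} \<Longrightarrow> f z = g z) \<Longrightarrow> wsym i j f \<longleftrightarrow> wsym i j g"
  unfolding wsym_def by simp

lemma bsym_imp_wsym: "bsym b \<Longrightarrow> wsym 0 0 b"
  by (rule wsymI) (auto simp: mon_def)

lemma wsym_mon: "wsym i j (\<lambda>z. of_real (mon i j z))"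
  by (rule wsymI[OF bsym_const[of 1]]) auto

lemma wsym_mult:
  assumes "wsym i j f" "wsym i' j' g"
  shows "wsym (i + i') (j + j') (\<lambda>z. f z * g z)"
proof -
  obtain b b' where "bsym b" "\<And>z. z \<in> {0<..<1} \<Longrightarrow> f z = of_real (mon i j z) * b z"
    "bsym b'" "\<And>z. z \<in> {0<..<1} \<Longrightarrow> g z = of_real (mon i' j' z) * b' z"
    using assms by (metis wsymE)
  then show ?thesis by (intro wsymI[OF bsym_mult[of b b']]) (auto simp: mon_add)
qed

lemma wsym_mult': "wsym i j f \<Longrightarrow> wsym i' j' g \<Longrightarrow> k = i + i' \<Longrightarrow> l = j + j' \<Longrightarrow> wsym k l (\<lambda>z. f z * g z)"
  using wsym_mult by simp

lemma wsym_cmult: "wsym i j f \<Longrightarrow> wsym i j (\<lambda>z. c * f z)"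
  using wsym_mult[OF bsym_imp_wsym[OF bsym_const[of c]], of i j f] by simp

lemma wsym_add:
  assumes "wsym i j f" "wsym i j g"
  shows "wsym i j (\<lambda>z. f z + g z)"
proof -
  obtain b b' where "bsym b" "\<And>z. z \<in> {0<..<1} \<Longrightarrow> f z = of_real (mon i j z) * b z"
    "bsym b'" "\<And>z. z \<in> {0<..<1} \<Longrightarrow> g z = of_real (mon i j z) * b' z"
    using assms by (metis wsymE)
  then show ?thesis by (intro wsymI[OF bsym_add[of b b']]) (auto simp: algebra_simps)
qed

lemma wsym_diff: "wsym i j f \<Longrightarrow> wsym i j g \<Longrightarrow> wsym i j (\<lambda>z. f z - g z)"
  using wsym_add[of i j f "\<lambda>z. (-1) * g z"] wsym_cmult[of i j g "-1"] by simp

lemma wsym_weaken: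
  assumes "wsym i j f" "i' \<le> i" "j' \<le> j"
  shows "wsym i' j' f"
proof -
  obtain b where b: "bsym b" "\<And>z. z \<in> {0<..<1} \<Longrightarrow> f z = of_real (mon i j z) * b z"
    using assms by (metis wsymE)
  show ?thesis
  proof (rule wsymI[of "\<lambda>z. (of_real z ^ nat (i - i') * of_real (1 - z) ^ nat (j - j')) * b z"])
    show "bsym (\<lambda>z. (of_real z ^ nat (i - i') * of_real (1 - z) ^ nat (j - j')) * b z)"
      by (intro bsym_mult bsym_power bsym_z bsym_z' b)
    fix z :: real assume z: "z \<in> {0<..<1}"
    have "mon i j z = mon i' j' z * mon (int (nat (i - i'))) (int (nat (j - j'))) z"
      using assms z by (subst mon_add[symmetric]) auto
    then have "mon i j z = mon i' j' z * (z ^ nat (i - i') * (1 - z) ^ nat (j - j'))"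
      unfolding mon_nat .
    then show "f z = of_real (mon i' j' z) * ((of_real z ^ nat (i - i') * of_real (1 - z) ^ nat (j - j')) * b z)"
      using b(2)[OF z] by simp
  qed
qed

lemma mon_deriv:
  assumes "z \<in> {0<..<1}"
  shows "(mon i j has_real_derivative mon (i-1) (j-1) z * (of_int i * (1 - z) - of_int j * z)) (at z)"
proof -
  have "((\<lambda>z. z powi i * (1 - z) powi j) has_real_derivative
      (z powi i * (of_int j * (1 - z) powi (j - 1) * (-1)) + of_int i * z powi (i - 1) * 1 * (1 - z) powi j)) (at z)"
    using assms by (auto intro!: derivative_eq_intros)
  moreover have "z powi i = z powi (i - 1) * z" "(1 - z) powi j = (1 - z) powi (j - 1) * (1 - z)"
    using assms power_int_add[of z "i-1" 1] power_int_add[of "1-z" "j-1" 1] by auto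
  ultimately show ?thesis unfolding mon_def by (simp add: algebra_simps)
qed

lemma wsym_deriv_aux:
  assumes "bsym b" "z \<in> {0<..<1}"
  shows "((\<lambda>z. of_real (mon i j z) * b z) has_vector_derivative
     of_real (mon (i-1) (j-1) z) * (of_int i * of_real (1 - z) * b z +
       (- of_int j * of_real z * b z + of_real (z * (1 - z)) * vector_derivative b (at z)))) (at z)"
proof -
  have "((\<lambda>z. complex_of_real (mon i j z)) has_vector_derivative
      of_real (mon (i-1) (j-1) z * (of_int i * (1 - z) - of_int j * z))) (at z)"
    using mon_deriv[OF assms(2)] by (simp add: has_vector_derivative_complex_iff
          has_real_derivative_iff_has_vector_derivative)
  from has_vector_derivative_mult[OF this bsym_deriv(2)[OF assms]]
  have "((\<lambda>z. of_real (mon i j z) * b z) has_vector_derivative of_real (mon i j z) * vector_derivative b (at z) +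
     of_real (mon (i-1) (j-1) z * (of_int i * (1 - z) - of_int j * z)) * b z) (at z)" .
  moreover have "mon i j z = mon (i-1) (j-1) z * (z * (1 - z))"
    using mon_add[OF assms(2), of "i-1" 1 "j-1" 1] by (simp add: mon_def)
  ultimately show ?thesis by (simp add: algebra_simps)
qed

lemma wsym_has_deriv:
  assumes "wsym i j f" "z \<in> {0<..<1}"
  shows "(f has_vector_derivative vector_derivative f (at z)) (at z)"
proof -
  obtain b where b: "bsym b" "\<And>z. z \<in> {0<..<1} \<Longrightarrow> f z = of_real (mon i j z) * b z"
    using assms by (metis wsymE)
  have "f differentiable (at z)"
    using vector_derivative_cong_open(3)[of "{0<..<1}" f "\<lambda>z. of_real (mon i j z) * b z", OF _ b(2) assms(2)]
      differentiableI_vector[OF wsym_deriv_aux[OF b(1) assms(2), of i j]] by simp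
  then show ?thesis by (simp add: vector_derivative_works[symmetric])
qed

lemma wsym_vector_derivative:
  assumes "wsym i j f"
  shows "wsym (i-1) (j-1) (\<lambda>z. vector_derivative f (at z))"
proof -
  obtain b where b: "bsym b" "\<And>z. z \<in> {0<..<1} \<Longrightarrow> f z = of_real (mon i j z) * b z"
    using assms by (metis wsymE)
  show ?thesis
  proof (rule wsymI)
    show "bsym (\<lambda>z. of_int i * of_real (1 - z) * b z +
       (- of_int j * of_real z * b z + of_real (z * (1 - z)) * vector_derivative b (at z)))"
      by (intro bsym_add bsym_mult bsym_const bsym_z' bsym_z b bsym_deriv(1))
    fix z :: real assume z: "z \<in> {0<..<1}"
    show "vector_derivative f (at z) = of_real (mon (i - 1) (j - 1) z) * (of_int i * of_real (1 - z) * b z +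
       (- of_int j * of_real z * b z + of_real (z * (1 - z)) * vector_derivative b (at z)))"
      using vector_derivative_cong_open(2)[of "{0<..<1}" f "\<lambda>z. of_real (mon i j z) * b z" z] b(2) z
        vector_derivative_at[OF wsym_deriv_aux[OF b(1) z]] by auto
  qed
qed

text \<open>\<open>osc \<kappa>\<close> is an eigenfunction of this field with eigenvalue i
  \<kappa>. Each application trades one power of z for one power of 1 - z, so integration by parts
  improves convergence at the irregular point at the expense of the order of vanishing at 0.\<close>

definition dd :: "(real \<Rightarrow> complex) \<Rightarrow> real \<Rightarrow> complex" where
  "dd f z = of_real ((1 - z)\<^sup>2) * vector_derivative f (at z)"

lemma dd_cong:
  assumes "\<And>z. z \<in> {0<..<1} \<Longrightarrow> f z = g z" "z \<in> {0<..<1}"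
  shows "dd f z = dd g z"
  using vector_derivative_cong_open(2)[of "{0<..<1}" f g z] assms by (simp add: dd_def)

lemma dd_pow_cong:
  assumes "\<And>z. z \<in> {0<..<1} \<Longrightarrow> f z = g z" "z \<in> {0<..<1}"
  shows "(dd ^^ J) f z = (dd ^^ J) g z"
  using assms(2)
proof (induction J arbitrary: z)
  case (Suc J)
  then show ?case using dd_cong[of "(dd ^^ J) f" "(dd ^^ J) g"] by auto
qed (use assms in auto)

lemma dd_wsym: "wsym i j f \<Longrightarrow> wsym (i - 1) (j + 1) (dd f)"
  unfolding dd_def
  by (rule wsym_mult'[OF _ wsym_vector_derivative, where i = 0 and j = 2])
    (auto intro!: wsymI[OF bsym_const[of 1]] simp: mon_def)

lemma dd_pow_wsym: "wsym i j f \<Longrightarrow> wsym (i - int J) (j + int J) ((dd ^^ J) f)"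
proof (induction J)
  case (Suc J)
  from dd_wsym[OF Suc.IH[OF Suc.prems]] show ?case by (simp add: algebra_simps)
qed simp

lemma dd_lin:
  assumes "wsym i j f" "wsym i j g" "z \<in> {0<..<1}"
  shows "dd (\<lambda>z. a * f z + b * g z) z = a * dd f z + b * dd g z"
proof -
  have "((\<lambda>z. a * f z + b * g z) has_vector_derivative
     a * vector_derivative f (at z) + b * vector_derivative g (at z)) (at z)"
    by (intro has_vector_derivative_add has_vector_derivative_mult_right
        wsym_has_deriv[OF assms(1,3)] wsym_has_deriv[OF assms(2,3)])
  from vector_derivative_at[OF this] show ?thesis by (simp add: dd_def algebra_simps)
qed

lemma dd_pow_lin:
  assumes "wsym i j f" "wsym i j g" "z \<in> {0<..<1}"
  shows "(dd ^^ J) (\<lambda>z. a * f z + b * g z) z = a * (dd ^^ J) f z + b * (dd ^^ J) g z"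
  using assms(3)
proof (induction J arbitrary: z)
  case (Suc J)
  have "(dd ^^ Suc J) (\<lambda>z. a * f z + b * g z) z = dd (\<lambda>z. a * (dd ^^ J) f z + b * (dd ^^ J) g z) z"
    using dd_cong[of "(dd ^^ J) (\<lambda>z. a * f z + b * g z)" "\<lambda>z. a * (dd ^^ J) f z + b * (dd ^^ J) g z" z]
      Suc by simp
  also have "\<dots> = a * (dd ^^ Suc J) f z + b * (dd ^^ Suc J) g z"
    using dd_lin[OF dd_pow_wsym[OF assms(1)] dd_pow_wsym[OF assms(2)] Suc.prems] by simp
  finally show ?case .
qed simp


section \<open>The oscillating factor and continuity of the integrands up to the endpoints\<close>

definition osc :: "real \<Rightarrow> real \<Rightarrow> complex" where
  "osc \<kappa> z = exp (\<i> * of_real (\<kappa> / (1 - z)))"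

lemma norm_osc [simp]: "norm (osc \<kappa> z) = 1"
  by (simp add: osc_def)

lemma osc_deriv:
  assumes "z \<noteq> 1"
  shows "(osc \<kappa> has_vector_derivative osc \<kappa> z * (\<i> * of_real (\<kappa> / (1 - z)\<^sup>2))) (at z)"
proof -
  have "((\<lambda>z. \<kappa> / (1 - z)) has_real_derivative \<kappa> / (1 - z)\<^sup>2) (at z)"
    using assms by (auto intro!: derivative_eq_intros simp: power2_eq_square)
  then have "((\<lambda>z. complex_of_real (\<kappa> / (1 - z))) has_vector_derivative of_real (\<kappa> / (1 - z)\<^sup>2)) (at z)"
    by (simp add: has_vector_derivative_complex_iff has_real_derivative_iff_has_vector_derivative)
  from has_vector_derivative_mult_right[OF this, of \<i>]
  have "((\<lambda>z. \<i> * of_real (\<kappa> / (1 - z))) has_vector_derivative \<i> * of_real (\<kappa> / (1 - z)\<^sup>2)) (at z)" .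
  from field_vector_diff_chain_at[OF this DERIV_exp]
  show ?thesis unfolding osc_def o_def by (simp add: mult.commute)
qed

lemma continuous_on_extend_zero:
  fixes f :: "real \<Rightarrow> complex"
  assumes "continuous_on {0<..<1} f" "\<And>z. z \<in> {0<..<1} \<Longrightarrow> norm (f z) \<le> B * (z * (1 - z))"
  shows "continuous_on {0..1} (\<lambda>z. if z \<in> {0<..<1} then f z else 0)" (is "continuous_on _ ?K")
  unfolding continuous_on_eq_continuous_within
proof
  fix x :: real assume x: "x \<in> {0..1}"
  show "continuous (at x within {0..1}) ?K"
  proof (cases "x \<in> {0<..<1}")
    case True
    have "continuous_on {0<..<1} ?K" using assms(1) by (rule continuous_on_eq) auto
    then have "isCont ?K x" using True continuous_on_eq_continuous_at open_greaterThanLessThan by blast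
    then show ?thesis by (rule continuous_at_imp_continuous_at_within)
  next
    case False
    then have x01: "x = 0 \<or> x = 1" using x by auto
    have "((\<lambda>z. B * (z * (1 - z))) \<longlongrightarrow> B * (x * (1 - x))) (at x within {0..1})"
      by (intro tendsto_intros)
    then have "((\<lambda>z. B * (z * (1 - z))) \<longlongrightarrow> 0) (at x within {0..1})" using x01 by auto
    moreover have "eventually (\<lambda>z. norm (?K z) \<le> B * (z * (1 - z))) (at x within {0..1})"
      unfolding eventually_at_filter
    proof (intro always_eventually allI impI)
      fix z :: real assume "z \<in> {0..1}"
      then consider "z \<in> {0<..<1}" | "z = 0" | "z = 1" by fastforce
      then show "norm (?K z) \<le> B * (z * (1 - z))" by cases (use assms(2)[of z] in auto)
    qed
    ultimately have "(?K \<longlongrightarrow> 0) (at x within {0..1})" by (rule Lim_null_comparison[rotated])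
    then show ?thesis using x01 by (auto simp: continuous_within)
  qed
qed

lemma wsym_continuous_on: "wsym i j f \<Longrightarrow> continuous_on {0<..<1} f"
  using wsym_has_deriv has_vector_derivative_continuous
  by (intro continuous_at_imp_continuous_on ballI) blast

lemma wsym_bound:
  assumes "wsym (int i) (int j) f"
  obtains B where "B > 0" "\<And>z. z \<in> {0<..<1} \<Longrightarrow> norm (f z) \<le> B * (z ^ i * (1 - z) ^ j)"
proof -
  obtain b where b: "bsym b" "\<And>z. z \<in> {0<..<1} \<Longrightarrow> f z = of_real (mon (int i) (int j) z) * b z"
    using assms by (metis wsymE)
  obtain B where B: "B > 0" "\<And>z. z \<in> {0<..<1} \<Longrightarrow> norm (b z) \<le> B" using bsym_bound[OF b(1)] by metis
  show ?thesis
  proof (rule that[OF B(1)])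
    fix z :: real assume z: "z \<in> {0<..<1}"
    have "norm (f z) = (z ^ i * (1 - z) ^ j) * norm (b z)"
      using z b(2)[OF z] by (simp add: mon_nat norm_mult norm_power del: of_real_mult of_real_power)
    also have "\<dots> \<le> (z ^ i * (1 - z) ^ j) * B" using z B(2)[OF z] by (intro mult_left_mono) auto
    finally show "norm (f z) \<le> B * (z ^ i * (1 - z) ^ j)" by (simp add: mult.commute)
  qed
qed

lemma osc_continuous_on: "continuous_on {0<..<1} (osc \<kappa>)"
  by (intro continuous_at_imp_continuous_on ballI has_vector_derivative_continuous[OF osc_deriv]) auto

lemma osc_wsym_continuous_on:
  assumes "wsym 1 1 f"
  shows "continuous_on {0..1} (\<lambda>z. if z \<in> {0<..<1} then osc \<kappa> z * f z else 0)"
proof -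
  obtain B where "\<And>z. z \<in> {0<..<1} \<Longrightarrow> norm (f z) \<le> B * (z ^ 1 * (1 - z) ^ 1)"
    using wsym_bound[of 1 1 f] assms by auto
  then show ?thesis
    by (intro continuous_on_extend_zero[of _ B] continuous_on_mult osc_continuous_on wsym_continuous_on[OF assms])
      (auto simp: norm_mult)
qed

text \<open>
  The oscillatory integral of \<open>f\<close> with respect to \<open>dz / (1 - z)\<^sup>2\<close>, made convergent by \<open>J\<close> formal
  integrations by parts; the resulting factor \<open>(i / \<kappa>)\<^sup>J\<close> is dropped.
\<close>

definition reg_int :: "real \<Rightarrow> nat \<Rightarrow> (real \<Rightarrow> complex) \<Rightarrow> complex" where
  "reg_int \<kappa> J f = integral {0..1} (\<lambda>z. osc \<kappa> z * ((dd ^^ J) f z / of_real ((1 - z)\<^sup>2)))"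

lemma osc_wsym_integrable:
  assumes "wsym 1 1 f"
  shows "(\<lambda>z. osc \<kappa> z * f z) integrable_on {0..1}"
proof -
  have "(\<lambda>z. if z \<in> {0<..<1} then osc \<kappa> z * f z else 0) integrable_on {0..1}"
    using integrable_continuous_interval[OF osc_wsym_continuous_on[OF assms]] .
  then show ?thesis
    by (rule integrable_spike_finite[of "{0,1}", rotated 2]) auto
qed

lemma wsym_divide_square:
  "wsym i j f \<Longrightarrow> wsym i (j - 2) (\<lambda>z. f z / of_real ((1 - z)\<^sup>2))"
proof -
  assume "wsym i j f"
  then have "wsym i (j - 2) (\<lambda>z. of_real (mon 0 (-2) z) * f z)"
    by (rule wsym_mult'[OF wsym_mon]) auto
  then show ?thesis
    by (rule wsym_cong[THEN iffD1, rotated]) (auto simp: mon_def power_int_minus divide_inverse)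
qed

lemma reg_int_lin:
  assumes "wsym i j f" "wsym i j g" "i \<ge> int J + 1" "j + int J \<ge> 3"
  shows "reg_int \<kappa> J (\<lambda>z. a * f z + b * g z) = a * reg_int \<kappa> J f + b * reg_int \<kappa> J g"
proof -
  have int: "(\<lambda>z. osc \<kappa> z * ((dd ^^ J) f z / of_real ((1 - z)\<^sup>2))) integrable_on {0..1}"
    if "wsym i j f" for f
    by (intro osc_wsym_integrable wsym_weaken[OF wsym_divide_square[OF dd_pow_wsym[OF that]]])
       (use assms(3,4) in auto)
  have "((\<lambda>z. a * (osc \<kappa> z * ((dd ^^ J) f z / of_real ((1 - z)\<^sup>2))) +
          b * (osc \<kappa> z * ((dd ^^ J) g z / of_real ((1 - z)\<^sup>2)))) has_integral
          (a * reg_int \<kappa> J f + b * reg_int \<kappa> J g)) {0..1}"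
    unfolding reg_int_def
    by (intro has_integral_add has_integral_mult_right integrable_integral int assms(1,2))
  then have "((\<lambda>z. osc \<kappa> z * ((dd ^^ J) (\<lambda>z. a * f z + b * g z) z / of_real ((1 - z)\<^sup>2))) has_integral
          (a * reg_int \<kappa> J f + b * reg_int \<kappa> J g)) {0..1}"
  proof (rule has_integral_spike_finite[of "{0,1}", rotated 2])
    fix z :: real assume "z \<in> {0..1} - {0,1}"
    then have "z \<in> {0<..<1}" by auto
    from dd_pow_lin[OF assms(1,2) this, of J a b]
    show "osc \<kappa> z * ((dd ^^ J) (\<lambda>z. a * f z + b * g z) z / of_real ((1 - z)\<^sup>2)) =
       a * (osc \<kappa> z * ((dd ^^ J) f z / of_real ((1 - z)\<^sup>2))) +
          b * (osc \<kappa> z * ((dd ^^ J) g z / of_real ((1 - z)\<^sup>2)))"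
      by (simp add: add_divide_distrib algebra_simps)
  qed auto
  then show ?thesis unfolding reg_int_def by (rule integral_unique)
qed

lemma reg_int_cong:
  assumes "\<And>z. z \<in> {0<..<1} \<Longrightarrow> f z = g z"
  shows "reg_int \<kappa> J f = reg_int \<kappa> J g"
  unfolding reg_int_def
proof (rule integral_spike[of "{0,1}"])
  fix z :: real assume "z \<in> {0..1} - {0,1}"
  then have "z \<in> {0<..<1}" by auto
  from dd_pow_cong[OF assms this, where J = J]
  show "osc \<kappa> z * ((dd ^^ J) g z / of_real ((1 - z)\<^sup>2)) = osc \<kappa> z * ((dd ^^ J) f z / of_real ((1 - z)\<^sup>2))"
    by simp
qed auto

text \<open>The integrand is the exact derivative of \<open>osc \<kappa> z * (dd ^^ J) f z\<close>,
  and the weight conditions make this function vanish at both ends.\<close>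

lemma reg_int_total:
  assumes "wsym i j f" "i \<ge> int J + 1" "j + int J \<ge> 1"
  shows "reg_int \<kappa> J (\<lambda>z. dd f z + \<i> * of_real \<kappa> * f z) = 0"
proof -
  define F where "F = (dd ^^ J) f"
  have F: "wsym (i - int J) (j + int J) F" unfolding F_def by (rule dd_pow_wsym[OF assms(1)])
  then have F1: "wsym 1 1 F" by (rule wsym_weaken) (use assms in auto)
  define K where "K = (\<lambda>z. if z \<in> {0<..<1} then osc \<kappa> z * F z else 0)"
  have "((\<lambda>z. osc \<kappa> z * vector_derivative F (at z) + osc \<kappa> z * (\<i> * of_real (\<kappa> / (1 - z)\<^sup>2)) * F z)
     has_integral K 1 - K 0) {0..1}"
  proof (rule fundamental_theorem_of_calculus_interior)
    show "continuous_on {0..1} K" unfolding K_def by (rule osc_wsym_continuous_on[OF F1])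
    fix z :: real assume z: "z \<in> {0<..<1}"
    have "((\<lambda>z. osc \<kappa> z * F z) has_vector_derivative
        osc \<kappa> z * vector_derivative F (at z) + osc \<kappa> z * (\<i> * of_real (\<kappa> / (1 - z)\<^sup>2)) * F z) (at z)"
      using z by (intro has_vector_derivative_mult osc_deriv wsym_has_deriv[OF F]) auto
    then show "(K has_vector_derivative osc \<kappa> z * vector_derivative F (at z) + osc \<kappa> z * (\<i> * of_real (\<kappa> / (1 - z)\<^sup>2)) * F z) (at z)"
      using vector_derivative_cong_open(1)[of "{0<..<1}" K "\<lambda>z. osc \<kappa> z * F z" z] z by (simp add: K_def)
  qed auto
  then have "((\<lambda>z. osc \<kappa> z * vector_derivative F (at z) + osc \<kappa> z * (\<i> * of_real (\<kappa> / (1 - z)\<^sup>2)) * F z)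
     has_integral 0) {0..1}" by (simp add: K_def)
  then have "((\<lambda>z. osc \<kappa> z * ((dd ^^ J) (\<lambda>z. dd f z + \<i> * of_real \<kappa> * f z) z / of_real ((1 - z)\<^sup>2))) has_integral 0) {0..1}"
  proof (rule has_integral_spike_finite[of "{0,1}", rotated 2])
    fix z :: real assume "z \<in> {0..1} - {0,1}"
    then have z: "z \<in> {0<..<1}" by auto
    have "(dd ^^ J) (\<lambda>z. dd f z + \<i> * of_real \<kappa> * f z) z = dd F z + \<i> * of_real \<kappa> * F z"
      using dd_pow_lin[OF wsym_weaken[OF dd_wsym[OF assms(1)], of "i-1" j] wsym_weaken[OF assms(1), of "i-1" j] z, of J 1 "\<i> * of_real \<kappa>"]
      by (simp add: F_def funpow_swap1)
    then show "osc \<kappa> z * ((dd ^^ J) (\<lambda>z. dd f z + \<i> * of_real \<kappa> * f z) z / of_real ((1 - z)\<^sup>2)) =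
       osc \<kappa> z * vector_derivative F (at z) + osc \<kappa> z * (\<i> * of_real (\<kappa> / (1 - z)\<^sup>2)) * F z"
      using z by (simp add: dd_def field_simps)
  qed auto
  then show ?thesis unfolding reg_int_def by (rule integral_unique)
qed

text \<open>Compatibility of the regularisations: since total derivatives integrate to zero,
  \<open>dd\<close> may be replaced by -i \<kappa> under the integral. Different \<open>J\<close>
  thus give the same quantity up to powers of this factor.\<close>

lemma reg_int_Suc:
  assumes "wsym i j f" "i \<ge> int J + 2" "j + int J \<ge> 3"
  shows "reg_int \<kappa> (Suc J) f = - \<i> * of_real \<kappa> * reg_int \<kappa> J f"
proof -
  have "reg_int \<kappa> J (\<lambda>z. 1 * dd f z + (\<i> * of_real \<kappa>) * f z) = 1 * reg_int \<kappa> J (dd f) + (\<i> * of_real \<kappa>) * reg_int \<kappa> J f"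
    by (rule reg_int_lin[of "i-1" j]) (use assms in \<open>auto intro!: wsym_weaken[OF dd_wsym[OF assms(1)]] wsym_weaken[OF assms(1)]\<close>)
  moreover have "reg_int \<kappa> J (\<lambda>z. 1 * dd f z + (\<i> * of_real \<kappa>) * f z) = 0"
    using reg_int_total[OF assms(1), of J \<kappa>] assms by simp
  moreover have "reg_int \<kappa> (Suc J) f = reg_int \<kappa> J (dd f)"
    by (simp add: reg_int_def funpow_swap1)
  ultimately show ?thesis by (simp add: add_eq_0_iff)
qed

section \<open>Decay of the regularised moments\<close>

lemma power_div_fact_le_exp: "x \<ge> 0 \<Longrightarrow> x ^ m / fact m \<le> exp (x::real)"
proof -
  assume x: "x \<ge> 0"
  have "(\<Sum>n\<in>{m}. x ^ n /\<^sub>R fact n) \<le> (\<Sum>n. x ^ n /\<^sub>R fact n)"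
    by (rule sum_le_suminf) (use x exp_converges[of x] in \<open>auto simp: sums_iff\<close>)
  then show ?thesis using exp_converges[of x] by (simp add: sums_iff divide_inverse mult.commute)
qed

text \<open>From z <= exp (-(1 - z)) and x^m / m! <= exp x with x = n (1 - z).\<close>

lemma power_mult_power_le:
  assumes "z \<in> {0<..<(1::real)}" "n \<ge> 1"
  shows "z ^ n * (1 - z) ^ m \<le> fact m / real n ^ m"
proof -
  have "z = exp (ln z)" using assms by auto
  also have "\<dots> \<le> exp (- (1 - z))" using assms ln_le_minus_one[of z] by (subst exp_le_cancel_iff) auto
  finally have "z ^ n \<le> exp (- (1 - z)) ^ n" using assms by (intro power_mono) auto
  also have "\<dots> = exp (- (real n * (1 - z)))" by (simp add: algebra_simps flip: exp_of_nat_mult)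
  finally have "z ^ n * exp (real n * (1 - z)) \<le> exp (- (real n * (1 - z))) * exp (real n * (1 - z))"
    by (rule mult_right_mono) simp
  then have 1: "z ^ n * exp (real n * (1 - z)) \<le> 1"
    by (simp flip: exp_add)
  have "(real n * (1 - z)) ^ m / fact m \<le> exp (real n * (1 - z))"
    using assms by (intro power_div_fact_le_exp) auto
  then have "z ^ n * ((real n * (1 - z)) ^ m / fact m) \<le> z ^ n * exp (real n * (1 - z))"
    using assms by (intro mult_left_mono) auto
  with 1 have "z ^ n * ((real n * (1 - z)) ^ m / fact m) \<le> 1" by linarith
  then have "z ^ n * (real n ^ m * (1 - z) ^ m / fact m) \<le> 1" by (simp only: power_mult_distrib)
  then show ?thesis using assms by (simp add: divide_simps mult_ac)
qed

text \<open>
  Each integration by parts gains one power of \<open>1 / n\<close>: a derivative falling on \<open>z\<^sup>n\<close> costs a factor \<open>n\<close>, but comes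
  with \<open>(1 - z)\<^sup>2\<close>, which is of size \<open>n\<^sup>-\<^sup>2\<close> where \<open>z\<^sup>n\<close> is not small.
\<close>

lemma reg_int_decay:
  assumes "bsym b" "j + int J \<ge> 3"
  shows "\<exists>C. \<forall>n\<ge>J + 1. norm (reg_int \<kappa> J (\<lambda>z. of_real (mon (int n) j z) * b z)) \<le> C / real n ^ nat (j + int J - 2)"
  using assms
proof (induction J arbitrary: j b)
  case (0 j b)
  obtain B where B: "B > 0" "\<And>z. z \<in> {0<..<1} \<Longrightarrow> norm (b z) \<le> B" using bsym_bound[OF 0(1)] by metis
  define m where "m = nat (j - 2)"
  have j: "j = int (m + 2)" using 0 by (simp add: m_def)
  have "norm (reg_int \<kappa> 0 (\<lambda>z. of_real (mon (int n) j z) * b z)) \<le> (B * fact m) / real n ^ m" if n: "n \<ge> 1" for n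
  proof -
    define g where "g = (\<lambda>z. osc \<kappa> z * ((of_real (mon (int n) j z) * b z) / of_real ((1 - z)\<^sup>2)))"
    have "wsym (int n) j (\<lambda>z. of_real (mon (int n) j z) * b z)" by (rule wsymI[OF 0(1)]) auto
    from wsym_divide_square[OF this]
    have "wsym 1 1 (\<lambda>z. (of_real (mon (int n) j z) * b z) / of_real ((1 - z)\<^sup>2))"
      by (rule wsym_weaken) (use n 0 in auto)
    then have "g integrable_on {0..1}" unfolding g_def by (rule osc_wsym_integrable)
    then have "(g has_integral reg_int \<kappa> 0 (\<lambda>z. of_real (mon (int n) j z) * b z)) (cbox 0 1)"
      unfolding reg_int_def g_def by (simp add: integrable_integral)
    then have "norm (reg_int \<kappa> 0 (\<lambda>z. of_real (mon (int n) j z) * b z)) \<le> (B * fact m) / real n ^ m * measure lborel (cbox 0 (1::real))"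
    proof (rule has_integral_bound_spike_finite[of _ "{0,1}", rotated 2])
      fix z :: real assume "z \<in> cbox 0 1 - {0,1}"
      then have z: "z \<in> {0<..<1}" by auto
      have "norm (g z) = z ^ n * (1 - z) ^ m * norm (b z)"
        using z unfolding g_def j mon_nat
        by (simp add: norm_mult norm_divide norm_power power_add power2_eq_square del: of_real_mult of_real_power of_real_diff)
      also have "\<dots> \<le> (fact m / real n ^ m) * B"
        using z n B by (intro mult_mono power_mult_power_le) auto
      finally show "norm (g z) \<le> (B * fact m) / real n ^ m" by (simp add: mult.commute)
    qed (use B in auto)
    then show ?thesis by simp
  qed
  then show ?case unfolding m_def by (intro exI[of _ "B * fact m"]) (auto simp: m_def)
next
  case (Suc J j b)
  define b2 where "b2 = (\<lambda>z. - of_int j * of_real z * b z + of_real (z * (1 - z)) * vector_derivative b (at z))"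
  have b2: "bsym b2" unfolding b2_def
    by (intro bsym_add bsym_mult bsym_const bsym_z' bsym_z Suc.prems bsym_deriv(1))
  \<comment> \<open>The two terms of the derivative have weights j + 2 and j + 1 at z = 1, so with
    \<open>J\<close> integrations left they decay with exponents e + 1 and e; the factor n coming
    from z^n uses up the surplus of the first.\<close>
  define e where "e = nat (j + 1 + int J - 2)"
  obtain C1 where C1: "\<And>n. n \<ge> J + 1 \<Longrightarrow> norm (reg_int \<kappa> J (\<lambda>z. of_real (mon (int n) (j+2) z) * b z)) \<le> C1 / real n ^ nat (j + 2 + int J - 2)"
    using Suc.IH[OF Suc.prems(1), of "j+2"] Suc.prems(2) by auto
  obtain C2 where C2: "\<And>n. n \<ge> J + 1 \<Longrightarrow> norm (reg_int \<kappa> J (\<lambda>z. of_real (mon (int n) (j+1) z) * b2 z)) \<le> C2 / real n ^ nat (j + 1 + int J - 2)"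
    using Suc.IH[OF b2, of "j+1"] Suc.prems(2) by auto
  have e1: "nat (j + 2 + int J - 2) = Suc e" "nat (j + 1 + int J - 2) = e" "nat (j + int (Suc J) - 2) = e"
    using Suc.prems(2) by (simp_all add: e_def)
  note C1 = C1[unfolded e1] and C2 = C2[unfolded e1]
  have "norm (reg_int \<kappa> (Suc J) (\<lambda>z. of_real (mon (int n) j z) * b z)) \<le> (\<bar>C1\<bar> * 2 ^ Suc e + \<bar>C2\<bar> * 2 ^ e) / real n ^ e"
    if n: "n \<ge> Suc J + 1" for n
  proof -
    have n1: "int n - 1 = int (n - 1)" "n - 1 \<ge> J + 1" using n by auto
    have dd_eq: "dd (\<lambda>z. of_real (mon (int n) j z) * b z) z =
        of_nat n * (of_real (mon (int (n - 1)) (j+2) z) * b z) + 1 * (of_real (mon (int (n - 1)) (j+1) z) * b2 z)"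
      if z: "z \<in> {0<..<1}" for z
    proof -
      have m2: "mon (int (n-1)) (j+2) z = mon (int (n-1)) (j-1) z * (1 - z)^3"
           "mon (int (n-1)) (j+1) z = mon (int (n-1)) (j-1) z * (1 - z)^2"
        using mon_add[OF z, of "int (n-1)" 0 "j-1" 3] mon_add[OF z, of "int (n-1)" 0 "j-1" 2] by (simp_all add: mon_def add.commute)
      show ?thesis unfolding dd_def vector_derivative_at[OF wsym_deriv_aux[OF Suc.prems(1) z]] m2 b2_def n1
        by (simp add: algebra_simps power2_eq_square power3_eq_cube)
    qed
    have "reg_int \<kappa> (Suc J) (\<lambda>z. of_real (mon (int n) j z) * b z) = reg_int \<kappa> J (dd (\<lambda>z. of_real (mon (int n) j z) * b z))"
      by (simp add: reg_int_def funpow_swap1)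
    also have "\<dots> = reg_int \<kappa> J (\<lambda>z. of_nat n * (of_real (mon (int (n - 1)) (j+2) z) * b z) + 1 * (of_real (mon (int (n - 1)) (j+1) z) * b2 z))"
      by (rule reg_int_cong) (rule dd_eq)
    also have "\<dots> = of_nat n * reg_int \<kappa> J (\<lambda>z. of_real (mon (int (n - 1)) (j+2) z) * b z) + 1 * reg_int \<kappa> J (\<lambda>z. of_real (mon (int (n - 1)) (j+1) z) * b2 z)"
    proof (rule reg_int_lin[of "int (n-1)" "j+1"])
      show "wsym (int (n - 1)) (j + 1) (\<lambda>z. of_real (mon (int (n - 1)) (j + 2) z) * b z)"
        by (rule wsym_weaken[of "int (n-1)" "j+2"]) (auto intro: wsymI[OF Suc.prems(1)])
      show "wsym (int (n - 1)) (j + 1) (\<lambda>z. of_real (mon (int (n - 1)) (j + 1) z) * b2 z)"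
        by (auto intro: wsymI[OF b2])
    qed (use n Suc.prems in auto)
    finally have "norm (reg_int \<kappa> (Suc J) (\<lambda>z. of_real (mon (int n) j z) * b z)) \<le>
       norm (of_nat n * reg_int \<kappa> J (\<lambda>z. of_real (mon (int (n - 1)) (j+2) z) * b z)) + norm (reg_int \<kappa> J (\<lambda>z. of_real (mon (int (n - 1)) (j+1) z) * b2 z))"
      by (simp add: norm_triangle_ineq)
    also have "\<dots> \<le> real n * (\<bar>C1\<bar> / real (n-1) ^ Suc e) + \<bar>C2\<bar> / real (n-1) ^ e"
    proof (intro add_mono)
      have "norm (reg_int \<kappa> J (\<lambda>z. of_real (mon (int (n - 1)) (j+2) z) * b z)) \<le> \<bar>C1\<bar> / real (n-1) ^ Suc e"
        by (rule order_trans[OF C1[OF n1(2)]]) (auto intro: divide_right_mono)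
      then show "norm (of_nat n * reg_int \<kappa> J (\<lambda>z. of_real (mon (int (n - 1)) (j+2) z) * b z)) \<le> real n * (\<bar>C1\<bar> / real (n-1) ^ Suc e)"
        unfolding norm_mult norm_of_nat by (rule mult_left_mono) simp
      show "norm (reg_int \<kappa> J (\<lambda>z. of_real (mon (int (n - 1)) (j+1) z) * b2 z)) \<le> \<bar>C2\<bar> / real (n-1) ^ e"
        by (rule order_trans[OF C2[OF n1(2)]]) (auto intro: divide_right_mono)
    qed
    also have "\<dots> \<le> real n * (\<bar>C1\<bar> * (2 / real n) ^ Suc e) + \<bar>C2\<bar> * (2 / real n) ^ e"
    proof -
      have i: "inverse (real (n - 1)) \<le> 2 / real n" using n by (simp add: field_simps of_nat_diff)
      have "\<bar>C\<bar> / real (n-1) ^ k \<le> \<bar>C\<bar> * (2 / real n) ^ k" for C k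
      proof -
        have "\<bar>C\<bar> / real (n-1) ^ k = \<bar>C\<bar> * inverse (real (n-1)) ^ k" by (simp add: divide_inverse power_inverse)
        also have "\<dots> \<le> \<bar>C\<bar> * (2 / real n) ^ k" using i by (intro mult_left_mono power_mono) auto
        finally show ?thesis .
      qed
      from add_mono[OF mult_left_mono[OF this[of C1 "Suc e"], of "real n"] this[of C2 e]]
      show ?thesis by simp
    qed
    also have "\<dots> = (\<bar>C1\<bar> * 2 ^ Suc e + \<bar>C2\<bar> * 2 ^ e) / real n ^ e"
      using n by (simp add: power_divide field_simps)
    finally show ?thesis .
  qed
  then show ?case unfolding e1 by blast
qed

section \<open>Determination of a function by its moments\<close>

lemma moments_zero_real:
  fixes f :: "real \<Rightarrow> real"
  assumes "continuous_on {0..1} f" "\<And>n. integral {0..1} (\<lambda>z. z ^ n * f z) = 0" "x \<in> {0..1}"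
  shows "f x = 0"
proof -
  have int: "(\<lambda>z. z ^ n * f z) integrable_on {0..1}" for n
    by (intro integrable_continuous_interval continuous_intros assms)
  have "compact (f ` {0..1})" by (rule compact_continuous_image[OF assms(1)]) simp
  then obtain M where M: "M > 0" "\<And>z. z \<in> {0..1} \<Longrightarrow> \<bar>f z\<bar> \<le> M"
    using compact_imp_bounded bounded_pos by (metis imageI real_norm_def)
  have "integral {0..1} (\<lambda>z. f z * f z) \<le> e" if e: "e > 0" for e
  proof -
    obtain g where g: "real_polynomial_function g" "\<And>z. z \<in> {0..1} \<Longrightarrow> \<bar>f z - g z\<bar> < e / M"
      using Stone_Weierstrass_real_polynomial_function[of "{0..1}" f "e / M"] assms(1) e M by auto
    obtain a n where gs: "g = (\<lambda>x. \<Sum>i\<le>n. a i * x ^ i)" using g(1) by (auto simp: real_polynomial_function_iff_sum)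
    have "((\<lambda>z. \<Sum>i\<le>n. a i * (z ^ i * f z)) has_integral (\<Sum>i\<le>n. a i * integral {0..1} (\<lambda>z. z ^ i * f z))) {0..1}"
      by (intro has_integral_sum has_integral_mult_right integrable_integral int) auto
    then have gf: "((\<lambda>z. g z * f z) has_integral 0) {0..1}"
      by (simp add: gs assms(2) sum_distrib_right mult.assoc)
    have cg: "continuous_on {0..1} g" unfolding gs by (intro continuous_intros)
    have "((\<lambda>z. f z * f z) has_integral integral {0..1} (\<lambda>z. f z * f z)) {0..1}"
      by (intro integrable_integral integrable_continuous_interval continuous_intros assms)
    \<comment> \<open>\<open>f\<close> is orthogonal to the polynomial \<open>g\<close>, so the
      integral of f^2 equals that of (f - g) f, which is small by the choice of
      \<open>g\<close>.\<close>
    from has_integral_diff[OF this gf]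
    have "((\<lambda>z. (f z - g z) * f z) has_integral integral {0..1} (\<lambda>z. f z * f z)) (cbox 0 1)"
      by (simp add: algebra_simps)
    then have "norm (integral {0..1} (\<lambda>z. f z * f z)) \<le> e * measure lborel (cbox 0 (1::real))"
    proof (rule has_integral_bound[rotated])
      fix z :: real assume "z \<in> cbox 0 1"
      then have z: "z \<in> {0..1}" by simp
      have "norm ((f z - g z) * f z) \<le> (e / M) * M"
        unfolding real_norm_def abs_mult using g(2)[OF z] M(2)[OF z] M(1) by (intro mult_mono) auto
      then show "norm ((f z - g z) * f z) \<le> e" using M by simp
    qed (use e in auto)
    then show ?thesis by simp
  qed
  then have "integral {0..1} (\<lambda>z. f z * f z) \<le> 0" by (rule field_le_epsilon) auto
  moreover have "integral {0..1} (\<lambda>z. f z * f z) \<ge> 0"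
    by (intro integral_nonneg integrable_continuous_interval continuous_intros assms) auto
  ultimately have "integral (cbox 0 1) (\<lambda>z. f z * f z) = 0" by simp
  then have "((\<lambda>z. f z * f z) has_integral 0) (cbox 0 1)"
    using integrable_integral[of "\<lambda>z. f z * f z" "cbox 0 1"] integrable_continuous_interval[of 0 1 "\<lambda>z. f z * f z"]
      continuous_on_mult[OF assms(1) assms(1)] by simp
  then have "f x * f x = 0"
    by (rule has_integral_0_cbox_imp_0[rotated 2]) (use assms in \<open>auto intro: continuous_intros\<close>)
  then show ?thesis by simp
qed

lemma moments_zero:
  fixes f :: "real \<Rightarrow> complex"
  assumes "continuous_on {0..1} f" "\<And>n. integral {0..1} (\<lambda>z. of_real z ^ n * f z) = 0" "x \<in> {0..1}"
  shows "f x = 0"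
proof -
  have h: "((\<lambda>z. of_real z ^ n * f z) has_integral 0) {0..1}" for n
    using integrable_integral[of "\<lambda>z. of_real z ^ n * f z" "{0..1}"]
      integrable_continuous_interval[of 0 1 "\<lambda>z. of_real z ^ n * f z"] assms(1,2)
    by (simp add: continuous_on_mult continuous_on_power continuous_on_of_real)
  have "Re (f x) = 0"
  proof (rule moments_zero_real[OF _ _ assms(3)])
    show "integral {0..1} (\<lambda>z. z ^ n * Re (f z)) = 0" for n
      using has_integral_linear[OF h bounded_linear_Re, of n]
      by (intro integral_unique) (simp add: o_def flip: of_real_power)
  qed (intro continuous_intros assms)
  moreover have "Im (f x) = 0"
  proof (rule moments_zero_real[OF _ _ assms(3)])
    show "integral {0..1} (\<lambda>z. z ^ n * Im (f z)) = 0" for n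
      using has_integral_linear[OF h bounded_linear_Im, of n]
      by (intro integral_unique) (simp add: o_def flip: of_real_power)
  qed (intro continuous_intros assms)
  ultimately show ?thesis by (simp add: complex_eq_iff)
qed

text \<open>Differences of consecutive moments are moments of (1 - z) g, so the moments of (1 - z)^l
  g vanish as well. For large l the integral converges without regularisation,
  \<open>reg_int_Suc\<close> removes it, and ordinary moments determine a continuous
  function.\<close>

lemma reg_int_moments_zero:
  assumes g: "wsym i j g" and \<kappa>: "\<kappa> \<noteq> 0" and J: "j + int J \<ge> 3"
    and zero: "\<And>n. n \<ge> N \<Longrightarrow> reg_int \<kappa> J (\<lambda>z. of_real z ^ n * g z) = 0"
    and z: "z \<in> {0<..<1}"
  shows "g z = 0"
proof -
  \<comment> \<open>For n >= \<open>N'\<close> the weight of z^n g at 0 is at least J + 3, enough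
    for all the integrations by parts.\<close>
  define N' where "N' = N + nat (int J + 3 - i)"
  have sym: "wsym (i + int n) (j + int l) (\<lambda>z. of_real z ^ n * of_real (1 - z) ^ l * g z)" for n l
    by (rule wsym_mult'[OF wsym_mon[of "int n" "int l"] g, THEN wsym_cong[THEN iffD1, rotated]])
      (auto simp: mon_nat)
  have big: "i + int n \<ge> int J + 3" if "n \<ge> N'" for n using that by (simp add: N'_def)
  have z0: "reg_int \<kappa> J (\<lambda>z. of_real z ^ n * of_real (1 - z) ^ l * g z) = 0" if "n \<ge> N'" for n l
    using that
  proof (induction l arbitrary: n)
    case 0
    then show ?case using zero[of n] by (simp add: N'_def)
  next
    case (Suc l)
    have "reg_int \<kappa> J (\<lambda>z. of_real z ^ n * of_real (1 - z) ^ Suc l * g z) =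
       reg_int \<kappa> J (\<lambda>z. 1 * (of_real z ^ n * of_real (1 - z) ^ l * g z) + (-1) * (of_real z ^ Suc n * of_real (1 - z) ^ l * g z))"
      by (rule arg_cong[where f = "reg_int \<kappa> J"]) (auto simp: algebra_simps)
    also have "\<dots> = 1 * reg_int \<kappa> J (\<lambda>z. of_real z ^ n * of_real (1 - z) ^ l * g z) +
       (-1) * reg_int \<kappa> J (\<lambda>z. of_real z ^ Suc n * of_real (1 - z) ^ l * g z)"
      by (rule reg_int_lin[OF sym wsym_weaken[OF sym]]) (use big[OF Suc.prems] J in auto)
    also have "\<dots> = 0" using Suc.IH[of n] Suc.IH[of "Suc n"] Suc.prems by simp
    finally show ?case .
  qed
  \<comment> \<open>Brings the weight at 1 to at least 3, which leaves a zero there after division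
    by (1 - z)^2.\<close>
  define l where "l = nat (3 - j)"
  have 0: "reg_int \<kappa> 0 (\<lambda>z. of_real z ^ n * of_real (1 - z) ^ l * g z) = 0" if "n \<ge> N'" for n
  proof -
    have "reg_int \<kappa> k (\<lambda>z. of_real z ^ n * of_real (1 - z) ^ l * g z) =
       (- \<i> * of_real \<kappa>) ^ k * reg_int \<kappa> 0 (\<lambda>z. of_real z ^ n * of_real (1 - z) ^ l * g z)" if "k \<le> J" for k
      using that
    proof (induction k)
      case (Suc k)
      have "reg_int \<kappa> (Suc k) (\<lambda>z. of_real z ^ n * of_real (1 - z) ^ l * g z) =
        - \<i> * of_real \<kappa> * reg_int \<kappa> k (\<lambda>z. of_real z ^ n * of_real (1 - z) ^ l * g z)"
        by (rule reg_int_Suc[OF sym]) (use big[OF \<open>n \<ge> N'\<close>] Suc.prems in \<open>auto simp: l_def\<close>)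
      then show ?case using Suc by simp
    qed simp
    from this[of J] z0[OF that, of l] \<kappa> show ?thesis by simp
  qed
  define \<phi> where "\<phi> = (\<lambda>z. if z \<in> {0<..<1} then osc \<kappa> z * ((of_real z ^ N' * of_real (1 - z) ^ l * g z) / of_real ((1 - z)\<^sup>2)) else 0)"
  have "\<phi> z = 0"
  proof (rule moments_zero)
    show "continuous_on {0..1} \<phi>" unfolding \<phi>_def
      by (intro osc_wsym_continuous_on wsym_weaken[OF wsym_divide_square[OF sym]])
        (use big[of N'] in \<open>auto simp: l_def\<close>)
    fix n
    have "integral {0..1} (\<lambda>z. of_real z ^ n * \<phi> z) = reg_int \<kappa> 0 (\<lambda>z. of_real z ^ (N' + n) * of_real (1 - z) ^ l * g z)"
      unfolding reg_int_def
      by (rule integral_spike[of "{0,1}"]) (auto simp: \<phi>_def power_add)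
    then show "integral {0..1} (\<lambda>z. of_real z ^ n * \<phi> z) = 0" using 0[of "N' + n"] by simp
  qed (use z in auto)
  then show ?thesis using z by (simp add: \<phi>_def osc_def del: of_real_diff)
qed

section \<open>Confluent Heun equations\<close>

lemma bsym_sum: "(\<And>i. i \<in> I \<Longrightarrow> bsym (f i)) \<Longrightarrow> bsym (\<lambda>z. \<Sum>i\<in>I. f i z)"
  by (simp add: bsym_def symb_sum)

locale confluent_heun =
  fixes P0 P1 P2 R0 R1 :: complex
begin

text \<open>Indexed by the resulting power: \<open>al n\<close>, \<open>be n\<close>,
  \<open>ga n\<close> are the coefficients of z^n in the operator applied to z^(n+1), z^n and
  z^(n-1).\<close>

definition al :: "nat \<Rightarrow> complex" where "al n = (of_nat n + 1) * (of_nat n + P0)"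
definition be :: "nat \<Rightarrow> complex" where "be n = - 2 * of_nat n * (of_nat n - 1) + P1 * of_nat n + R0"
definition ga :: "nat \<Rightarrow> complex" where "ga n = (of_nat n - 1) * (of_nat n - 2) + P2 * (of_nat n - 1) + R1"

definition P :: "complex \<Rightarrow> complex" where "P z = P0 + P1 * z + P2 * z\<^sup>2"
definition R :: "complex \<Rightarrow> complex" where "R z = R0 + R1 * z"

text \<open>The arguments are the values of a function and of its two derivatives, so that the same
  operator serves real-variable solutions, polynomials and complex power series.\<close>

definition op :: "complex \<Rightarrow> complex \<Rightarrow> complex \<Rightarrow> complex \<Rightarrow> complex" where
  "op z w w' w'' = z * (1 - z)\<^sup>2 * w'' + P z * w' + R z * w"

definition rec :: "(nat \<Rightarrow> complex) \<Rightarrow> nat \<Rightarrow> complex" where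
  "rec c n = al n * c (Suc n) + be n * c n + ga n * (case n of 0 \<Rightarrow> 0 | Suc m \<Rightarrow> c m)"

lemma op_add: "op z (w + v) (w' + v') (w'' + v'') = op z w w' w'' + op z v v' v''"
  by (simp add: op_def algebra_simps)

lemma op_cmult: "op z (a * w) (a * w') (a * w'') = a * op z w w' w''"
  by (simp add: op_def algebra_simps)

lemma op_power_Suc:
  "op z (z ^ Suc k) (of_nat (Suc k) * z ^ k) (of_nat (Suc k) * (of_nat k * z ^ (k - 1))) =
     al k * z ^ k + be (Suc k) * z ^ Suc k + ga (k + 2) * z ^ (k + 2)"
proof -
  have *: "z * (of_nat k * z ^ (k - 1)) = of_nat k * z ^ k" by (cases k) auto
  have "op z (z ^ Suc k) (of_nat (Suc k) * z ^ k) (of_nat (Suc k) * (of_nat k * z ^ (k - 1))) =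
     of_nat (Suc k) * (1 - z)\<^sup>2 * (z * (of_nat k * z ^ (k - 1))) + P z * (of_nat (Suc k) * z ^ k) + R z * z ^ Suc k"
    by (simp add: op_def algebra_simps)
  then show ?thesis unfolding *
    by (simp add: al_def be_def ga_def P_def R_def algebra_simps power2_eq_square)
qed

definition psum :: "(nat \<Rightarrow> complex) \<Rightarrow> nat \<Rightarrow> complex \<Rightarrow> complex" where
  "psum c N z = (\<Sum>i\<le>N. c i * z ^ i)"
definition psum' :: "(nat \<Rightarrow> complex) \<Rightarrow> nat \<Rightarrow> complex \<Rightarrow> complex" where
  "psum' c N z = (\<Sum>i\<le>N. c i * (of_nat i * z ^ (i - 1)))"
definition psum'' :: "(nat \<Rightarrow> complex) \<Rightarrow> nat \<Rightarrow> complex \<Rightarrow> complex" where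
  "psum'' c N z = (\<Sum>i\<le>N. c i * (of_nat i * (of_nat (i - 1) * z ^ (i - 1 - 1))))"

text \<open>The recurrence at index N involves c (N + 1), which the partial sum lacks, and c N also
  produces a term of degree N + 1. These are the only errors of truncation.\<close>

lemma op_psum:
  "op z (psum c N z) (psum' c N z) (psum'' c N z) =
     (\<Sum>n\<le>N. rec c n * z ^ n) - al N * c (Suc N) * z ^ N + ga (Suc N) * c N * z ^ Suc N"
proof (induction N)
  case 0
  show ?case by (simp add: psum_def psum'_def psum''_def op_def rec_def be_def ga_def R_def algebra_simps)
next
  case (Suc N)
  have "op z (psum c (Suc N) z) (psum' c (Suc N) z) (psum'' c (Suc N) z) =
     op z (psum c N z) (psum' c N z) (psum'' c N z) +
     c (Suc N) * op z (z ^ Suc N) (of_nat (Suc N) * z ^ N) (of_nat (Suc N) * (of_nat N * z ^ (N - 1)))"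
    unfolding op_cmult[symmetric] op_add[symmetric]
    by (simp add: psum_def psum'_def psum''_def)
  then show ?case unfolding Suc.IH op_power_Suc
    by (simp add: rec_def algebra_simps)
qed

lemma psum_deriv:
  "((\<lambda>z. psum c N (of_real z)) has_vector_derivative psum' c N (of_real x)) (at x)"
  "((\<lambda>z. psum' c N (of_real z)) has_vector_derivative psum'' c N (of_real x)) (at x)"
proof -
  have "(psum c N has_field_derivative psum' c N z) (at z)" for z
    unfolding psum_def psum'_def
    by (rule derivative_eq_intros refl | simp)+ (simp add: mult.commute mult.left_commute)
  then show "((\<lambda>z. psum c N (of_real z)) has_vector_derivative psum' c N (of_real x)) (at x)"
    by (rule has_vector_derivative_real_field)
  have "(psum' c N has_field_derivative psum'' c N z) (at z)" for z
    unfolding psum''_def psum'_def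
    by (rule derivative_eq_intros refl | simp)+ (simp add: mult.commute mult.left_commute)
  then show "((\<lambda>z. psum' c N (of_real z)) has_vector_derivative psum'' c N (of_real x)) (at x)"
    by (rule has_vector_derivative_real_field)
qed

lemma bsym_psum: "bsym (\<lambda>z. psum c N (of_real z))" "bsym (\<lambda>z. psum' c N (of_real z))"
  unfolding psum_def psum'_def by (auto intro!: bsym_sum bsym_mult bsym_power bsym_z)

end

lemma symb_bsym_field:
  assumes "0 < \<delta>" "\<delta> \<le> 1" "symb (\<lambda>_. 1) {0<..<\<delta>} n f"
  shows "symb (\<lambda>z. z * (1 - z)) {0<..<\<delta>} n f"
proof (rule symb_change_field[of _ _ "\<lambda>z. z * (1 - z)" "\<lambda>_. 1"])
  have "symb (\<lambda>_. 1) {0<..<\<delta>} n of_real"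
    by (rule symb_id) auto
  then show "symb (\<lambda>_. 1) {0<..<\<delta>} n (\<lambda>z. of_real (z * (1 - z)))"
    unfolding of_real_mult of_real_diff of_real_1
    by (intro symb_mult symb_diff) auto
qed (use assms in auto)

text \<open>Near 0 the factor z^k is split off by means of \<open>g\<close>; away from 0 it is
  invertible. The two regions overlap, so the symbol bounds combine.\<close>

lemma wsym_vanishing:
  assumes "0 < \<delta>" "\<delta> \<le> 1" "wsym 0 (- int M) h"
    and g: "\<And>n. symb (\<lambda>_. 1) {0<..<\<delta>} n g" "\<And>z. z \<in> {0<..<\<delta>} \<Longrightarrow> h z = of_real z ^ k * g z"
  shows "wsym (int k) (- int M) h"
proof -
  define b where "b = (\<lambda>z. h z * of_real (1 - z) ^ M * inverse (of_real z ^ k))"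
  obtain b0 where b0: "bsym b0" "\<And>z. z \<in> {0<..<1} \<Longrightarrow> h z = of_real (mon 0 (- int M) z) * b0 z"
    using assms(3) by (metis wsymE)
  have mon0: "of_real (mon 0 (- int M) z) * complex_of_real (1 - z) ^ M = 1" if "z \<in> {0<..<1}" for z
    using that by (simp add: mon_def power_int_minus del: of_real_diff)
  have "bsym b" unfolding bsym_def
  proof
    fix n
    have "symb (\<lambda>z. z * (1 - z)) {0<..<\<delta>} n (\<lambda>z. of_real (1 - z) ^ M * g z)"
    proof (intro symb_mult symb_bsym_field[OF assms(1,2) g(1)])
      show "symb (\<lambda>z. z * (1 - z)) {0<..<\<delta>} n (\<lambda>z. of_real (1 - z) ^ M)"
        by (rule symb_subset[OF bsymD[OF bsym_power[OF bsym_z']]]) (use assms in auto)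
    qed auto
    then have 1: "symb (\<lambda>z. z * (1 - z)) {0<..<\<delta>} n b"
      by (rule symb_cong[THEN iffD1, rotated 2]) (auto simp: b_def g(2))
    have "symb (\<lambda>z. z * (1 - z)) {\<delta>/2<..<1} n (\<lambda>z. b0 z * inverse (of_real z ^ k))"
    proof (intro symb_mult symb_inverse[of _ "(\<delta>/2)^k"])
      show "symb (\<lambda>z. z * (1 - z)) {\<delta>/2<..<1} n b0"
        by (rule symb_subset[OF bsymD[OF b0(1)]]) (use assms in auto)
      show "symb (\<lambda>z. z * (1 - z)) {\<delta>/2<..<1} n (\<lambda>z. of_real z ^ k)"
        by (rule symb_subset[OF bsymD[OF bsym_power[OF bsym_z]]]) (use assms in auto)
      fix x assume "x \<in> {\<delta>/2<..<1}"
      then show "(\<delta>/2)^k \<le> norm (complex_of_real x ^ k)"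
        using assms(1) by (auto simp: norm_power intro!: power_mono)
    qed (use assms in auto)
    then have 2: "symb (\<lambda>z. z * (1 - z)) {\<delta>/2<..<1} n b"
    proof (rule symb_cong[THEN iffD1, rotated 2])
      fix x assume "x \<in> {\<delta>/2<..<1}"
      then have x: "x \<in> {0<..<1}" using assms(1) by auto
      show "b0 x * inverse (complex_of_real x ^ k) = b x"
        unfolding b_def b0(2)[OF x] using mon0[OF x] by (simp add: mult_ac)
    qed auto
    have "{0<..<1} = {0<..<\<delta>} \<union> {\<delta>/2<..<1}" using assms(1,2) by auto
    with symb_Un[OF 1 2] show "symb (\<lambda>z. z * (1 - z)) {0<..<1} n b" by simp
  qed
  then show ?thesis
  proof (rule wsymI)
    fix z :: real assume z: "z \<in> {0<..<1}"
    have "of_real (mon (int k) (- int M) z) = of_real (mon 0 (- int M) z) * complex_of_real z ^ k"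
      using mon_add[OF z, of "int k" 0 0 "- int M"] by (simp add: mon_def)
    then show "h z = of_real (mon (int k) (- int M) z) * b z"
      unfolding b_def using z mon0[OF z] by (simp add: mult_ac del: of_real_diff)
  qed
qed

section \<open>Solutions smooth at z = 0 and conormal at z = 1\<close>

locale heun_solution = confluent_heun +
  fixes W :: "real \<Rightarrow> complex" and c :: "nat \<Rightarrow> complex" and g :: "nat \<Rightarrow> real \<Rightarrow> complex"
    and M :: nat and \<delta> :: real
  assumes W: "wsym 0 (- int M) W"
    and ode: "\<And>z. z \<in> {0<..<1} \<Longrightarrow>
      op (of_real z) (W z) (vector_derivative W (at z)) (vector_derivative (\<lambda>z. vector_derivative W (at z)) (at z)) = 0"
    and \<delta>: "0 < \<delta>" "\<delta> \<le> 1"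
    and smooth_g: "\<And>N n. symb (\<lambda>_. 1) {0<..<\<delta>} n (g N)"
    and taylor: "\<And>N z. z \<in> {0<..<\<delta>} \<Longrightarrow> W z = (\<Sum>i<N. c i * of_real z ^ i) + of_real z ^ N * g N z"
begin

abbreviation "W' \<equiv> \<lambda>z. vector_derivative W (at z)"
abbreviation "W'' \<equiv> \<lambda>z. vector_derivative W' (at z)"

lemma W_deriv:
  assumes "z \<in> {0<..<1}"
  shows "(W has_vector_derivative W' z) (at z)" "(W' has_vector_derivative W'' z) (at z)"
  using wsym_has_deriv[OF W assms] wsym_has_deriv[OF wsym_vector_derivative[OF W] assms] by auto

lemma W_psum: "z \<in> {0<..<\<delta>} \<Longrightarrow> W z = psum c N (of_real z) + of_real z ^ Suc N * g (Suc N) z"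
  using taylor[of z "Suc N"] by (simp add: psum_def lessThan_Suc_atMost)

text \<open>The Taylor polynomial differs from \<open>W\<close> by z^(N+2) times a smooth function.
  The operator annihilates \<open>W\<close> and lowers the order of vanishing at 0 by at most
  one.\<close>

lemma remainder_op:
  obtains B where "\<And>z. z \<in> {0<..<\<delta>} \<Longrightarrow>
     norm (op (of_real z) (psum c (Suc N) (of_real z)) (psum' c (Suc N) (of_real z)) (psum'' c (Suc N) (of_real z))) \<le> B * z ^ Suc N"
proof -
  define h where "h = g (N + 2)"
  define h1 where "h1 = (\<lambda>z. vector_derivative h (at z))"
  define h2 where "h2 = (\<lambda>z. vector_derivative h1 (at z))"
  have sh: "symb (\<lambda>_. 1) {0<..<\<delta>} n h" for n unfolding h_def by (rule smooth_g)
  have sh1: "symb (\<lambda>_. 1) {0<..<\<delta>} n h1" for n using symb_SucD(3)[OF sh] by (simp add: h1_def)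
  have sh2: "symb (\<lambda>_. 1) {0<..<\<delta>} n h2" for n using symb_SucD(3)[OF sh1] by (simp add: h2_def)
  have dh: "(h has_vector_derivative h1 z) (at z)" "(h1 has_vector_derivative h2 z) (at z)" if "z \<in> {0<..<\<delta>}" for z
    using symb_SucD(2)[OF sh that] symb_SucD(2)[OF sh1 that] by (auto simp: h1_def h2_def)
  define k :: complex where "k = of_nat (N + 2)"
  \<comment> \<open>\<open>X\<close> is the operator applied to z^(N+2) h, divided by
    z^(N+1).\<close>
  define X where "X = (\<lambda>z. of_real ((1 - z)\<^sup>2) * (k * (k - 1) * h z + 2 * k * of_real z * h1 z + (of_real z)\<^sup>2 * h2 z) +
     P (of_real z) * (k * h z + of_real z * h1 z) + R (of_real z) * (of_real z * h z))"
  have sz: "symb (\<lambda>_. 1) {0<..<\<delta>} n of_real" for n by (rule symb_id) auto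
  have "symb (\<lambda>_. 1) {0<..<\<delta>} 0 X"
    unfolding X_def P_def R_def of_real_power of_real_diff of_real_1
    by (intro symb_add symb_mult symb_diff symb_power symb_const sz sh sh1 sh2) auto
  then obtain B where B: "\<And>z. z \<in> {0<..<\<delta>} \<Longrightarrow> norm (X z) \<le> B" using symb_bound by metis
  have dpow: "((\<lambda>x. complex_of_real x ^ Suc n) has_vector_derivative of_nat (Suc n) * of_real z ^ n) (at z)" for n z
    by (rule has_vector_derivative_real_field)
      (use DERIV_power[OF DERIV_ident, where n = "Suc n"] in simp)
  show ?thesis
  proof (rule that[of B])
    fix z assume z: "z \<in> {0<..<\<delta>}"
    then have z1: "z \<in> {0<..<1}" using \<delta> by auto
    define r1 where "r1 = (\<lambda>z. of_real z ^ Suc (Suc N) * h1 z + of_nat (Suc (Suc N)) * of_real z ^ Suc N * h z)"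
    define r2 where "r2 = (\<lambda>z. (of_real z ^ Suc (Suc N) * h2 z + of_nat (Suc (Suc N)) * of_real z ^ Suc N * h1 z)
      + of_nat (Suc (Suc N)) * (of_real z ^ Suc N * h1 z + of_nat (Suc N) * of_real z ^ N * h z))"
    have e0: "psum c (Suc N) (of_real y) = W y - of_real y ^ Suc (Suc N) * h y" if "y \<in> {0<..<\<delta>}" for y
      using W_psum[OF that, of "Suc N"] by (simp add: h_def)
    have dr0: "((\<lambda>y. of_real y ^ Suc (Suc N) * h y) has_vector_derivative r1 y) (at y)" if "y \<in> {0<..<\<delta>}" for y
      unfolding r1_def by (rule has_vector_derivative_mult[OF dpow dh(1)[OF that]])
    have dr1: "(r1 has_vector_derivative r2 y) (at y)" if "y \<in> {0<..<\<delta>}" for y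
      unfolding r1_def r2_def mult.assoc
      by (intro has_vector_derivative_add has_vector_derivative_mult_right
            has_vector_derivative_mult[OF dpow dh(1)[OF that], unfolded mult.assoc]
            has_vector_derivative_mult[OF dpow dh(2)[OF that], unfolded mult.assoc])
    have e1: "psum' c (Suc N) (of_real y) = W' y - r1 y" if "y \<in> {0<..<\<delta>}" for y
    proof -
      have "((\<lambda>y. psum c (Suc N) (of_real y)) has_vector_derivative W' y - r1 y) (at y)"
      proof (subst vector_derivative_cong_open(1)[of "{0<..<\<delta>}" _ "\<lambda>y. W y - of_real y ^ Suc (Suc N) * h y"])
        show "((\<lambda>y. W y - of_real y ^ Suc (Suc N) * h y) has_vector_derivative W' y - r1 y) (at y)"
          using that \<delta> by (intro has_vector_derivative_diff dr0 W_deriv) auto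
      qed (use that e0 in auto)
      from vector_derivative_unique_at[OF this psum_deriv(1)] show ?thesis by simp
    qed
    have e2: "psum'' c (Suc N) (of_real z) = W'' z - r2 z"
    proof -
      have "((\<lambda>y. psum' c (Suc N) (of_real y)) has_vector_derivative W'' z - r2 z) (at z)"
      proof (subst vector_derivative_cong_open(1)[of "{0<..<\<delta>}" _ "\<lambda>y. W' y - r1 y"])
        show "((\<lambda>y. W' y - r1 y) has_vector_derivative W'' z - r2 z) (at z)"
          using z z1 by (intro has_vector_derivative_diff dr1 W_deriv) auto
      qed (use z e1 in auto)
      from vector_derivative_unique_at[OF this psum_deriv(2)] show ?thesis by simp
    qed
    have "op (of_real z) (psum c (Suc N) (of_real z)) (psum' c (Suc N) (of_real z)) (psum'' c (Suc N) (of_real z)) =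
      op (of_real z) (W z) (W' z) (W'' z) - of_real z ^ Suc N * X z"
      unfolding e0[OF z] e1[OF z] e2 r1_def r2_def X_def k_def op_def
      by (simp add: algebra_simps power2_eq_square)
    then have "norm (op (of_real z) (psum c (Suc N) (of_real z)) (psum' c (Suc N) (of_real z)) (psum'' c (Suc N) (of_real z)))
       = z ^ Suc N * norm (X z)"
      using ode[OF z1] z by (simp add: norm_mult norm_power)
    also have "\<dots> \<le> z ^ Suc N * B" using B[OF z] z by (intro mult_left_mono) auto
    finally show "norm (op (of_real z) (psum c (Suc N) (of_real z)) (psum' c (Suc N) (of_real z)) (psum'' c (Suc N) (of_real z))) \<le> B * z ^ Suc N"
      by (simp add: mult.commute)
  qed
qed

text \<open>Once the lower recurrences hold, the operator applied to the Taylor polynomial starts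
  with \<open>rec c N\<close> in degree N, whereas by \<open>remainder_op\<close> the result is of
  order N + 1.\<close>

lemma rec_zero: "rec c N = 0"
proof (induction N rule: less_induct)
  case (less N)
  obtain B where B: "\<And>z. z \<in> {0<..<\<delta>} \<Longrightarrow>
     norm (op (of_real z) (psum c (Suc N) (of_real z)) (psum' c (Suc N) (of_real z)) (psum'' c (Suc N) (of_real z))) \<le> B * z ^ Suc N"
    using remainder_op[of N] by metis
  \<comment> \<open>The polynomial has degree N + 1, so that its coefficient in degree N is already
    the full \<open>rec c N\<close>; \<open>Y\<close> and \<open>Y2\<close> are the coefficients in
    degrees N + 1 and N + 2.\<close>
  define Y where "Y = rec c (Suc N) - al (Suc N) * c (Suc (Suc N))"
  define Y2 where "Y2 = ga (Suc (Suc N)) * c (Suc N)"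
  have est: "norm (rec c N) \<le> z * (B + norm Y + norm Y2)" if z: "z \<in> {0<..<\<delta>}" for z
  proof -
    have s0: "(\<Sum>n<N. rec c n * of_real z ^ n) = 0" using less by simp
    have eq: "op (of_real z) (psum c (Suc N) (of_real z)) (psum' c (Suc N) (of_real z)) (psum'' c (Suc N) (of_real z)) =
       of_real z ^ N * (rec c N + of_real z * (Y + of_real z * Y2))"
      unfolding op_psum Y_def Y2_def using s0
      by (simp add: atMost_Suc lessThan_Suc_atMost[symmetric] algebra_simps)
    have "z ^ N * norm (rec c N + of_real z * (Y + of_real z * Y2)) \<le> z ^ N * (B * z)"
      using B[OF z] z unfolding eq by (simp add: norm_mult norm_power mult_ac)
    then have 1: "norm (rec c N + of_real z * (Y + of_real z * Y2)) \<le> B * z"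
      using z by simp
    have "norm (of_real z * (Y + of_real z * Y2)) = z * norm (Y + of_real z * Y2)" using z by (simp add: norm_mult)
    also have "\<dots> \<le> z * (norm Y + norm Y2)"
    proof (rule mult_left_mono)
      have "norm (of_real z * Y2) \<le> norm Y2" using z \<delta> by (simp add: norm_mult mult_left_le_one_le)
      then show "norm (Y + of_real z * Y2) \<le> norm Y + norm Y2" using norm_triangle_ineq[of Y "of_real z * Y2"] by linarith
    qed (use z in auto)
    finally have 2: "norm (of_real z * (Y + of_real z * Y2)) \<le> z * (norm Y + norm Y2)" .
    have "norm (rec c N) \<le> norm (rec c N + of_real z * (Y + of_real z * Y2)) + norm (of_real z * (Y + of_real z * Y2))"
      using norm_triangle_ineq4[of "rec c N + of_real z * (Y + of_real z * Y2)" "of_real z * (Y + of_real z * Y2)"] by simp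
    with 1 2 show ?thesis by (simp add: algebra_simps)
  qed
  have "((\<lambda>z. z * (B + norm Y + norm Y2)) \<longlongrightarrow> 0 * (B + norm Y + norm Y2)) (at_right 0)" by (intro tendsto_intros)
  moreover have "eventually (\<lambda>z. norm (rec c N) \<le> z * (B + norm Y + norm Y2)) (at_right 0)"
    using est \<delta> by (auto simp: eventually_at_right_field intro!: exI[of _ \<delta>])
  ultimately have "norm (rec c N) \<le> 0 * (B + norm Y + norm Y2)" by (intro tendsto_lowerbound[of _ _ "at_right 0"]) auto
  then show ?case by simp
qed

end

section \<open>Decay of the Taylor coefficients\<close>

text \<open>By Bernoulli's inequality 1 + C / n <= ((n + 1) / n)^C, and the product of these bounds
  telescopes.\<close>

lemma ratio_growth:
  fixes \<rho> :: "nat \<Rightarrow> complex" and x :: "nat \<Rightarrow> complex" and C n0 :: nat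
  assumes "n0 \<ge> 1" "\<And>n. n \<ge> n0 \<Longrightarrow> x (Suc n) = \<rho> n * x n"
    and "\<And>n. n \<ge> n0 \<Longrightarrow> norm (\<rho> n) \<le> 1 + real C / real n"
  shows "n \<ge> n0 \<Longrightarrow> norm (x n) \<le> norm (x n0) * real n ^ C"
proof (induction n rule: dec_induct)
  case base
  have "1 \<le> real n0 ^ C" using assms(1) by simp
  then show ?case using mult_left_mono[of 1 "real n0 ^ C" "norm (x n0)"] by simp
next
  case (step n)
  have n: "n \<ge> 1" using step assms(1) by simp
  have "1 + real C / real n \<le> (1 + 1 / real n) ^ C"
    using Bernoulli_inequality[of "1 / real n" C] order_trans[of "-1" 0 "1 / real n"] by simp
  also have "\<dots> = (real (Suc n) / real n) ^ C" using n by (simp add: field_simps)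
  finally have r: "norm (\<rho> n) \<le> (real (Suc n) / real n) ^ C" using assms(3)[of n] step by simp
  have "norm (x (Suc n)) = norm (\<rho> n) * norm (x n)" using assms(2)[of n] step by (simp add: norm_mult)
  also have "\<dots> \<le> (real (Suc n) / real n) ^ C * (norm (x n0) * real n ^ C)"
    using r step.IH by (intro mult_mono) auto
  also have "\<dots> = norm (x n0) * real (Suc n) ^ C" using n by (simp add: power_divide)
  finally show ?case .
qed

text \<open>
  \<open>osc \<kappa> z * G z\<close> is the weight that makes the operator symmetric (up to the factor \<open>(1 - z)\<^sup>2\<close>).
\<close>

locale heun_weighted = heun_solution +
  fixes G :: "real \<Rightarrow> complex" and \<kappa> :: real and Q L :: nat
  assumes G: "wsym (- int Q) (- int L) G"
    and G_nz: "\<And>z. z \<in> {0<..<1} \<Longrightarrow> G z \<noteq> 0"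
    and G_ode: "\<And>z. z \<in> {0<..<1} \<Longrightarrow> dd (\<lambda>z. of_real z * G z) z + \<i> * of_real \<kappa> * (of_real z * G z) = G z * P (of_real z)"
    and \<kappa>: "\<kappa> \<noteq> 0"
begin

lemma wsym_zG: "wsym (1 - int Q) (- int L) (\<lambda>z. of_real z * G z)"
  by (rule wsym_mult'[OF wsym_mon[of 1 0] G, THEN wsym_cong[THEN iffD1, rotated]]) (auto simp: mon_def)

text \<open>Lagrange's identity: by \<open>G_ode\<close>, the difference of G W op(p) and G p op(W)
  is \<open>dd f + \<i> * \<kappa> * f\<close> (up to coercions) for the weighted Wronskian f = z G
  (W p' - W' p). Here op(W) = 0, and the total derivative integrates to zero.\<close>

lemma reg_int_op:
  assumes p: "\<And>z. z \<in> {0<..<1} \<Longrightarrow> (p has_vector_derivative p' z) (at z)"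
    "\<And>z. z \<in> {0<..<1} \<Longrightarrow> (p' has_vector_derivative p'' z) (at z)"
    and f: "wsym i j (\<lambda>z. of_real z * G z * (W z * p' z - W' z * p z))" "i \<ge> int J + 1" "j + int J \<ge> 1"
  shows "reg_int \<kappa> J (\<lambda>z. G z * W z * op (of_real z) (p z) (p' z) (p'' z)) = 0"
proof -
  define f where "f = (\<lambda>z. of_real z * G z * (W z * p' z - W' z * p z))"
  have "reg_int \<kappa> J (\<lambda>z. G z * W z * op (of_real z) (p z) (p' z) (p'' z)) =
        reg_int \<kappa> J (\<lambda>z. dd f z + \<i> * of_real \<kappa> * f z)"
  proof (rule reg_int_cong)
    fix z :: real assume z: "z \<in> {0<..<1}"
    define D where "D = vector_derivative (\<lambda>z. of_real z * G z) (at z)"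
    have "(f has_vector_derivative (of_real z * G z) * ((W z * p'' z + W' z * p' z) - (W' z * p' z + W'' z * p z)) +
        D * (W z * p' z - W' z * p z)) (at z)"
      unfolding f_def D_def
      by (intro has_vector_derivative_mult has_vector_derivative_diff W_deriv p z wsym_has_deriv[OF wsym_zG z])
    then have "dd f z = of_real ((1 - z)\<^sup>2) * ((of_real z * G z) * (W z * p'' z - W'' z * p z) +
        D * (W z * p' z - W' z * p z))"
      unfolding dd_def by (simp add: vector_derivative_at algebra_simps)
    then have 1: "dd f z + \<i> * of_real \<kappa> * f z =
       of_real ((1 - z)\<^sup>2) * (of_real z * G z) * (W z * p'' z - W'' z * p z) +
       (of_real ((1 - z)\<^sup>2) * D + \<i> * of_real \<kappa> * (of_real z * G z)) * (W z * p' z - W' z * p z)"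
      by (simp add: f_def algebra_simps)
    have 2: "of_real ((1 - z)\<^sup>2) * D + \<i> * of_real \<kappa> * (of_real z * G z) = G z * P (of_real z)"
      using G_ode[OF z] by (simp add: dd_def D_def)
    have "dd f z + \<i> * of_real \<kappa> * f z =
      G z * W z * op (of_real z) (p z) (p' z) (p'' z) - G z * p z * op (of_real z) (W z) (W' z) (W'' z)"
      unfolding 1 2 op_def by (simp add: algebra_simps)
    then show "G z * W z * op (of_real z) (p z) (p' z) (p'' z) = dd f z + \<i> * of_real \<kappa> * f z"
      using ode[OF z] by simp
  qed
  also have "\<dots> = 0" unfolding f_def by (rule reg_int_total[OF f])
  finally show ?thesis .
qed

definition moment :: "nat \<Rightarrow> nat \<Rightarrow> complex" where
  "moment J n = reg_int \<kappa> J (\<lambda>z. of_real z ^ n * (G z * W z))"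

lemma wsym_GW: "wsym (- int Q) (- int (L + M)) (\<lambda>z. G z * W z)"
  by (rule wsym_mult'[OF G W]) auto

lemma wsym_moment: "wsym (int n - int Q) (- int (L + M)) (\<lambda>z. of_real z ^ n * (G z * W z))"
  by (rule wsym_mult'[OF wsym_mon[of "int n" 0] wsym_GW, THEN wsym_cong[THEN iffD1, rotated]])
    (auto simp: mon_def)

lemma moment_lin:
  assumes "n \<ge> Q + J + 1" "J \<ge> L + M + 3"
  shows "reg_int \<kappa> J (\<lambda>z. a * (of_real z ^ n * (G z * W z)) + b * (of_real z ^ Suc n * (G z * W z)))
     = a * moment J n + b * moment J (Suc n)"
  unfolding moment_def
  by (rule reg_int_lin[OF wsym_moment wsym_weaken[OF wsym_moment]]) (use assms in auto)

lemma wsym_bsym_mult: "wsym i j f \<Longrightarrow> bsym b \<Longrightarrow> wsym i j (\<lambda>z. f z * b z)"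
  using wsym_mult[OF _ bsym_imp_wsym] by simp

text \<open>The test function is the Taylor polynomial p of degree n, on which the operator leaves
  only two monomials by \<open>op_psum\<close> and \<open>rec_zero\<close>. The Wronskian of W and p
  equals that of W - p and p, hence vanishes to order n at 0; this compensates the singularity
  z^(-Q) of \<open>G\<close>, so no boundary term appears.\<close>

lemma coeff_moment_casoratian:
  assumes "n \<ge> Q + J + 1" "J \<ge> L + M + 3"
  shows "al n * c (Suc n) * moment J n = ga (Suc n) * c n * moment J (Suc n)"
proof -
  define p where "p = (\<lambda>z::real. psum c n (of_real z))"
  define p' where "p' = (\<lambda>z::real. psum' c n (of_real z))"
  define h where "h = (\<lambda>z. W z - p z)"
  define h' where "h' = (\<lambda>z. vector_derivative h (at z))"
  have bp: "bsym p" "bsym p'" unfolding p_def p'_def by (rule bsym_psum)+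
  have "wsym 0 (- int M) h" unfolding h_def
    by (intro wsym_diff W wsym_weaken[OF bsym_imp_wsym[OF bp(1)]]) auto
  then have h: "wsym (int (Suc n)) (- int M) h"
    by (rule wsym_vanishing[OF \<delta> _ smooth_g[of _ "Suc n"]]) (simp add: h_def p_def W_psum[of _ n])
  have h'_eq: "h' z = W' z - p' z" if "z \<in> {0<..<1}" for z
    unfolding h'_def h_def p_def p'_def
    by (rule vector_derivative_at) (intro has_vector_derivative_diff W_deriv psum_deriv that)
  have h': "wsym (int n) (- int M - 1) h'"
    using wsym_vector_derivative[OF h] unfolding h'_def by simp
  have "wsym (int n) (- int M - 1) (\<lambda>z. h z * p' z - h' z * p z)"
    by (intro wsym_diff wsym_bsym_mult bp h' wsym_weaken[OF h]) auto
  then have "wsym (int n) (- int M - 1) (\<lambda>z. W z * p' z - W' z * p z)"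
    by (rule wsym_cong[THEN iffD1, rotated]) (simp add: h'_eq h_def algebra_simps)
  from wsym_mult'[OF wsym_zG this refl refl]
  have "reg_int \<kappa> J (\<lambda>z. G z * W z * op (of_real z) (p z) (p' z) (psum'' c n (of_real z))) = 0"
    by (rule reg_int_op[rotated 2]) (use assms in \<open>auto simp: p_def p'_def intro!: psum_deriv\<close>)
  then have "0 = reg_int \<kappa> J (\<lambda>z. G z * W z * op (of_real z) (p z) (p' z) (psum'' c n (of_real z)))" by simp
  also have "\<dots> = reg_int \<kappa> J (\<lambda>z. (- al n * c (Suc n)) * (of_real z ^ n * (G z * W z)) + (ga (Suc n) * c n) * (of_real z ^ Suc n * (G z * W z)))"
    unfolding p_def p'_def op_psum rec_zero by (rule arg_cong[where f = "reg_int \<kappa> J"]) (auto simp: algebra_simps)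
  also have "\<dots> = (- al n * c (Suc n)) * moment J n + (ga (Suc n) * c n) * moment J (Suc n)"
    by (rule moment_lin[OF assms])
  finally show ?thesis by (simp add: eq_neg_iff_add_eq_0)
qed

text \<open>\<open>reg_int_op\<close> with the monomial z^(n+1), whose image consists of three
  monomials.\<close>

lemma moment_rec:
  assumes "n \<ge> Q + J + 2" "J \<ge> L + M + 3"
  shows "al n * moment J n + be (Suc n) * moment J (Suc n) + ga (n + 2) * moment J (n + 2) = 0"
proof -
  define p where "p = (\<lambda>z. complex_of_real z ^ Suc n)"
  define p' where "p' = (\<lambda>z. of_nat (Suc n) * complex_of_real z ^ n)"
  define p'' where "p'' = (\<lambda>z. of_nat (Suc n) * (of_nat n * complex_of_real z ^ (n - 1)))"
  have dpow: "((\<lambda>x. complex_of_real x ^ k) has_vector_derivative of_nat k * of_real z ^ (k - 1)) (at z)" for k z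
    by (rule has_vector_derivative_real_field)
      (use DERIV_power[OF DERIV_ident, where n = k] in simp)
  have w: "wsym (int k) 0 (\<lambda>z. complex_of_real z ^ k)" for k
    by (rule wsym_mon[of "int k" 0, THEN wsym_cong[THEN iffD1, rotated]]) (auto simp: mon_def)
  have "wsym (int n) (- int M - 1) (\<lambda>z. W z * p' z)"
    unfolding p'_def by (rule wsym_weaken[OF wsym_mult[OF W wsym_cmult[OF w]]]) auto
  moreover have "wsym (int n) (- int M - 1) (\<lambda>z. W' z * p z)"
    unfolding p_def by (rule wsym_weaken[OF wsym_mult[OF wsym_vector_derivative[OF W] w]]) auto
  ultimately have "wsym (int n) (- int M - 1) (\<lambda>z. W z * p' z - W' z * p z)" by (rule wsym_diff)
  from wsym_mult'[OF wsym_zG this refl refl]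
  have 1: "reg_int \<kappa> J (\<lambda>z. G z * W z * op (of_real z) (p z) (p' z) (p'' z)) = 0"
  proof (rule reg_int_op[rotated 2])
    show "(p has_vector_derivative p' z) (at z)" for z unfolding p_def p'_def using dpow[of "Suc n"] by simp
    show "(p' has_vector_derivative p'' z) (at z)" for z unfolding p'_def p''_def
      by (intro has_vector_derivative_mult_right dpow)
  qed (use assms in auto)
  have "reg_int \<kappa> J (\<lambda>z. G z * W z * op (of_real z) (p z) (p' z) (p'' z)) =
     reg_int \<kappa> J (\<lambda>z. 1 * (al n * (of_real z ^ n * (G z * W z)) + be (Suc n) * (of_real z ^ Suc n * (G z * W z))) +
        ga (n + 2) * (of_real z ^ (n + 2) * (G z * W z)))"
    unfolding p_def p'_def p''_def op_power_Suc by (rule arg_cong[where f = "reg_int \<kappa> J"]) (auto simp: algebra_simps)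
  also have "\<dots> = 1 * reg_int \<kappa> J (\<lambda>z. al n * (of_real z ^ n * (G z * W z)) + be (Suc n) * (of_real z ^ Suc n * (G z * W z))) +
        ga (n + 2) * moment J (n + 2)"
    unfolding moment_def
    by (rule reg_int_lin[OF wsym_add[OF wsym_cmult[OF wsym_moment] wsym_cmult[OF wsym_weaken[OF wsym_moment]]] wsym_weaken[OF wsym_moment]])
       (use assms in auto)
  finally show ?thesis using 1 moment_lin[of J n "al n" "be (Suc n)"] assms by simp
qed

text \<open>\<open>G\<close> contributes z^(-Q), so the effective exponent is n - Q, which is at
  least n / 2 here. The total weight of G W at 1 is -(L + M), and \<open>J\<close> exceeds L + M by
  enough to leave K powers of decay.\<close>

lemma moment_decay:
  assumes "J \<ge> L + M + K + 3"
  obtains C where "\<And>n. n \<ge> 2 * Q + J + 1 \<Longrightarrow> norm (moment J n) \<le> C / real n ^ K"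
proof -
  obtain b where b: "bsym b" "\<And>z. z \<in> {0<..<1} \<Longrightarrow> G z * W z = of_real (mon (- int Q) (- int (L + M)) z) * b z"
    using wsym_GW unfolding wsym_def by blast
  have "- int (L + M) + int J \<ge> 3" using assms by simp
  from reg_int_decay[OF b(1) this, of \<kappa>] obtain C where
    C: "\<And>n. n \<ge> J + 1 \<Longrightarrow> norm (reg_int \<kappa> J (\<lambda>z. of_real (mon (int n) (- int (L + M)) z) * b z)) \<le> C / real n ^ nat (- int (L + M) + int J - 2)"
    by blast
  have "norm (moment J n) \<le> (\<bar>C\<bar> * 2 ^ K) / real n ^ K" if n: "n \<ge> 2 * Q + J + 1" for n
  proof -
    have "moment J n = reg_int \<kappa> J (\<lambda>z. of_real (mon (int (n - Q)) (- int (L + M)) z) * b z)"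
      unfolding moment_def
    proof (rule reg_int_cong)
      fix z :: real assume z: "z \<in> {0<..<1}"
      have "mon (int (n - Q)) (- int (L + M)) z = z ^ n * mon (- int Q) (- int (L + M)) z"
        using mon_add[OF z, of "int n" "- int Q" 0 "- int (L + M)"] n by (simp add: mon_def of_nat_diff)
      then show "of_real z ^ n * (G z * W z) = of_real (mon (int (n - Q)) (- int (L + M)) z) * b z"
        using b(2)[OF z] by simp
    qed
    then have "norm (moment J n) \<le> C / real (n - Q) ^ nat (- int (L + M) + int J - 2)"
      using C[of "n - Q"] n by simp
    also have "\<dots> \<le> \<bar>C\<bar> / real (n - Q) ^ nat (- int (L + M) + int J - 2)" by (rule divide_right_mono) auto
    also have "\<dots> \<le> \<bar>C\<bar> / real (n - Q) ^ K"
    proof (rule divide_left_mono)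
      show "real (n - Q) ^ K \<le> real (n - Q) ^ nat (- int (L + M) + int J - 2)"
        using n assms by (intro power_increasing) auto
    qed (use n in auto)
    also have "\<dots> \<le> \<bar>C\<bar> / (real n / 2) ^ K"
      using n by (intro divide_left_mono power_mono mult_pos_pos zero_less_power) (auto simp: of_nat_diff)
    finally show ?thesis by (simp add: power_divide)
  qed
  then show ?thesis by (rule that)
qed

text \<open>Suitably rescaled, the moments solve the same second-order recurrence as
  \<open>c\<close>, and \<open>coeff_moment_casoratian\<close> says that their Casoratian with
  \<open>c\<close> is zero. From an index with nonzero moment onwards, \<open>c\<close> is therefore
  a constant multiple of them and inherits their decay.\<close>

lemma coeff_decay:
  assumes nz: "\<exists>z\<in>{0<..<1}. W z \<noteq> 0"
    and alga: "\<And>n. n \<ge> n1 \<Longrightarrow> al n \<noteq> 0" "\<And>n. n \<ge> n1 \<Longrightarrow> ga n \<noteq> 0"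
    and ratio: "\<And>n. n \<ge> n1 \<Longrightarrow> norm (ga (Suc n) / al n) \<le> 1 + real C / real n"
  shows "\<exists>B N. \<forall>n\<ge>N. norm (c n) \<le> B / real n ^ K"
proof -
  \<comment> \<open>The additional C powers of decay pay for the growth n^C of the rescaling factor
    \<open>x\<close>.\<close>
  define J where "J = L + M + (K + C) + 3"
  define m where "m = moment J"
  have J3: "J \<ge> L + M + 3" by (simp add: J_def)
  define n0 where "n0 = 2 * Q + J + 2 + n1"
  obtain N where N: "N \<ge> n0" "m N \<noteq> 0"
  proof (rule ccontr)
    assume "\<not> thesis"
    then have R: "reg_int \<kappa> J (\<lambda>z. of_real z ^ n * (G z * W z)) = 0" if "n \<ge> n0" for n
      using that \<open>\<And>N. n0 \<le> N \<Longrightarrow> m N \<noteq> 0 \<Longrightarrow> thesis\<close> unfolding m_def moment_def by blast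
    have "G z * W z = 0" if "z \<in> {0<..<1}" for z
      by (rule reg_int_moments_zero[where J = J and N = n0, OF wsym_GW \<kappa> _ R that]) (use J3 in auto)
    then show False using nz G_nz by auto
  qed
  \<comment> \<open>\<open>x\<close> satisfies al n * x (n + 1) = ga (n + 1) * x n for n >= N, which
    turns the transposed recurrence into the original one. The product starts at N, beyond the zeros
    of \<open>al\<close>.\<close>
  define x where "x = (\<lambda>n. rec_nat 1 (\<lambda>k y. ga (Suc (N + k)) / al (N + k) * y) (n - N))"
  have xN: "x N = 1" by (simp add: x_def)
  have xS: "x (Suc n) = ga (Suc n) / al n * x n" if "n \<ge> N" for n
    using that by (simp add: x_def Suc_diff_le)
  have x_bound: "norm (x n) \<le> real n ^ C" if "n \<ge> N" for n
    using ratio_growth[of N x "\<lambda>n. ga (Suc n) / al n" C n] xS ratio N that xN by (simp add: n0_def)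
  define y where "y = (\<lambda>n. x n * m n)"
  have yrec: "al (Suc n) * y (n + 2) + be (Suc n) * y (Suc n) + ga (Suc n) * y n = 0" if n: "n \<ge> N" for n
  proof -
    have nz: "al n \<noteq> 0" "al (Suc n) \<noteq> 0" using alga n N by (auto simp: n0_def)
    have "al n * m n + be (Suc n) * m (Suc n) + ga (n + 2) * m (n + 2) = 0"
      unfolding m_def by (rule moment_rec) (use n N J3 in \<open>auto simp: n0_def\<close>)
    note mr = this
    have e1: "al (Suc n) * x (n + 2) = ga (n + 2) * x (Suc n)" using xS[of "Suc n"] n nz by simp
    have e2: "ga (Suc n) * x n = al n * x (Suc n)" using xS[of n] n nz by simp
    have A: "al (Suc n) * y (n + 2) = x (Suc n) * (ga (n + 2) * m (n + 2))"
      unfolding y_def mult.assoc[symmetric] e1 by (simp add: mult_ac)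
    have B: "ga (Suc n) * y n = x (Suc n) * (al n * m n)"
      unfolding y_def mult.assoc[symmetric] e2 by (simp add: mult_ac)
    have "al (Suc n) * y (n + 2) + be (Suc n) * y (Suc n) + ga (Suc n) * y n =
       x (Suc n) * (al n * m n + be (Suc n) * m (Suc n) + ga (n + 2) * m (n + 2))"
      unfolding A B by (simp only: y_def distrib_left) (simp only: mult_ac add_ac)
    then show ?thesis unfolding mr by simp
  qed
  have ylink: "c (Suc n) * y n = c n * y (Suc n)" if n: "n \<ge> N" for n
  proof -
    have nz: "al n \<noteq> 0" using alga n N by (auto simp: n0_def)
    have "al n * c (Suc n) * m n = ga (Suc n) * c n * m (Suc n)"
      unfolding m_def by (rule coeff_moment_casoratian) (use n N J3 in \<open>auto simp: n0_def\<close>)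
    then have lk: "ga (Suc n) * c n * m (Suc n) = al n * (c (Suc n) * m n)" by (simp add: mult.assoc)
    have "c n * y (Suc n) = (x n / al n) * (ga (Suc n) * c n * m (Suc n))"
      unfolding y_def using xS[OF n] by simp
    also have "\<dots> = c (Suc n) * y n" unfolding lk y_def using nz by simp
    finally show ?thesis by simp
  qed
  have crec: "al (Suc n) * c (n + 2) + be (Suc n) * c (Suc n) + ga (Suc n) * c n = 0" for n
    using rec_zero[of "Suc n"] by (simp add: rec_def)
  define l where "l = c N / m N"
  have "c n = l * y n \<and> c (Suc n) = l * y (Suc n)" if "n \<ge> N" for n
    using that
  proof (induction n rule: dec_induct)
    case base
    have yN: "y N = m N" by (simp add: y_def xN)
    have "c (Suc N) * m N = c N * y (Suc N)" using ylink[of N] yN by simp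
    then show ?case unfolding l_def using N yN by (simp add: eq_divide_eq)
  next
    case (step n)
    have nz: "al (Suc n) \<noteq> 0" using alga step N by (auto simp: n0_def)
    have "al (Suc n) * c (n + 2) = - (be (Suc n) * c (Suc n) + ga (Suc n) * c n)"
      using crec[of n] unfolding eq_neg_iff_add_eq_0 by (simp add: add.assoc)
    also have "\<dots> = l * (- (be (Suc n) * y (Suc n) + ga (Suc n) * y n))"
      using step.IH by (simp add: algebra_simps)
    also have "\<dots> = l * (al (Suc n) * y (n + 2))"
    proof -
      have "al (Suc n) * y (n + 2) = - (be (Suc n) * y (Suc n) + ga (Suc n) * y n)"
        using yrec[of n] step unfolding eq_neg_iff_add_eq_0 by (simp add: add.assoc)
      then show ?thesis by simp
    qed
    finally have "c (n + 2) = l * y (n + 2)" using nz by simp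
    then show ?case using step.IH by simp
  qed
  then have cl: "c n = l * y n" if "n \<ge> N" for n using that by blast
  obtain B where B: "\<And>n. n \<ge> 2 * Q + J + 1 \<Longrightarrow> norm (moment J n) \<le> B / real n ^ (K + C)"
    using moment_decay[of "K + C" J] by (auto simp: J_def)
  have "norm (c n) \<le> (norm l * \<bar>B\<bar>) / real n ^ K" if n: "n \<ge> N" for n
  proof -
    have n0: "n \<ge> 1" "n \<ge> 2 * Q + J + 1" using n N by (auto simp: n0_def)
    have "norm (m n) \<le> \<bar>B\<bar> / real n ^ (K + C)"
      unfolding m_def by (rule order_trans[OF B[OF n0(2)]]) (auto intro: divide_right_mono)
    then have "norm (x n) * norm (m n) \<le> real n ^ C * (\<bar>B\<bar> / real n ^ (K + C))"
      using x_bound[OF n] by (intro mult_mono) auto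
    also have "\<dots> = \<bar>B\<bar> / real n ^ K" using n0 by (simp add: power_add)
    finally have "norm l * (norm (x n) * norm (m n)) \<le> norm l * (\<bar>B\<bar> / real n ^ K)"
      by (rule mult_left_mono) simp
    then show ?thesis using cl[OF n] by (simp add: y_def norm_mult)
  qed
  then show ?thesis by blast
qed

end

section \<open>Flux of power series solutions\<close>

lemma eventually_bounded_summable:
  fixes f :: "nat \<Rightarrow> complex"
  assumes "\<And>n. n \<ge> m \<Longrightarrow> norm (f n) \<le> C" "norm z < 1"
  shows "summable (\<lambda>n. f n * z ^ n)"
proof (rule summable_comparison_test)
  show "\<exists>m. \<forall>n\<ge>m. norm (f n * z ^ n) \<le> C * norm z ^ n"
    using assms(1) by (intro exI[of _ m]) (auto simp: norm_mult norm_power intro!: mult_right_mono)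
  show "summable (\<lambda>n. C * norm z ^ n)" using assms(2) by (intro summable_mult summable_geometric) simp
qed

definition pser :: "(nat \<Rightarrow> complex) \<Rightarrow> complex \<Rightarrow> complex" where
  "pser a z = (\<Sum>n. a n * z ^ n)"
definition pser1 :: "(nat \<Rightarrow> complex) \<Rightarrow> complex \<Rightarrow> complex" where
  "pser1 a z = (\<Sum>n. diffs a n * z ^ n)"
definition pser2 :: "(nat \<Rightarrow> complex) \<Rightarrow> complex \<Rightarrow> complex" where
  "pser2 a z = (\<Sum>n. diffs (diffs a) n * z ^ n)"

lemma pser_0: "pser a 0 = a 0"
  unfolding pser_def by (simp add: powser_zero)

context confluent_heun
begin

context
  fixes a :: "nat \<Rightarrow> complex" and B :: real and N :: nat
  assumes decay: "\<And>n. n \<ge> N \<Longrightarrow> norm (a n) \<le> B / real n ^ 3"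
begin

text \<open>Cubic decay suits the flux argument: the coefficients of the first derivative are then
  summable, so the series and its derivative are bounded on the open disc, and those of the second
  derivative are bounded, so that it converges in the disc.\<close>

lemma diffs_decay: "n \<ge> N + 1 \<Longrightarrow> norm (diffs a n) \<le> \<bar>B\<bar> / (real n)\<^sup>2"
proof -
  assume n: "n \<ge> N + 1"
  have "norm (diffs a n) = real (Suc n) * norm (a (Suc n))" by (simp add: diffs_def norm_mult del: of_nat_Suc)
  also have "\<dots> \<le> real (Suc n) * (\<bar>B\<bar> / real (Suc n) ^ 3)"
    using n by (intro mult_left_mono order_trans[OF decay] divide_right_mono) auto
  also have "\<dots> = \<bar>B\<bar> / (real (Suc n))\<^sup>2" by (simp add: power2_eq_square power3_eq_cube del: of_nat_Suc)
  also have "\<dots> \<le> \<bar>B\<bar> / (real n)\<^sup>2" using n by (intro divide_left_mono power_mono mult_pos_pos) auto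
  finally show ?thesis .
qed

lemma diffs_diffs_bounded: "n \<ge> N + 1 \<Longrightarrow> norm (diffs (diffs a) n) \<le> \<bar>B\<bar>"
proof -
  assume n: "n \<ge> N + 1"
  have "norm (diffs (diffs a) n) = real (Suc n) * norm (diffs a (Suc n))" by (simp add: diffs_def[of "diffs a"] norm_mult del: of_nat_Suc)
  also have "\<dots> \<le> real (Suc n) * (\<bar>B\<bar> / (real (Suc n))\<^sup>2)"
    using n by (intro mult_left_mono diffs_decay) auto
  also have "\<dots> = \<bar>B\<bar> / real (Suc n)" by (simp add: power2_eq_square del: of_nat_Suc)
  also have "\<dots> \<le> \<bar>B\<bar> / 1" by (intro divide_left_mono) auto
  finally show ?thesis by simp
qed

lemma coeff_bounded:
  assumes "n \<ge> N + 1"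
  shows "norm (a n) \<le> \<bar>B\<bar>" "norm (diffs a n) \<le> \<bar>B\<bar>"
proof -
  have "norm (a n) \<le> \<bar>B\<bar> / real n ^ 3" using assms by (intro order_trans[OF decay] divide_right_mono) auto
  also have "\<dots> \<le> \<bar>B\<bar> / 1" using assms by (intro divide_left_mono one_le_power) auto
  finally show "norm (a n) \<le> \<bar>B\<bar>" by simp
  have "norm (diffs a n) \<le> \<bar>B\<bar> / (real n)\<^sup>2" by (rule diffs_decay[OF assms])
  also have "\<dots> \<le> \<bar>B\<bar> / 1" using assms by (intro divide_left_mono one_le_power) auto
  finally show "norm (diffs a n) \<le> \<bar>B\<bar>" by simp
qed

lemma pser_summable:
  assumes "norm z < 1"
  shows "summable (\<lambda>n. a n * z ^ n)" "summable (\<lambda>n. diffs a n * z ^ n)" "summable (\<lambda>n. diffs (diffs a) n * z ^ n)"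
  by (intro eventually_bounded_summable[of "N + 1" _ "\<bar>B\<bar>"] coeff_bounded diffs_diffs_bounded assms; assumption)+

lemma pser_deriv:
  assumes "norm z < 1"
  shows "(pser a has_field_derivative pser1 a z) (at z)" "(pser1 a has_field_derivative pser2 a z) (at z)"
  unfolding pser_def pser1_def pser2_def
  by (rule termdiffs_strong'[OF _ assms]; rule pser_summable; assumption)+

lemma pser_bounded:
  obtains C where "C > 0" "\<And>z. norm z < 1 \<Longrightarrow> norm (pser a z) \<le> C" "\<And>z. norm z < 1 \<Longrightarrow> norm (pser1 a z) \<le> C"
proof -
  have s0: "summable (\<lambda>n. norm (diffs a n))"
  proof (rule summable_comparison_test)
    show "\<exists>m. \<forall>n\<ge>m. norm (norm (diffs a n)) \<le> \<bar>B\<bar> * (1 / (real n)\<^sup>2)" using diffs_decay by auto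
    show "summable (\<lambda>n. \<bar>B\<bar> * (1 / (real n)\<^sup>2))" using inverse_power_summable[of 2, where 'a = real]
      by (intro summable_mult) (simp add: inverse_eq_divide)
  qed
  have s1: "summable (\<lambda>n. norm (a n))"
  proof (rule summable_comparison_test)
    have "norm (a n) \<le> \<bar>B\<bar> * (1 / (real n)\<^sup>2)" if "n \<ge> N + 1" for n
    proof -
      have "norm (a n) \<le> \<bar>B\<bar> / real n ^ 3" using that by (intro order_trans[OF decay] divide_right_mono) auto
      also have "\<dots> \<le> \<bar>B\<bar> / (real n)\<^sup>2" using that by (intro divide_left_mono power_increasing mult_pos_pos zero_less_power) auto
      finally show ?thesis by simp
    qed
    then show "\<exists>m. \<forall>n\<ge>m. norm (norm (a n)) \<le> \<bar>B\<bar> * (1 / (real n)\<^sup>2)" by auto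
    show "summable (\<lambda>n. \<bar>B\<bar> * (1 / (real n)\<^sup>2))" using inverse_power_summable[of 2, where 'a = real]
      by (intro summable_mult) (simp add: inverse_eq_divide)
  qed
  have gen: "norm (\<Sum>n. f n * z ^ n) \<le> (\<Sum>n. norm (f n))" if "summable (\<lambda>n. norm (f n))" "norm z < 1" for f :: "nat \<Rightarrow> complex" and z
  proof -
    have le: "norm (f n * z ^ n) \<le> norm (f n)" for n
      using that(2) by (simp add: norm_mult norm_power mult_left_le power_le_one)
    have "summable (\<lambda>n. norm (f n * z ^ n))" by (rule summable_comparison_test[OF _ that(1)]) (use le in auto)
    then show ?thesis using le that(1) by (intro order_trans[OF summable_norm] suminf_le)
  qed
  show ?thesis
  proof (rule that[of "(\<Sum>n. norm (a n)) + (\<Sum>n. norm (diffs a n)) + 1"])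
    have p: "(\<Sum>n. norm (a n)) \<ge> 0" "(\<Sum>n. norm (diffs a n)) \<ge> 0" using s0 s1 by (auto intro: suminf_nonneg)
    show "(\<Sum>n. norm (a n)) + (\<Sum>n. norm (diffs a n)) + 1 > 0" using p by simp
    show "norm (pser a z) \<le> (\<Sum>n. norm (a n)) + (\<Sum>n. norm (diffs a n)) + 1"
        "norm (pser1 a z) \<le> (\<Sum>n. norm (a n)) + (\<Sum>n. norm (diffs a n)) + 1" if "norm z < 1" for z
      using gen[OF s0 that] gen[OF s1 that] p unfolding pser_def pser1_def by linarith+
  qed
qed

text \<open>By \<open>op_psum\<close> the partial sums leave two terms. Their coefficients are
  bounded, because \<open>al\<close> and \<open>ga\<close> are quadratic in n and \<open>a\<close>
  decays cubically, so the terms tend to 0 inside the disc.\<close>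

lemma pser_op:
  assumes rec0: "\<And>n. rec a n = 0" and z: "norm z < 1"
  shows "op z (pser a z) (pser1 a z) (pser2 a z) = 0"
proof -
  have 0: "(\<lambda>n. psum a n z) \<longlonglongrightarrow> pser a z"
    using summable_LIMSEQ'[OF pser_summable(1)[OF z]] by (simp add: psum_def pser_def)
  have s1: "(\<lambda>n. of_nat n * a n * z ^ (n - Suc 0)) sums pser1 a z"
    unfolding pser1_def by (rule diffs_equiv[OF pser_summable(2)[OF z]])
  then have 1: "(\<lambda>n. psum' a n z) \<longlonglongrightarrow> pser1 a z"
    unfolding sums_def_le psum'_def by (simp add: mult_ac)
  have "(\<lambda>n. of_nat n * diffs a n * z ^ (n - Suc 0)) sums pser2 a z"
    unfolding pser2_def by (rule diffs_equiv[OF pser_summable(3)[OF z]])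
  then have "(\<lambda>n. a (Suc n) * (of_nat (Suc n) * (of_nat (Suc n - 1) * z ^ (Suc n - 1 - 1)))) sums pser2 a z"
    by (simp add: diffs_def mult_ac del: of_nat_Suc)
  from sums_Suc[OF this]
  have "(\<lambda>n. a n * (of_nat n * (of_nat (n - 1) * z ^ (n - 1 - 1)))) sums pser2 a z" by simp
  then have 2: "(\<lambda>n. psum'' a n z) \<longlonglongrightarrow> pser2 a z"
    unfolding sums_def_le psum''_def .
  have lim: "(\<lambda>n. op z (psum a n z) (psum' a n z) (psum'' a n z)) \<longlonglongrightarrow> op z (pser a z) (pser1 a z) (pser2 a z)"
    unfolding op_def by (intro tendsto_intros 0 1 2)
  have "(\<lambda>n. op z (psum a n z) (psum' a n z) (psum'' a n z)) \<longlonglongrightarrow> 0"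
  proof -
    have za: "(\<lambda>n. a n * z ^ n) \<longlonglongrightarrow> 0" "(\<lambda>n. diffs a n * z ^ n) \<longlonglongrightarrow> 0" "(\<lambda>n. diffs (diffs a) n * z ^ n) \<longlonglongrightarrow> 0"
      by (intro summable_LIMSEQ_zero pser_summable[OF z])+
    have bb: "\<exists>C. \<forall>n\<ge>N + 2. norm (of_nat n ^ 2 * a n) \<le> C"
    proof (intro exI allI impI)
      fix n assume n: "n \<ge> N + 2"
      have "norm (of_nat n ^ 2 * a n) = (real n)\<^sup>2 * norm (a n)" by (simp add: norm_mult norm_power)
      also have "\<dots> \<le> (real n)\<^sup>2 * (\<bar>B\<bar> / real n ^ 3)" using n by (intro mult_left_mono order_trans[OF decay] divide_right_mono) auto
      also have "\<dots> = \<bar>B\<bar> / real n" using n by (simp add: power2_eq_square power3_eq_cube)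
      also have "\<dots> \<le> \<bar>B\<bar> / 1" using n by (intro divide_left_mono) auto
      finally show "norm (of_nat n ^ 2 * a n) \<le> \<bar>B\<bar>" by simp
    qed
    have q: "(\<lambda>n. (of_nat n ^ 2 * X + of_nat n * Y + V) * a n * z ^ n) \<longlonglongrightarrow> 0" for X Y V
    proof -
      obtain C where C: "\<And>n. n \<ge> N + 2 \<Longrightarrow> norm (of_nat n ^ 2 * a n) \<le> C" using bb by blast
      have C2: "norm (of_nat n * a n) \<le> C" "norm (a n) \<le> C" if n: "n \<ge> N + 2" for n
      proof -
        have "norm (of_nat n * a n) = real n ^ 1 * norm (a n)" by (simp add: norm_mult)
        also have "\<dots> \<le> real n ^ 2 * norm (a n)" using n by (intro mult_right_mono power_increasing) auto
        also have "\<dots> \<le> C" using C[OF n] by (simp add: norm_mult norm_power)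
        finally show 1: "norm (of_nat n * a n) \<le> C" .
        have "norm (a n) = real n ^ 0 * norm (a n)" by simp
        also have "\<dots> \<le> real n ^ 2 * norm (a n)" using n by (intro mult_right_mono power_increasing) auto
        also have "\<dots> \<le> C" using C[OF n] by (simp add: norm_mult norm_power)
        finally show "norm (a n) \<le> C" .
      qed
      have l: "(\<lambda>n. X * ((of_nat n ^ 2 * a n) * z ^ n) + Y * ((of_nat n * a n) * z ^ n) + V * (a n * z ^ n)) \<longlonglongrightarrow> X * 0 + Y * 0 + V * 0"
        by (intro tendsto_intros summable_LIMSEQ_zero eventually_bounded_summable[of "N + 2" _ C] C C2 z; assumption)
      then show ?thesis by (simp add: algebra_simps)
    qed
    have "(\<lambda>n. (of_nat n ^ 2 * 1 + of_nat n * (P0 - 1) + (0::complex)) * a n * z ^ n) \<longlonglongrightarrow> 0"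
         "(\<lambda>n. (of_nat n ^ 2 * 1 + of_nat n * (P2 - 1) + R1) * a n * z ^ n) \<longlonglongrightarrow> 0"
      by (rule q)+
    note l1 = LIMSEQ_Suc[OF this(1)] and l2 = this(2)
    have al_eq: "al n = of_nat (Suc n) ^ 2 * 1 + of_nat (Suc n) * (P0 - 1) + 0"
     and ga_eq: "ga (Suc n) = of_nat n ^ 2 * 1 + of_nat n * (P2 - 1) + R1" for n
      by (simp_all add: al_def ga_def power2_eq_square algebra_simps)
    show ?thesis
    proof (cases "z = 0")
      case True
      have "op 0 (psum a n 0) (psum' a n 0) (psum'' a n 0) = 0" if "n \<ge> 1" for n
        unfolding op_psum using rec0 that by simp
      then show ?thesis unfolding True by (intro tendsto_eventually eventually_sequentiallyI[of 1])
    next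
      case False
      have lim: "(\<lambda>n. - (inverse z * (al n * a (Suc n) * z ^ Suc n)) + z * (ga (Suc n) * a n * z ^ n)) \<longlonglongrightarrow> - (inverse z * 0) + z * 0"
        unfolding al_eq ga_eq by (intro tendsto_intros l1 l2)
      have eq: "inverse z * (al n * a (Suc n) * z ^ Suc n) = al n * a (Suc n) * z ^ n" for n
        using False by simp
      have "op z (psum a n z) (psum' a n z) (psum'' a n z) = - (al n * a (Suc n) * z ^ n) + z * (ga (Suc n) * a n * z ^ n)" for n
        unfolding op_psum using rec0 by simp
      with lim[unfolded eq] show ?thesis by simp
    qed
  qed
  from LIMSEQ_unique[OF lim this] show ?thesis .
qed

end


section \<open>Conservation of the flux, in real and imaginary parts\<close>

lemma flux_algebra:
  fixes x y x1 y1 A B pr pi rr ri M M' z S t :: real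
  assumes "A + (pr * x1 - pi * y1) + (rr * x - ri * y) = 0"
    "B + (pr * y1 + pi * x1) + (rr * y + ri * x) = 0"
    "pr = (2 * S + 1) * t\<^sup>2 - 2 * z * t" "pi = 2 * M" "z * ri = 2 * S * M + z * M'"
  shows "z * (M' * (x\<^sup>2 + y\<^sup>2) + 2 * M * (x * x1 + y * y1) + (t\<^sup>2 - 2 * z * t) * (y1 * x - x1 * y) + (B * x - A * y))
     + 2 * S * (M * (x\<^sup>2 + y\<^sup>2) + z * t\<^sup>2 * (y1 * x - x1 * y)) = 0"
proof -
  have A: "A = - (pr * x1 - pi * y1) - (rr * x - ri * y)" and B: "B = - (pr * y1 + pi * x1) - (rr * y + ri * x)"
    using assms(1,2) by linarith+
  have "z * (M' * (x\<^sup>2 + y\<^sup>2) + 2 * M * (x * x1 + y * y1) + (t\<^sup>2 - 2 * z * t) * (y1 * x - x1 * y) + (B * x - A * y))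
     + 2 * S * (M * (x\<^sup>2 + y\<^sup>2) + z * t\<^sup>2 * (y1 * x - x1 * y)) =
     (z * M' + 2 * S * M - z * ri) * (x\<^sup>2 + y\<^sup>2) + z * (2 * M - pi) * (x * x1 + y * y1) +
     z * (t\<^sup>2 - 2 * z * t - pr + 2 * S * t\<^sup>2) * (y1 * x - x1 * y)"
    unfolding A B by (simp add: algebra_simps power2_eq_square)
  also have "\<dots> = 0" unfolding assms(3-5) by (simp add: algebra_simps)
  finally show ?thesis .
qed

text \<open>This is z (1 - z)^2 Im (w' cnj w) for w = exp (i \<theta>) u with \<theta>' = M / (z (1
  - z)^2): the usual current, after a phase has removed the imaginary part 2 M of the first-order
  coefficient.\<close>

definition flux :: "(real \<Rightarrow> real) \<Rightarrow> complex \<Rightarrow> complex \<Rightarrow> real \<Rightarrow> real" where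
  "flux M u u1 z = M z * (norm u)\<^sup>2 + z * (1 - z)\<^sup>2 * Im (u1 * cnj u)"

text \<open>\<open>imR\<close> says that the potential becomes real once the phase is removed. The
  real part of the first-order coefficient is the derivative of z (1 - z)^2 plus 2 S (1 - z)^2, and
  the second summand makes z^(2 S) the integrating factor.\<close>

lemma flux_const:
  fixes M M' :: "real \<Rightarrow> real" and S :: nat and u u1 u2 :: "real \<Rightarrow> complex"
  assumes u: "\<And>z. z \<in> {0<..<1} \<Longrightarrow> (u has_vector_derivative u1 z) (at z)"
    "\<And>z. z \<in> {0<..<1} \<Longrightarrow> (u1 has_vector_derivative u2 z) (at z)"
    "\<And>z. z \<in> {0<..<1} \<Longrightarrow> op (of_real z) (u z) (u1 z) (u2 z) = 0"
    and M: "\<And>z. z \<in> {0<..<1} \<Longrightarrow> (M has_real_derivative M' z) (at z)"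
    and reP: "\<And>z. z \<in> {0<..<1} \<Longrightarrow> Re (P (of_real z)) = (2 * real S + 1) * (1 - z)\<^sup>2 - 2 * z * (1 - z)"
    and imP: "\<And>z. z \<in> {0<..<1} \<Longrightarrow> Im (P (of_real z)) = 2 * M z"
    and imR: "\<And>z. z \<in> {0<..<1} \<Longrightarrow> z * Im (R (of_real z)) = 2 * real S * M z + z * M' z"
  shows "\<exists>q. \<forall>z\<in>{0<..<1}. z ^ (2 * S) * flux M (u z) (u1 z) z = q"
proof -
  define x where "x = (\<lambda>z. Re (u z))"
  define y where "y = (\<lambda>z. Im (u z))"
  define x1 where "x1 = (\<lambda>z. Re (u1 z))"
  define y1 where "y1 = (\<lambda>z. Im (u1 z))"
  define I where "I = (\<lambda>z. M z * ((x z)\<^sup>2 + (y z)\<^sup>2) + z * (1 - z)\<^sup>2 * (y1 z * x z - x1 z * y z))"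
  have I_eq: "flux M (u z) (u1 z) z = I z" for z
    by (simp add: flux_def I_def x_def y_def x1_def y1_def cmod_power2)
  have "((\<lambda>z. z ^ (2 * S) * I z) has_real_derivative 0) (at z)" if z: "z \<in> {0<..<1}" for z
  proof -
    define x2 where "x2 = Re (u2 z)"
    define y2 where "y2 = Im (u2 z)"
    have d: "(x has_real_derivative x1 z) (at z)" "(y has_real_derivative y1 z) (at z)"
      "(x1 has_real_derivative x2) (at z)" "(y1 has_real_derivative y2) (at z)"
      using u(1,2)[OF z] unfolding has_vector_derivative_complex_iff x_def y_def x1_def y1_def x2_def y2_def
      by (simp_all add: has_real_derivative_iff_has_vector_derivative)
    define I1 where "I1 = M' z * ((x z)\<^sup>2 + (y z)\<^sup>2) + 2 * M z * (x z * x1 z + y z * y1 z) +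
       ((1 - z)\<^sup>2 - 2 * z * (1 - z)) * (y1 z * x z - x1 z * y z) + ((z * (1 - z)\<^sup>2 * y2) * x z - (z * (1 - z)\<^sup>2 * x2) * y z)"
    have dI: "(I has_real_derivative I1) (at z)"
      unfolding I_def
      by (rule derivative_eq_intros M[OF z] d refl)+ (simp add: I1_def algebra_simps power2_eq_square)
    have "z * I1 + 2 * real S * I z = 0"
      unfolding I1_def I_def
    proof (rule flux_algebra[OF _ _ reP[OF z] imP[OF z] imR[OF z]])
      show "z * (1 - z)\<^sup>2 * x2 + (Re (P (of_real z)) * x1 z - Im (P (of_real z)) * y1 z) +
        (Re (R (of_real z)) * x z - Im (R (of_real z)) * y z) = 0"
        using arg_cong[OF u(3)[OF z], of Re] unfolding op_def x_def y_def x1_def y1_def x2_def y2_def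
        by (simp add: Re_power2 Im_power2 power2_eq_square)
      show "z * (1 - z)\<^sup>2 * y2 + (Re (P (of_real z)) * y1 z + Im (P (of_real z)) * x1 z) +
        (Re (R (of_real z)) * y z + Im (R (of_real z)) * x z) = 0"
        using arg_cong[OF u(3)[OF z], of Im] unfolding op_def x_def y_def x1_def y1_def x2_def y2_def
        by (simp add: Re_power2 Im_power2 power2_eq_square)
    qed
    then have "z ^ (2 * S) * (z * I1 + 2 * real S * I z) = 0" by simp
    moreover have "z * (z ^ (2 * S) * I1 + (real (2 * S) * z ^ (2 * S - 1)) * I z) = z ^ (2 * S) * (z * I1 + 2 * real S * I z)"
      by (cases S) (simp_all add: algebra_simps)
    ultimately have "z ^ (2 * S) * I1 + (real (2 * S) * z ^ (2 * S - 1)) * I z = 0" using z by simp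
    moreover have "((\<lambda>z. z ^ (2 * S) * I z) has_real_derivative (z ^ (2 * S) * I1 + (real (2 * S) * z ^ (2 * S - 1)) * I z)) (at z)"
      using DERIV_mult[OF DERIV_pow[of "2 * S" z] dI] by (simp add: add.commute mult.commute)
    ultimately show ?thesis by simp
  qed
  then have "\<exists>q. \<forall>z\<in>{0<..<1}. z ^ (2 * S) * I z = q"
    by (intro has_field_derivative_zero_constant) (auto intro: has_field_derivative_at_within)
  then show ?thesis unfolding I_eq .
qed

text \<open>At z = 0 the flux is M 0 |a 0|^2. At z = 1 the term with u' disappears because u' is
  bounded, so the flux has the sign of M 1 or is zero. Being constant, it must vanish when M 0 and M
  1 have opposite signs.\<close>

lemma flux_vanish_regular:
  assumes a: "\<And>n. rec a n = 0" "\<And>n. n \<ge> N \<Longrightarrow> norm (a n) \<le> B / real n ^ 3"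
    and M: "\<And>z. (M has_real_derivative M' z) (at z)"
    and reP: "\<And>z. z \<in> {0<..<1} \<Longrightarrow> Re (P (of_real z)) = (1 - z)\<^sup>2 - 2 * z * (1 - z)"
    and imP: "\<And>z. z \<in> {0<..<1} \<Longrightarrow> Im (P (of_real z)) = 2 * M z"
    and imR: "\<And>z. z \<in> {0<..<1} \<Longrightarrow> Im (R (of_real z)) = M' z"
    and sign: "M 0 * M 1 < 0"
  shows "a 0 = 0"
proof -
  have wd: "(pser a has_field_derivative pser1 a z) (at z)" "(pser1 a has_field_derivative pser2 a z) (at z)" if "norm z < 1" for z
    using pser_deriv a that by blast+
  have wo: "op z (pser a z) (pser1 a z) (pser2 a z) = 0" if "norm z < 1" for z
    using pser_op a that by blast
  obtain C where C: "C > 0" "\<And>z. norm z < 1 \<Longrightarrow> norm (pser a z) \<le> C" "\<And>z. norm z < 1 \<Longrightarrow> norm (pser1 a z) \<le> C"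
    using pser_bounded a by blast
  have "\<exists>q. \<forall>z\<in>{0<..<1}. z ^ (2 * 0) * flux M (pser a (of_real z)) (pser1 a (of_real z)) z = q"
  proof (rule flux_const[where M' = M' and ?u2.0 = "\<lambda>z. pser2 a (of_real z)"])
    fix z :: real assume z: "z \<in> {0<..<1}"
    then have n: "norm (complex_of_real z) < 1" by simp
    show "((\<lambda>z. pser a (of_real z)) has_vector_derivative pser1 a (of_real z)) (at z)"
      by (rule has_vector_derivative_real_field[OF wd(1)[OF n]])
    show "((\<lambda>z. pser1 a (of_real z)) has_vector_derivative pser2 a (of_real z)) (at z)"
      by (rule has_vector_derivative_real_field[OF wd(2)[OF n]])
  qed (use assms wo in auto)
  then obtain q where q: "\<And>z. z \<in> {0<..<1} \<Longrightarrow> flux M (pser a (of_real z)) (pser1 a (of_real z)) z = q" by auto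
  have D: "\<bar>Im (pser1 a (of_real z) * cnj (pser a (of_real z)))\<bar> \<le> C * C" if z: "z \<in> {0<..<1}" for z
  proof -
    have "\<bar>Im (pser1 a (of_real z) * cnj (pser a (of_real z)))\<bar> \<le> norm (pser1 a (of_real z)) * norm (pser a (of_real z))"
      using abs_Im_le_cmod[of "pser1 a (of_real z) * cnj (pser a (of_real z))"] by (simp add: norm_mult)
    also have "\<dots> \<le> C * C" using C z by (intro mult_mono) auto
    finally show ?thesis .
  qed
  have cM: "isCont M z" for z using M DERIV_isCont by blast
  have q0: "q = M 0 * (norm (a 0))\<^sup>2"
  proof (rule tendsto_unique[of "at_right 0"])
    have "isCont (pser a) 0" using wd(1)[of 0] DERIV_isCont by auto
    then have "((\<lambda>z. pser a (of_real z)) \<longlongrightarrow> pser a 0) (at_right 0)"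
      by (intro isCont_tendsto_compose[of 0 "pser a"] tendsto_eq_intros) auto
    moreover have "(M \<longlongrightarrow> M 0) (at_right 0)" using cM[of 0] by (simp add: isCont_def filterlim_at_split)
    moreover have "((\<lambda>z. z * (1 - z)\<^sup>2 * Im (pser1 a (of_real z) * cnj (pser a (of_real z)))) \<longlongrightarrow> 0) (at_right 0)"
    proof (rule Lim_null_comparison)
      show "eventually (\<lambda>z. norm (z * (1 - z)\<^sup>2 * Im (pser1 a (of_real z) * cnj (pser a (of_real z)))) \<le> z * (1 - z)\<^sup>2 * (C * C)) (at_right 0)"
        unfolding eventually_at_right_field
        using D by (intro exI[of _ 1]) (auto simp: abs_mult intro!: mult_left_mono)
      have "((\<lambda>z::real. z * (1 - z)\<^sup>2 * (C * C)) \<longlongrightarrow> 0 * (1 - 0)\<^sup>2 * (C * C)) (at_right 0)" by (intro tendsto_intros)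
      then show "((\<lambda>z::real. z * (1 - z)\<^sup>2 * (C * C)) \<longlongrightarrow> 0) (at_right 0)" by simp
    qed
    ultimately have "((\<lambda>z. flux M (pser a (of_real z)) (pser1 a (of_real z)) z) \<longlongrightarrow> M 0 * (norm (pser a 0))\<^sup>2 + 0) (at_right 0)"
      unfolding flux_def by (intro tendsto_intros)
    then show "((\<lambda>z. flux M (pser a (of_real z)) (pser1 a (of_real z)) z) \<longlongrightarrow> M 0 * (norm (a 0))\<^sup>2) (at_right 0)"
      by (simp add: pser_0)
    show "((\<lambda>z. flux M (pser a (of_real z)) (pser1 a (of_real z)) z) \<longlongrightarrow> q) (at_right 0)"
      by (rule tendsto_eventually) (auto simp: eventually_at_right_field q intro!: exI[of _ 1])
  qed auto
  have "q * M 1 \<ge> 0"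
  proof (rule tendsto_lowerbound[of "\<lambda>z. q * M 1 + (1 - z)\<^sup>2 * (\<bar>M 1\<bar> * (C * C))" _ "at_left 1"])
    have "((\<lambda>z. q * M 1 + (1 - z)\<^sup>2 * (\<bar>M 1\<bar> * (C * C))) \<longlongrightarrow> q * M 1 + (1 - 1)\<^sup>2 * (\<bar>M 1\<bar> * (C * C))) (at_left 1)"
      by (intro tendsto_intros)
    then show "((\<lambda>z. q * M 1 + (1 - z)\<^sup>2 * (\<bar>M 1\<bar> * (C * C))) \<longlongrightarrow> q * M 1) (at_left 1)" by simp
    have "((\<lambda>z. M z * M 1) \<longlongrightarrow> M 1 * M 1) (at_left 1)"
      using cM[of 1] by (intro tendsto_intros) (simp add: isCont_def filterlim_at_split)
    moreover have "M 1 * M 1 > 0" using sign by (cases "M 1 = 0") (auto simp: zero_less_mult_iff)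
    ultimately have ev: "eventually (\<lambda>z. M z * M 1 > 0) (at_left 1)" by (rule order_tendstoD)
    have "eventually (\<lambda>z. z \<in> {0<..<1}) (at_left (1::real))"
      by (auto simp: eventually_at_left_field intro!: exI[of _ 0])
    with ev show "eventually (\<lambda>z. 0 \<le> q * M 1 + (1 - z)\<^sup>2 * (\<bar>M 1\<bar> * (C * C))) (at_left 1)"
    proof eventually_elim
      case (elim z)
      define d where "d = Im (pser1 a (of_real z) * cnj (pser a (of_real z)))"
      have "q * M 1 = (M z * M 1) * (norm (pser a (of_real z)))\<^sup>2 + z * (1 - z)\<^sup>2 * d * M 1"
        unfolding q[OF elim(2), symmetric] flux_def d_def by (simp add: algebra_simps)
      moreover have "(M z * M 1) * (norm (pser a (of_real z)))\<^sup>2 \<ge> 0" using elim by simp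
      moreover have "\<bar>z * (1 - z)\<^sup>2 * d * M 1\<bar> \<le> 1 * (1 - z)\<^sup>2 * (C * C) * \<bar>M 1\<bar>"
        unfolding abs_mult using elim D[OF elim(2)] C(1) unfolding d_def
        by (intro mult_mono) auto
      ultimately show ?case by (simp add: mult_ac)
    qed
  qed auto
  then have "(M 0 * M 1) * (norm (a 0))\<^sup>2 \<ge> 0" unfolding q0 by (simp add: mult_ac)
  with mult_neg_pos[OF sign, of "(norm (a 0))\<^sup>2"] show ?thesis by fastforce
qed

text \<open>
  Here the flux vanishes at the horizon, hence everywhere, so that \<open>u = O((1 - z)\<^sup>2 u')\<close> near \<open>z = 1\<close>.  The equation
  then forces \<open>(1 - z)\<^sup>4 |u'|\<^sup>2\<close> to be almost constant, which is only possible for bounded \<open>u'\<close> if \<open>u' = 0\<close>.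
\<close>

lemma flux_vanish_irregular:
  assumes a: "\<And>n. rec a n = 0" "\<And>n. n \<ge> N \<Longrightarrow> norm (a n) \<le> B / real n ^ 3"
    and S: "S \<ge> 1"
    and M: "\<And>z. (M has_real_derivative M' z) (at z)"
    and reP: "\<And>z. z \<in> {0<..<1} \<Longrightarrow> Re (P (of_real z)) = (2 * real S + 1) * (1 - z)\<^sup>2 - 2 * z * (1 - z)"
    and imP: "\<And>z. z \<in> {0<..<1} \<Longrightarrow> Im (P (of_real z)) = 2 * M z"
    and imR: "\<And>z. z \<in> {0<..<1} \<Longrightarrow> z * Im (R (of_real z)) = 2 * real S * M z + z * M' z"
    and M1: "M 1 \<noteq> 0"
  shows "a 0 = 0"
proof -
  have wd: "(pser a has_field_derivative pser1 a z) (at z)" "(pser1 a has_field_derivative pser2 a z) (at z)" if "norm z < 1" for z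
    using pser_deriv a that by blast+
  have wo: "op z (pser a z) (pser1 a z) (pser2 a z) = 0" if "norm z < 1" for z
    using pser_op a that by blast
  obtain C where C: "C > 0" "\<And>z. norm z < 1 \<Longrightarrow> norm (pser a z) \<le> C" "\<And>z. norm z < 1 \<Longrightarrow> norm (pser1 a z) \<le> C"
    using pser_bounded a by blast
  define u u1 u2 where "u = (\<lambda>z. pser a (of_real z))" and "u1 = (\<lambda>z. pser1 a (of_real z))" and "u2 = (\<lambda>z. pser2 a (of_real z))"
  have du: "(u has_vector_derivative u1 z) (at z)" "(u1 has_vector_derivative u2 z) (at z)"
    and uop: "op (of_real z) (u z) (u1 z) (u2 z) = 0"
    and uC: "norm (u z) \<le> C" "norm (u1 z) \<le> C" if z: "z \<in> {0<..<1}" for z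
  proof -
    have n: "norm (complex_of_real z) < 1" using z by simp
    show "(u has_vector_derivative u1 z) (at z)" unfolding u_def u1_def
      by (rule has_vector_derivative_real_field[OF wd(1)[OF n]])
    show "(u1 has_vector_derivative u2 z) (at z)" unfolding u1_def u2_def
      by (rule has_vector_derivative_real_field[OF wd(2)[OF n]])
    show "op (of_real z) (u z) (u1 z) (u2 z) = 0" unfolding u_def u1_def u2_def by (rule wo[OF n])
    show "norm (u z) \<le> C" "norm (u1 z) \<le> C" unfolding u_def u1_def using C n by auto
  qed
  obtain q where q: "\<And>z. z \<in> {0<..<1} \<Longrightarrow> z ^ (2 * S) * flux M (u z) (u1 z) z = q"
    using flux_const[OF du uop M reP imP imR] by blast
  have D: "\<bar>Im (u1 z * cnj (u z))\<bar> \<le> norm (u1 z) * norm (u z)" for z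
    using abs_Im_le_cmod[of "u1 z * cnj (u z)"] by (simp add: norm_mult)
  have cM: "isCont M z" for z using M DERIV_isCont by blast
  have cM': "continuous_on {0..1} M" using cM by (simp add: continuous_at_imp_continuous_on)
  have "compact (M ` {0..1})" by (rule compact_continuous_image[OF cM']) simp
  then obtain m where m: "m > 0" "\<And>z. z \<in> {0..1} \<Longrightarrow> \<bar>M z\<bar> \<le> m"
    using compact_imp_bounded bounded_pos by (metis imageI real_norm_def)
  have q0: "q = 0"
  proof (rule tendsto_unique[of "at_right 0"])
    show "((\<lambda>z. z ^ (2 * S) * flux M (u z) (u1 z) z) \<longlongrightarrow> q) (at_right 0)"
      by (rule tendsto_eventually) (auto simp: eventually_at_right_field q intro!: exI[of _ 1])
    show "((\<lambda>z. z ^ (2 * S) * flux M (u z) (u1 z) z) \<longlongrightarrow> 0) (at_right 0)"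
    proof (rule Lim_null_comparison)
      have "((\<lambda>z::real. z ^ (2 * S) * (m * C\<^sup>2 + C * C)) \<longlongrightarrow> 0 ^ (2 * S) * (m * C\<^sup>2 + C * C)) (at_right 0)" by (intro tendsto_intros)
      then show "((\<lambda>z::real. z ^ (2 * S) * (m * C\<^sup>2 + C * C)) \<longlongrightarrow> 0) (at_right 0)" using S by (simp add: power_0_left)
      have "norm (z ^ (2 * S) * flux M (u z) (u1 z) z) \<le> z ^ (2 * S) * (m * C\<^sup>2 + C * C)" if z: "z \<in> {0<..<1}" for z
      proof -
        have "\<bar>M z * (norm (u z))\<^sup>2\<bar> \<le> m * C\<^sup>2" unfolding abs_mult
          using m z uC[OF z] by (intro mult_mono) (auto intro: power_mono)
        moreover have "\<bar>z * (1 - z)\<^sup>2 * Im (u1 z * cnj (u z))\<bar> \<le> 1 * (C * C)" unfolding abs_mult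
        proof (rule mult_mono)
          show "\<bar>z\<bar> * \<bar>(1 - z)\<^sup>2\<bar> \<le> 1" using z by (intro mult_le_one) (auto simp: power_le_one)
          show "\<bar>Im (u1 z * cnj (u z))\<bar> \<le> C * C" using uC[OF z] C(1) by (intro order_trans[OF D] mult_mono) auto
        qed auto
        ultimately have "\<bar>flux M (u z) (u1 z) z\<bar> \<le> m * C\<^sup>2 + C * C" unfolding flux_def by linarith
        then show ?thesis using z by (simp add: abs_mult mult_left_mono)
      qed
      then show "eventually (\<lambda>z. norm (z ^ (2 * S) * flux M (u z) (u1 z) z) \<le> z ^ (2 * S) * (m * C\<^sup>2 + C * C)) (at_right 0)"
        by (auto simp: eventually_at_right_field intro!: exI[of _ 1])
    qed
  qed auto
  have fl0: "flux M (u z) (u1 z) z = 0" if "z \<in> {0<..<1}" for z using q[OF that] q0 that by simp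
  have "((\<lambda>z. \<bar>M z\<bar>) \<longlongrightarrow> \<bar>M 1\<bar>) (at_left 1)"
    using cM[of 1] by (intro tendsto_intros) (simp add: isCont_def filterlim_at_split)
  then have "eventually (\<lambda>z. \<bar>M z\<bar> > \<bar>M 1\<bar> / 2) (at_left 1)" using M1 by (intro order_tendstoD) auto
  then obtain z0 where z0: "z0 < 1" "\<And>z. z0 < z \<Longrightarrow> z < 1 \<Longrightarrow> \<bar>M z\<bar> > \<bar>M 1\<bar> / 2"
    unfolding eventually_at_left_field by blast
  define z1 where "z1 = max (1/2) ((z0 + 1) / 2)"
  have z1: "1/2 \<le> z1" "z1 < 1" "z0 < z1" using z0(1) by (auto simp: z1_def max_def)
  \<comment> \<open>Vanishing flux gives |M| |u|^2 <= (1 - z)^2 |u'| |u|, and |M| exceeds |M 1| / 2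
    beyond \<open>z1\<close>.\<close>
  define k where "k = 2 / \<bar>M 1\<bar>"
  have k: "k > 0" using M1 by (simp add: k_def)
  have u_le: "norm (u z) \<le> k * (1 - z)\<^sup>2 * norm (u1 z)" if z: "z \<in> {z1..<1}" for z
  proof (cases "u z = 0")
    case False
    have z': "z \<in> {0<..<1}" using z z1 by auto
    have "\<bar>M z\<bar> * (norm (u z))\<^sup>2 = \<bar>M z * (norm (u z))\<^sup>2\<bar>" by (simp add: abs_mult)
    also have "\<dots> = \<bar>z * (1 - z)\<^sup>2 * Im (u1 z * cnj (u z))\<bar>" using fl0[OF z'] unfolding flux_def by linarith
    also have "\<dots> \<le> (1 * (1 - z)\<^sup>2) * (norm (u1 z) * norm (u z))"
      unfolding abs_mult using z' D by (intro mult_mono) auto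
    finally have "\<bar>M z\<bar> * norm (u z) * norm (u z) \<le> (1 - z)\<^sup>2 * norm (u1 z) * norm (u z)"
      by (simp add: power2_eq_square mult_ac)
    then have 1: "\<bar>M z\<bar> * norm (u z) \<le> (1 - z)\<^sup>2 * norm (u1 z)" using False by simp
    have "\<bar>M 1\<bar> / 2 * norm (u z) \<le> \<bar>M z\<bar> * norm (u z)"
      using z0(2)[of z] z z1 by (intro mult_right_mono) auto
    with 1 have "\<bar>M 1\<bar> / 2 * norm (u z) \<le> (1 - z)\<^sup>2 * norm (u1 z)" by linarith
    then show ?thesis using M1 unfolding k_def by (simp add: field_simps)
  qed (use k in simp)
  define rb where "rb = norm R0 + norm R1"
  have R_le: "norm (R (of_real z)) \<le> rb" if "z \<in> {0<..<1}" for z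
  proof -
    have "norm (R (of_real z)) \<le> norm R0 + norm (R1 * of_real z)" unfolding R_def by (rule norm_triangle_ineq)
    also have "norm (R1 * of_real z) \<le> norm R1" using that by (simp add: norm_mult mult_left_le)
    finally show ?thesis by (simp add: rb_def)
  qed
  define X where "X = (\<lambda>z. (norm (u1 z))\<^sup>2)"
  define Y where "Y = (\<lambda>z. (1 - z) ^ 4 * X z)"
  \<comment> \<open>In the equation for X = |u'|^2 the term -2 z (1 - z) of Re P produces 4 X / (1 -
    z), which is exactly what differentiating (1 - z)^4 takes away. The rest is controlled by 2 (2 S
    + 1) + 2 rb k, doubled because one divides by z >= 1/2.\<close>
  define K where "K = 4 * (2 * real S + 1) + 4 * rb * k"
  define X' where "X' = (\<lambda>z. 2 * Re (u2 z * cnj (u1 z)))"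
  have dX: "(X has_real_derivative X' z) (at z)" if "z \<in> {0<..<1}" for z
  proof -
    have d: "((\<lambda>z. Re (u1 z)) has_real_derivative Re (u2 z)) (at z)" "((\<lambda>z. Im (u1 z)) has_real_derivative Im (u2 z)) (at z)"
      using du(2)[OF that] unfolding has_vector_derivative_complex_iff by (simp_all add: has_real_derivative_iff_has_vector_derivative)
    have "((\<lambda>z. (Re (u1 z))\<^sup>2 + (Im (u1 z))\<^sup>2) has_real_derivative X' z) (at z)"
      by (rule DERIV_cong[OF DERIV_add[OF DERIV_power[OF d(1)] DERIV_power[OF d(2)]]]) (simp add: X'_def algebra_simps)
    then show ?thesis unfolding X_def cmod_power2 .
  qed
  have dY: "(Y has_real_derivative (1 - z) ^ 4 * X' z - 4 * (1 - z) ^ 3 * X z) (at z)" if "z \<in> {0<..<1}" for z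
    unfolding Y_def by (rule derivative_eq_intros dX[OF that] refl)+ simp
  have Y_ge: "(1 - z) ^ 4 * X' z - 4 * (1 - z) ^ 3 * X z \<ge> - K * Y z" if z: "z \<in> {z1..<1}" for z
  proof -
    have z': "z \<in> {0<..<1}" using z z1 by auto
    have ode: "of_real z * (1 - of_real z)\<^sup>2 * u2 z = - (P (of_real z) * u1 z + R (of_real z) * u z)"
      using uop[OF z'] unfolding op_def eq_neg_iff_add_eq_0 by (simp add: add.assoc)
    have "of_real (z * (1 - z)\<^sup>2) * (u2 z * cnj (u1 z)) = (of_real z * (1 - of_real z)\<^sup>2 * u2 z) * cnj (u1 z)"
      by (simp add: mult_ac)
    also have "\<dots> = - (P (of_real z) * (u1 z * cnj (u1 z)) + R (of_real z) * (u z * cnj (u1 z)))"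
      unfolding ode by (simp add: algebra_simps)
    finally have "of_real (z * (1 - z)\<^sup>2) * (u2 z * cnj (u1 z)) = - (P (of_real z) * (u1 z * cnj (u1 z)) + R (of_real z) * (u z * cnj (u1 z)))" .
    moreover define v where "v = u2 z * cnj (u1 z)"
    moreover define q where "q = R (of_real z) * (u z * cnj (u1 z))"
    moreover have "u1 z * cnj (u1 z) = of_real (X z)" by (simp add: X_def complex_norm_square del: of_real_power)
    ultimately have eq: "of_real (z * (1 - z)\<^sup>2) * v = - (P (of_real z) * of_real (X z) + q)" by (simp only:)
    have "z * (1 - z)\<^sup>2 * Re v = - (Re (P (of_real z)) * X z + Re q)"
      using arg_cong[OF eq, of Re] by (simp del: of_real_mult of_real_power of_real_diff)
    then have zX': "z * (1 - z)\<^sup>2 * X' z = - 2 * ((2 * real S + 1) * (1 - z)\<^sup>2 - 2 * z * (1 - z)) * X z - 2 * Re (R (of_real z) * (u z * cnj (u1 z)))"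
      unfolding X'_def reP[OF z'] v_def q_def by (simp add: algebra_simps)
    have "Re (R (of_real z) * (u z * cnj (u1 z))) \<le> norm (R (of_real z) * (u z * cnj (u1 z)))" by (rule complex_Re_le_cmod)
    also have "\<dots> = norm (R (of_real z)) * (norm (u z) * norm (u1 z))" by (simp add: norm_mult)
    also have "\<dots> \<le> rb * ((k * (1 - z)\<^sup>2 * norm (u1 z)) * norm (u1 z))"
      using R_le[OF z'] u_le[OF z] by (intro mult_mono mult_right_mono) (auto simp: rb_def)
    also have "\<dots> = rb * k * (1 - z)\<^sup>2 * X z" by (simp add: X_def power2_eq_square)
    finally have RR: "Re (R (of_real z) * (u z * cnj (u1 z))) \<le> rb * k * (1 - z)\<^sup>2 * X z" .
    define t where "t = 1 - z"
    have t: "t > 0" "z > 0" "z \<ge> 1/2" using z' z z1 by (auto simp: t_def)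
    have "z * t\<^sup>2 * X' z \<ge> - 2 * ((2 * real S + 1) * t\<^sup>2 - 2 * z * t) * X z - 2 * (rb * k * t\<^sup>2 * X z)"
      using zX' RR unfolding t_def by linarith
    then have "t * (z * t * X' z - 4 * z * X z) \<ge> t * (- 2 * (2 * real S + 1) * t * X z - 2 * rb * k * t * X z)"
      by (simp add: algebra_simps power2_eq_square)
    then have "z * t * X' z - 4 * z * X z \<ge> - 2 * (2 * real S + 1) * t * X z - 2 * rb * k * t * X z"
      using t by simp
    moreover have "(2 * (2 * real S + 1) + 2 * rb * k) * (t * X z) * 1 \<le> (2 * (2 * real S + 1) + 2 * rb * k) * (t * X z) * (2 * z)"
      using t k by (intro mult_left_mono mult_nonneg_nonneg add_nonneg_nonneg) (auto simp: X_def rb_def)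
    ultimately have "z * (t * X' z - 4 * X z) \<ge> z * (- K * (t * X z))"
      by (simp add: K_def algebra_simps)
    then have "t * X' z - 4 * X z \<ge> - K * (t * X z)" using t(2) by (rule mult_left_le_imp_le)
    then have "t ^ 3 * (t * X' z - 4 * X z) \<ge> t ^ 3 * (- K * (t * X z))" using t by (intro mult_left_mono) auto
    then show ?thesis unfolding Y_def t_def[symmetric] by (simp add: algebra_simps power3_eq_cube power4_eq_xxxx)
  qed
  have Y0: "Y z = 0" if z: "z \<in> {z1..<1}" for z
  proof -
    \<comment> \<open>exp (K z) Y z does not decrease, yet tends to 0 at z = 1 because u' is
      bounded; as Y is nonnegative, it vanishes.\<close>
    have mono: "exp (K * z) * Y z \<le> exp (K * y) * Y y" if y: "z \<le> y" "y < 1" for y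
    proof (rule DERIV_nonneg_imp_nondecreasing[OF y(1)])
      fix x assume x: "z \<le> x" "x \<le> y"
      then have x': "x \<in> {z1..<1}" "x \<in> {0<..<1}" using z y z1 by auto
      have "((\<lambda>x. exp (K * x) * Y x) has_real_derivative exp (K * x) * (K * Y x + ((1 - x) ^ 4 * X' x - 4 * (1 - x) ^ 3 * X x))) (at x)"
        by (rule derivative_eq_intros dY[OF x'(2)] refl)+ (simp add: algebra_simps)
      moreover have "exp (K * x) * (K * Y x + ((1 - x) ^ 4 * X' x - 4 * (1 - x) ^ 3 * X x)) \<ge> 0"
        using Y_ge[OF x'(1)] by simp
      ultimately show "\<exists>d. ((\<lambda>x. exp (K * x) * Y x) has_real_derivative d) (at x) \<and> 0 \<le> d" by blast
    qed
    have "exp (K * z) * Y z \<le> 0"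
    proof (rule tendsto_lowerbound[of _ _ "at_left 1"])
      have "((\<lambda>y::real. exp (K * y) * ((1 - y) ^ 4 * C\<^sup>2)) \<longlongrightarrow> exp (K * 1) * ((1 - 1) ^ 4 * C\<^sup>2)) (at_left 1)"
        by (intro tendsto_intros)
      then show "((\<lambda>y::real. exp (K * y) * ((1 - y) ^ 4 * C\<^sup>2)) \<longlongrightarrow> 0) (at_left 1)" by simp
      have "exp (K * z) * Y z \<le> exp (K * y) * ((1 - y) ^ 4 * C\<^sup>2)" if y: "z < y" "y < 1" for y
      proof (rule order_trans[OF mono])
        have "norm (u1 y) \<le> C" using uC(2)[of y] y z z1 by auto
        then show "exp (K * y) * Y y \<le> exp (K * y) * ((1 - y) ^ 4 * C\<^sup>2)"
          unfolding Y_def X_def using y by (intro mult_left_mono power_mono) auto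
      qed (use y in auto)
      then show "eventually (\<lambda>y. exp (K * z) * Y z \<le> exp (K * y) * ((1 - y) ^ 4 * C\<^sup>2)) (at_left 1)"
        using z by (auto simp: eventually_at_left_field intro!: exI[of _ z])
    qed auto
    then have "Y z \<le> 0" by (simp add: mult_le_0_iff)
    moreover have "Y z \<ge> 0" using z by (simp add: Y_def X_def)
    ultimately show ?thesis by simp
  qed
  have u0: "u z = 0" if "z \<in> {z1..<1}" for z
    using Y0[OF that] u_le[OF that] that by (simp add: Y_def X_def)
  have "pser a 0 = 0"
  proof (rule analytic_continuation[of "pser a" "ball 0 1" "of_real ` {z1..<1}" "of_real z1"])
    show "pser a holomorphic_on ball 0 1"
    proof (rule holomorphic_onI)
      fix z :: complex assume "z \<in> ball 0 1"
      then have "norm z < 1" by simp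
      then show "pser a field_differentiable at z within ball 0 1"
        using wd(1) field_differentiable_at_within field_differentiable_def by blast
    qed
    show "complex_of_real ` {z1..<1} \<subseteq> ball 0 1" using z1 by (auto simp: dist_norm)
    show "complex_of_real z1 islimpt complex_of_real ` {z1..<1}"
      unfolding islimpt_approachable
    proof (intro allI impI)
      fix e :: real assume e: "e > 0"
      define y where "y = min (z1 + e / 2) ((z1 + 1) / 2)"
      have "y \<in> {z1..<1}" "y \<noteq> z1" "dist (complex_of_real y) (of_real z1) < e"
        using e z1 by (auto simp: y_def dist_norm min_def simp flip: of_real_diff of_real_add)
      then show "\<exists>x'\<in>complex_of_real ` {z1..<1}. x' \<noteq> of_real z1 \<and> dist x' (of_real z1) < e" by auto
    qed
    show "pser a z = 0" if "z \<in> complex_of_real ` {z1..<1}" for z using that u0 by (auto simp: u_def)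
  qed (use z1 in \<open>auto simp: dist_norm\<close>)
  then show ?thesis by (simp add: pser_0)
qed

end

section \<open>Absence of modes for the confluent Heun equation\<close>

context heun_solution
begin

text \<open>Gronwall at a regular singular point: E = |W|^2 + |y W'|^2 satisfies y E' <= K E on (0,
  z], so E / y^K does not increase there, while zero Taylor coefficients make E of order y^(2 K + 2)
  at 0.\<close>

lemma flat_imp_zero:
  assumes c0: "\<And>n. c n = 0" and z: "z \<in> {0<..<1}"
  shows "W z = 0"
proof -
  define \<tau> where "\<tau> = 1 - z"
  have \<tau>: "\<tau> > 0" using z by (simp add: \<tau>_def)
  define p where "p = norm P0 + norm P1 + norm P2"
  define r where "r = norm R0 + norm R1"
  have P_le: "norm (P (of_real y)) \<le> p" and R_le: "norm (R (of_real y)) \<le> r" if "y \<in> {0<..<1}" for y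
  proof -
    have "norm (P1 * of_real y) \<le> norm P1" "norm (P2 * (of_real y)\<^sup>2) \<le> norm P2" "norm (R1 * of_real y) \<le> norm R1"
      using that by (simp_all add: norm_mult norm_power mult_left_le power_le_one)
    then show "norm (P (of_real y)) \<le> p" "norm (R (of_real y)) \<le> r"
      unfolding P_def R_def p_def r_def
      using norm_triangle_ineq[of "P0 + P1 * of_real y" "P2 * (of_real y)\<^sup>2"] norm_triangle_ineq[of P0 "P1 * of_real y"]
        norm_triangle_ineq[of R0 "R1 * of_real y"] by linarith+
  qed
  have p0: "p \<ge> 0" "r \<ge> 0" by (simp_all add: p_def r_def)
  \<comment> \<open>A bound for y E' / E: the derivative of W contributes 1, that of V = y W'
    contributes 2 (1 + p / \<tau>^2) and r / \<tau>^2. It is rounded up to a natural number so that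
    it also serves as a Taylor order.\<close>
  define K where "K = nat \<lceil>1 + 2 * (1 + p / \<tau>\<^sup>2) + r / \<tau>\<^sup>2\<rceil>"
  have K: "real K \<ge> 1 + 2 * (1 + p / \<tau>\<^sup>2) + r / \<tau>\<^sup>2" unfolding K_def by linarith
  define V where "V = (\<lambda>y. of_real y * W' y)"
  define V' where "V' = (\<lambda>y. of_real y * W'' y + W' y)"
  define E where "E = (\<lambda>y. (norm (W y))\<^sup>2 + (norm (V y))\<^sup>2)"
  define E' where "E' = (\<lambda>y. 2 * Re (W' y * cnj (W y)) + 2 * Re (V' y * cnj (V y)))"
  have dV: "(V has_vector_derivative V' y) (at y)" if "y \<in> {0<..<1}" for y
  proof -
    have "(of_real has_vector_derivative (1::complex)) (at y)" by (simp add: has_vector_derivative_complex_iff)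
    from has_vector_derivative_mult[OF this W_deriv(2)[OF that]] show ?thesis
      unfolding V_def V'_def by simp
  qed
  have dnorm: "((\<lambda>y. (norm (f y))\<^sup>2) has_real_derivative 2 * Re (f' * cnj (f y))) (at y)"
    if "(f has_vector_derivative f') (at y)" for f :: "real \<Rightarrow> complex" and f' y
  proof -
    have d: "((\<lambda>z. Re (f z)) has_real_derivative Re f') (at y)" "((\<lambda>z. Im (f z)) has_real_derivative Im f') (at y)"
      using that unfolding has_vector_derivative_complex_iff by (simp_all add: has_real_derivative_iff_has_vector_derivative)
    show ?thesis unfolding cmod_power2
      by (rule DERIV_cong[OF DERIV_add[OF DERIV_power[OF d(1)] DERIV_power[OF d(2)]]]) (simp add: algebra_simps)
  qed
  have dE: "(E has_real_derivative E' y) (at y)" if "y \<in> {0<..<1}" for y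
    unfolding E_def E'_def by (intro DERIV_add dnorm dV W_deriv that)
  have E'_le: "y * E' y \<le> real K * E y" if y: "y \<in> {0<..z}" for y
  proof -
    have y': "y \<in> {0<..<1}" using y z by auto
    have nW: "y * norm (W' y) = norm (V y)" using y by (simp add: V_def norm_mult)
    have 1: "y * (2 * Re (W' y * cnj (W y))) \<le> E y"
    proof -
      have "y * (2 * Re (W' y * cnj (W y))) \<le> y * (2 * (norm (W' y) * norm (W y)))"
        using y complex_Re_le_cmod[of "W' y * cnj (W y)"] by (intro mult_left_mono) (auto simp: norm_mult)
      also have "\<dots> = 2 * norm (V y) * norm (W y)" unfolding nW[symmetric] by simp
      also have "\<dots> \<le> E y" unfolding E_def using sum_squares_bound[of "norm (V y)" "norm (W y)"] by simp
      finally show ?thesis .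
    qed
    have t2: "\<tau>\<^sup>2 \<le> (1 - y)\<^sup>2" using y z by (intro power_mono) (auto simp: \<tau>_def)
    have ode': "of_real y * W'' y * of_real ((1 - y)\<^sup>2) = - (P (of_real y) * W' y + R (of_real y) * W y)"
      using ode[OF y'] unfolding op_def eq_neg_iff_add_eq_0 by (simp add: algebra_simps)
    have "norm (of_real y * W'' y) * \<tau>\<^sup>2 \<le> norm (of_real y * W'' y) * (1 - y)\<^sup>2" using t2 by (rule mult_left_mono) simp
    also have "\<dots> = norm (of_real y * W'' y * of_real ((1 - y)\<^sup>2))" by (simp add: norm_mult norm_power del: of_real_diff of_real_power)
    also have "\<dots> \<le> norm (P (of_real y) * W' y) + norm (R (of_real y) * W y)" unfolding ode' norm_minus_cancel by (rule norm_triangle_ineq)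
    also have "\<dots> \<le> p * norm (W' y) + r * norm (W y)"
      unfolding norm_mult using P_le[OF y'] R_le[OF y'] by (intro add_mono mult_right_mono) auto
    finally have "norm (of_real y * W'' y) \<le> (p * norm (W' y) + r * norm (W y)) / \<tau>\<^sup>2"
      using \<tau> by (simp add: pos_le_divide_eq)
    then have "norm (V' y) \<le> (p * norm (W' y) + r * norm (W y)) / \<tau>\<^sup>2 + norm (W' y)"
      unfolding V'_def using norm_triangle_ineq[of "of_real y * W'' y" "W' y"] by linarith
    then have "y * norm (V' y) \<le> y * ((p * norm (W' y) + r * norm (W y)) / \<tau>\<^sup>2 + norm (W' y))"
      using y by (intro mult_left_mono) auto
    also have "\<dots> = (p / \<tau>\<^sup>2 + 1) * norm (V y) + y * ((r / \<tau>\<^sup>2) * norm (W y))"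
      unfolding nW[symmetric] by (simp add: add_divide_distrib algebra_simps)
    also have "y * ((r / \<tau>\<^sup>2) * norm (W y)) \<le> 1 * ((r / \<tau>\<^sup>2) * norm (W y))"
      using y' p0 by (intro mult_right_mono) auto
    finally have yV': "y * norm (V' y) \<le> (p / \<tau>\<^sup>2 + 1) * norm (V y) + (r / \<tau>\<^sup>2) * norm (W y)" by simp
    have "y * (2 * Re (V' y * cnj (V y))) \<le> 2 * ((y * norm (V' y)) * norm (V y))"
      using y complex_Re_le_cmod[of "V' y * cnj (V y)"] mult_left_mono[of "Re (V' y * cnj (V y))" "norm (V' y) * norm (V y)" "2 * y"]
      by (auto simp: norm_mult mult_ac)
    also have "\<dots> \<le> 2 * (((p / \<tau>\<^sup>2 + 1) * norm (V y) + (r / \<tau>\<^sup>2) * norm (W y)) * norm (V y))"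
      using yV' by (intro mult_left_mono mult_right_mono) auto
    also have "\<dots> = 2 * (1 + p / \<tau>\<^sup>2) * (norm (V y))\<^sup>2 + (r / \<tau>\<^sup>2) * (2 * norm (W y) * norm (V y))"
      by (simp add: algebra_simps power2_eq_square)
    also have "\<dots> \<le> 2 * (1 + p / \<tau>\<^sup>2) * E y + (r / \<tau>\<^sup>2) * E y"
      unfolding E_def using p0 sum_squares_bound[of "norm (W y)" "norm (V y)"]
      by (intro add_mono mult_left_mono) auto
    finally have "y * E' y \<le> (1 + 2 * (1 + p / \<tau>\<^sup>2) + r / \<tau>\<^sup>2) * E y"
      unfolding E'_def using 1 by (simp add: algebra_simps)
    also have "\<dots> \<le> real K * E y" using K by (rule mult_right_mono) (simp add: E_def)
    finally show ?thesis .
  qed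
  have mono: "E z / z ^ K \<le> E y / y ^ K" if y: "0 < y" "y \<le> z" for y
  proof (rule DERIV_nonpos_imp_nonincreasing[OF y(2)])
    fix x assume x: "y \<le> x" "x \<le> z"
    then have x': "x \<in> {0<..<1}" "x \<in> {0<..z}" "x > 0" using y z by auto
    have "((\<lambda>x. E x / x ^ K) has_real_derivative (E' x * x ^ K - E x * (real K * x ^ (K - 1))) / (x ^ K * x ^ K)) (at x)"
      using DERIV_divide[OF dE[OF x'(1)] DERIV_pow[of K x]] x'(3) by simp
    moreover have "E' x * x ^ K - E x * (real K * x ^ (K - 1)) \<le> 0"
    proof -
      have "x * (E' x * x ^ K - E x * (real K * x ^ (K - 1))) = x ^ K * (x * E' x - real K * E x)"
        by (cases K) (simp_all add: algebra_simps)
      also have "\<dots> \<le> 0" using E'_le[OF x'(2)] x'(3) by (simp add: mult_nonneg_nonpos)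
      finally show ?thesis using x'(3) by (simp add: mult_le_0_iff)
    qed
    ultimately show "\<exists>d. ((\<lambda>x. E x / x ^ K) has_real_derivative d) (at x) \<and> d \<le> 0"
      using x'(3) by (intro exI conjI) (auto intro!: divide_nonpos_nonneg)
  qed
  define h where "h = g (K + 1)"
  define h1 where "h1 = (\<lambda>z. vector_derivative h (at z))"
  have sh: "symb (\<lambda>_. 1) {0<..<\<delta>} n h" for n unfolding h_def by (rule smooth_g)
  have sh1: "symb (\<lambda>_. 1) {0<..<\<delta>} n h1" for n using symb_SucD(3)[OF sh] by (simp add: h1_def)
  obtain B where B: "B > 0" "\<And>z. z \<in> {0<..<\<delta>} \<Longrightarrow> norm (h z) \<le> B" using symb_bound[OF sh[of 0]] by metis
  obtain B1 where B1: "B1 > 0" "\<And>z. z \<in> {0<..<\<delta>} \<Longrightarrow> norm (h1 z) \<le> B1" using symb_bound[OF sh1[of 0]] by metis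
  define C where "C = B\<^sup>2 + (B1 + real (K + 1) * B)\<^sup>2"
  have E_small: "E y \<le> y ^ (2 * (K + 1)) * C" if y: "y \<in> {0<..<\<delta>}" for y
  proof -
    have y1: "y \<in> {0<..<1}" using y \<delta> by auto
    have W_eq: "W x = of_real x ^ Suc K * h x" if "x \<in> {0<..<\<delta>}" for x
      using taylor[OF that, of "K + 1"] c0 by (simp add: h_def)
    have dpow: "((\<lambda>x. complex_of_real x ^ Suc K) has_vector_derivative of_nat (Suc K) * of_real y ^ K) (at y)"
      by (rule has_vector_derivative_real_field) (use DERIV_power[OF DERIV_ident, where n = "Suc K"] in simp)
    have dh: "(h has_vector_derivative h1 y) (at y)" unfolding h1_def by (rule symb_SucD(2)[OF sh y])
    have "(W has_vector_derivative of_real y ^ Suc K * h1 y + of_nat (Suc K) * of_real y ^ K * h y) (at y)"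
      by (subst vector_derivative_cong_open(1)[of "{0<..<\<delta>}" _ "\<lambda>x. of_real x ^ Suc K * h x"])
        (use W_eq y has_vector_derivative_mult[OF dpow dh] in auto)
    from vector_derivative_unique_at[OF W_deriv(1)[OF y1] this]
    have V_eq: "V y = of_real y ^ Suc K * (of_real y * h1 y + of_nat (Suc K) * h y)"
      unfolding V_def by (simp add: algebra_simps)
    have "norm (W y) = y ^ Suc K * norm (h y)" unfolding W_eq[OF y] using y by (simp add: norm_mult norm_power)
    also have "\<dots> \<le> y ^ Suc K * B" using y B by (intro mult_left_mono) auto
    finally have 1: "norm (W y) \<le> y ^ Suc K * B" .
    have "norm (of_real y * h1 y + of_nat (Suc K) * h y) \<le> norm (of_real y * h1 y) + norm (of_nat (Suc K) * h y)"
      by (rule norm_triangle_ineq)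
    also have "\<dots> \<le> 1 * B1 + real (Suc K) * B"
      unfolding norm_mult norm_of_nat using y y1 B(2)[OF y] B1(2)[OF y] by (intro add_mono mult_mono) auto
    finally have "norm (of_real y * h1 y + of_nat (Suc K) * h y) \<le> B1 + real (K + 1) * B" by simp
    then have 2: "norm (V y) \<le> y ^ Suc K * (B1 + real (K + 1) * B)"
      unfolding V_eq using y by (simp add: norm_mult norm_power mult_left_mono del: of_nat_Suc of_nat_add power_Suc)
    have "E y \<le> (y ^ Suc K * B)\<^sup>2 + (y ^ Suc K * (B1 + real (K + 1) * B))\<^sup>2"
      unfolding E_def using 1 2 by (intro add_mono power_mono) auto
    also have "\<dots> = y ^ (2 * (K + 1)) * C"
    proof -
      have "y ^ (2 * (K + 1)) = (y ^ Suc K)\<^sup>2" by (metis Suc_eq_plus1 mult.commute power_mult)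
      then show ?thesis unfolding C_def power_mult_distrib by (simp only: distrib_left)
    qed
    finally show ?thesis .
  qed
  have "E z / z ^ K \<le> 0"
  proof (rule tendsto_lowerbound[of _ _ "at_right 0"])
    have "((\<lambda>y::real. y ^ (K + 2) * C) \<longlongrightarrow> 0 ^ (K + 2) * C) (at_right 0)" by (intro tendsto_intros)
    then show "((\<lambda>y::real. y ^ (K + 2) * C) \<longlongrightarrow> 0) (at_right 0)" by simp
    have "E z / z ^ K \<le> y ^ (K + 2) * C" if y: "0 < y" "y < min \<delta> z" for y
    proof -
      have "E z / z ^ K \<le> E y / y ^ K" using y by (intro mono) auto
      also have "\<dots> \<le> (y ^ (2 * (K + 1)) * C) / y ^ K" using y E_small by (intro divide_right_mono) auto
      also have "\<dots> = y ^ (K + 2) * C"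
      proof -
        have "y ^ (2 * (K + 1)) = y ^ K * y ^ (K + 2)" by (simp flip: power_add add: mult_2)
        then show ?thesis using y by simp
      qed
      finally show ?thesis .
    qed
    then show "eventually (\<lambda>y. E z / z ^ K \<le> y ^ (K + 2) * C) (at_right 0)"
      using z \<delta> by (auto simp: eventually_at_right_field intro!: exI[of _ "min \<delta> z"])
  qed auto
  moreover have "z ^ K > 0" using z by simp
  ultimately have "E z \<le> 0" by (simp only: pos_divide_le_eq mult_zero_left)
  then have "(norm (W z))\<^sup>2 \<le> 0" unfolding E_def by (smt (verit) zero_le_power2)
  then show ?thesis by simp
qed

end

section \<open>Rescaling of rapidly decaying coefficients\<close>

lemma decay_gauge:
  fixes h c :: "nat \<Rightarrow> complex" and C :: nat
  assumes h: "\<And>n. n \<ge> 1 \<Longrightarrow> norm (h n) \<le> A * real n ^ C"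
    and c: "\<And>K. \<exists>B N. \<forall>n\<ge>N. norm (c n) \<le> B / real n ^ K"
  shows "\<exists>B N. \<forall>n\<ge>N. norm (h n * c (n + S)) \<le> B / real n ^ 3"
proof -
  obtain B N where B: "\<And>n. n \<ge> N \<Longrightarrow> norm (c n) \<le> B / real n ^ (C + 3)" using c[of "C + 3"] by blast
  have "norm (h n * c (n + S)) \<le> (\<bar>A\<bar> * \<bar>B\<bar>) / real n ^ 3" if n: "n \<ge> N + 1" for n
  proof -
    have "norm (c (n + S)) \<le> \<bar>B\<bar> / real (n + S) ^ (C + 3)"
      using n by (intro order_trans[OF B] divide_right_mono) auto
    also have "\<dots> \<le> \<bar>B\<bar> / real n ^ (C + 3)"
      using n by (intro divide_left_mono power_mono mult_pos_pos zero_less_power) auto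
    finally have 1: "norm (c (n + S)) \<le> \<bar>B\<bar> / real n ^ (C + 3)" .
    have "norm (h n) \<le> \<bar>A\<bar> * real n ^ C"
      using n by (intro order_trans[OF h] mult_right_mono) auto
    then have "norm (h n * c (n + S)) \<le> (\<bar>A\<bar> * real n ^ C) * (\<bar>B\<bar> / real n ^ (C + 3))"
      unfolding norm_mult using 1 by (intro mult_mono) auto
    also have "\<dots> = (\<bar>A\<bar> * \<bar>B\<bar>) / real n ^ 3" using n by (simp add: power_add)
    finally show ?thesis .
  qed
  then show ?thesis by blast
qed

text \<open>The chord of the convex function (1 + y)^2 / (1 - y) over [0, 1/2]; equality at y = 1/2
  gives the constant 7. The two factors 1 + y come from \<open>ga\<close>, the factor 1 - y from
  \<open>al\<close>.\<close>

lemma one_plus_over_one_minus_bound: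
  fixes y :: real
  assumes "0 \<le> y" "y \<le> 1 / 2"
  shows "(1 + y)\<^sup>2 \<le> (1 + 7 * y) * (1 - y)"
proof -
  have "(1 + 7 * y) * (1 - y) - (1 + y)\<^sup>2 = 4 * y * (1 - 2 * y)" by (simp add: algebra_simps power2_eq_square)
  also have "\<dots> \<ge> 0" using assms by simp
  finally show ?thesis by simp
qed

text \<open>
  In the Kerr case \<open>x = 2 \<xi>\<close> and \<open>T = 4 m \<sigma>\<close>, where \<open>\<plusminus> (i \<xi> + s / 2)\<close> are the exponents at the horizon.
  The products \<open>al n * ga (n + 1)\<close>, which together with \<open>be n\<close> determine the recurrence up to rescaling,
  are invariant under exchanging the factor \<open>n + 1 - s - i x\<close> of \<open>al n\<close> with the factor \<open>n + 1 - i T\<close>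
  of \<open>ga (n + 1)\<close>; the exchange produces the equation with a conserved flux.
\<close>

lemma heun_mode_zero:
  fixes s x T \<eta> \<nu> :: real
  assumes sol: "heun_weighted (1 - of_real s - \<i> * of_real x) (- 4 + 4 * \<i> * of_real \<eta>)
      (3 + of_real s - \<i> * of_real x - \<i> * of_real T) (of_real \<nu> + 2 * \<i> * of_real \<eta>)
      ((1 + of_real s - \<i> * of_real x) * (1 - \<i> * of_real T)) W c g M \<delta> G \<kappa> Q L"
    and sign: "T * (2 * \<eta> - x - T / 2) > 0"
    and z: "z \<in> {0<..<1}"
  shows "W z = 0"
proof -
  define P0 where "P0 = 1 - of_real s - \<i> * complex_of_real x"
  define P1 where "P1 = - 4 + 4 * \<i> * complex_of_real \<eta>"
  define P2 where "P2 = 3 + of_real s - \<i> * complex_of_real x - \<i> * of_real T"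
  define R0 where "R0 = of_real \<nu> + 2 * \<i> * complex_of_real \<eta>"
  define R1 where "R1 = (1 + of_real s - \<i> * of_real x) * (1 - \<i> * complex_of_real T)"
  interpret O: heun_weighted P0 P1 P2 R0 R1 W c g M \<delta> G \<kappa> Q L
    using sol unfolding P0_def P1_def P2_def R0_def R1_def .
  have al: "O.al n = of_nat (Suc n) * (of_nat (Suc n) - of_real s - \<i> * of_real x)" for n
    unfolding O.al_def unfolding P0_def by (simp add: algebra_simps)
  have ga: "O.ga n = (of_nat n + of_real s - \<i> * of_real x) * (of_nat n - \<i> * of_real T)" for n
    unfolding O.ga_def unfolding P2_def R1_def by (simp add: algebra_simps)
  have al_S: "O.al n = 0 \<Longrightarrow> s = real (Suc n) \<and> x = 0" for n
    unfolding al by (auto simp: complex_eq_iff)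
  define A where "A = \<bar>s\<bar> + \<bar>x\<bar> + \<bar>T\<bar>"
  \<comment> \<open>From here on N = n + 1 is at least 2 A, so that y = A / N stays in [0, 1/2], and
    neither \<open>al\<close> nor \<open>ga\<close> vanishes.\<close>
  define n1 where "n1 = nat \<lceil>2 * A\<rceil> + 1"
  have n1: "real n \<ge> 2 * A" "n \<ge> 1" if "n \<ge> n1" for n
    using that unfolding n1_def by linarith+
  have A0: "A \<ge> 0" "\<bar>s\<bar> \<le> A" "\<bar>x\<bar> \<le> A" "\<bar>T\<bar> \<le> A" by (simp_all add: A_def)
  have al_nz: "O.al n \<noteq> 0" if "n \<ge> n1" for n
    using al_S[of n] n1[OF that] A0 by auto
  have ga_nz: "O.ga n \<noteq> 0" if "n \<ge> n1" for n
  proof -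
    have "real n + s \<noteq> 0" "real n \<noteq> 0" using n1[OF that] A0 by auto
    then have "of_nat n + of_real s - \<i> * complex_of_real x \<noteq> 0" "of_nat n - \<i> * complex_of_real T \<noteq> 0"
      by (simp_all add: complex_eq_iff)
    then show ?thesis unfolding ga by simp
  qed
  define C where "C = nat \<lceil>7 * A\<rceil>"
  have C: "real C \<ge> 7 * A" unfolding C_def by linarith
  have ratio: "norm (O.ga (Suc n) / O.al n) \<le> 1 + real C / real n" if n: "n \<ge> n1" for n
  proof -
    define N where "N = real (Suc n)"
    have N: "N > 0" "N \<ge> 2 * A" "N \<ge> real n" "real n > 0" using n1[OF n] by (simp_all add: N_def)
    define y where "y = A / N"
    have y: "0 \<le> y" "y \<le> 1 / 2" using A0 N by (simp_all add: y_def field_simps)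
    have Ny: "N * (1 + y) = N + A" "N * (1 - y) = N - A" using N by (simp_all add: y_def field_simps)
    have "norm (of_real N + (of_real s - \<i> * of_real x)) \<le> N + (\<bar>s\<bar> + \<bar>x\<bar>)"
      using norm_triangle_ineq[of "of_real N" "of_real s - \<i> * of_real x"] norm_triangle_ineq4[of "of_real s :: complex" "\<i> * of_real x"] N
      by (simp add: norm_mult)
    then have 1: "norm (of_nat (Suc n) + of_real s - \<i> * of_real x) \<le> N * (1 + y)"
      unfolding Ny by (simp add: N_def A_def algebra_simps)
    have "norm (of_real N - \<i> * of_real T) \<le> N + \<bar>T\<bar>"
      using norm_triangle_ineq4[of "of_real N" "\<i> * of_real T"] N by (simp add: norm_mult)
    then have 2: "norm (of_nat (Suc n) - \<i> * of_real T) \<le> N * (1 + y)"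
      unfolding Ny using A0 by (simp add: N_def algebra_simps)
    have "N - \<bar>s\<bar> \<le> norm (of_nat (Suc n) - of_real s - \<i> * of_real x)"
      using complex_Re_le_cmod[of "of_nat (Suc n) - of_real s - \<i> * of_real x"] by (simp add: N_def)
    then have 3: "N * (1 - y) \<le> norm (of_nat (Suc n) - of_real s - \<i> * of_real x)"
      unfolding Ny using A0 by linarith
    have "norm (O.ga (Suc n)) \<le> (N * (1 + y)) * (N * (1 + y))"
      unfolding ga norm_mult using 1 2 y N by (intro mult_mono) auto
    also have "\<dots> = N\<^sup>2 * (1 + y)\<^sup>2" by (simp add: power2_eq_square)
    also have "\<dots> \<le> N\<^sup>2 * ((1 + 7 * y) * (1 - y))"
      using one_plus_over_one_minus_bound[OF y] by (intro mult_left_mono) auto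
    also have "\<dots> = (1 + 7 * y) * (N * (N * (1 - y)))" by (simp add: power2_eq_square)
    also have "\<dots> \<le> (1 + 7 * y) * norm (O.al n)"
      unfolding al norm_mult norm_of_nat N_def[symmetric] using 3 y N by (intro mult_left_mono) auto
    finally have "norm (O.ga (Suc n) / O.al n) \<le> 1 + 7 * y"
      using al_nz[OF n] by (simp add: norm_divide pos_divide_le_eq)
    also have "7 * y \<le> real C / real n"
      unfolding y_def using C N A0 by (simp add: frac_le)
    finally show ?thesis by simp
  qed
  show ?thesis
  proof (rule ccontr)
    assume "W z \<noteq> 0"
    then have "\<exists>z\<in>{0<..<1}. W z \<noteq> 0" using z by blast
    from O.coeff_decay[OF this al_nz ga_nz ratio]
    have decay: "\<exists>B N. \<forall>n\<ge>N. norm (c n) \<le> B / real n ^ K" for K .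
    have not_flat: "\<not> (\<forall>n. c n = 0)" using O.flat_imp_zero[OF _ z] \<open>W z \<noteq> 0\<close> by blast
    have crec: "O.al n * c (Suc n) + O.be n * c n + O.ga n * (case n of 0 \<Rightarrow> 0 | Suc m \<Rightarrow> c m) = 0" for n
      using O.rec_zero[of n] unfolding O.rec_def .
    have c0: "c 0 = 0"
    proof -
      \<comment> \<open>The parameters after the exchange of factors. \<open>P1\<close> and
        \<open>R0\<close> are kept, because \<open>be\<close> depends on them alone.\<close>
      define Q0 Q2 S1 where "Q0 = 1 - \<i> * complex_of_real T" and "Q2 = 3 - 2 * \<i> * complex_of_real x"
        and "S1 = (1 - \<i> * of_real x)\<^sup>2 - (complex_of_real s)\<^sup>2"
      \<comment> \<open>Quotient of the two exchanged factors. The denominator has real part n + 1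
        and never vanishes; the numerator vanishes exactly where \<open>al\<close> does.\<close>
      define \<rho> where "\<rho> = (\<lambda>n. (of_nat (Suc n) - of_real s - \<i> * of_real x) / (of_nat (Suc n) - \<i> * complex_of_real T))"
      define h where "h = rec_nat (1::complex) (\<lambda>n y. \<rho> n * y)"
      have h0: "h 0 = 1" and hS: "h (Suc n) = \<rho> n * h n" for n by (simp_all add: h_def)
      have nzT: "of_nat (Suc n) - \<i> * complex_of_real T \<noteq> 0" for n by (simp add: complex_eq_iff)
      have hS': "h (Suc n) * (of_nat (Suc n) - \<i> * of_real T) = h n * (of_nat (Suc n) - of_real s - \<i> * of_real x)" for n
        using nzT[of n] unfolding hS \<rho>_def by simp
      have hb: "norm (h n) \<le> norm (h 1) * real n ^ C" if "n \<ge> 1" for n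
      proof (rule ratio_growth[of 1 h \<rho> C n])
        fix n :: nat assume n: "n \<ge> 1"
        have "norm (of_nat (Suc n) - of_real s - \<i> * complex_of_real x) \<le> real (Suc n) + (\<bar>s\<bar> + \<bar>x\<bar>)"
          using norm_triangle_ineq4[of "of_nat (Suc n) - of_real s" "\<i> * complex_of_real x"]
            norm_triangle_ineq4[of "of_nat (Suc n)" "complex_of_real s"] by (simp add: norm_mult del: of_nat_Suc)
        also have "\<dots> \<le> real (Suc n) + A" by (simp add: A_def)
        also have "\<dots> \<le> (1 + real C / real n) * real (Suc n)"
        proof -
          have "A \<le> real C" using C A0 by linarith
          also have "\<dots> \<le> real C / real n * real (Suc n)" using n by (simp add: field_simps)
          finally show ?thesis by (simp add: algebra_simps)
        qed
        also have "\<dots> \<le> (1 + real C / real n) * norm (of_nat (Suc n) - \<i> * complex_of_real T)"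
          using complex_Re_le_cmod[of "of_nat (Suc n) - \<i> * complex_of_real T"] by (intro mult_left_mono) auto
        finally show "norm (\<rho> n) \<le> 1 + real C / real n"
          unfolding \<rho>_def using nzT[of n] by (simp add: norm_divide pos_divide_le_eq)
      qed (use hS that in auto)
      define a where "a = (\<lambda>n. h n * c n)"
      have arec: "confluent_heun.rec Q0 P1 Q2 R0 S1 a n = 0" for n
      proof -
        have alh: "confluent_heun.al Q0 n = of_nat (Suc n) * (of_nat (Suc n) - \<i> * of_real T)"
          unfolding confluent_heun.al_def Q0_def by (simp add: algebra_simps)
        have gah: "confluent_heun.ga Q2 S1 n = (of_nat n - of_real s - \<i> * of_real x) * (of_nat n + of_real s - \<i> * of_real x)"
          unfolding confluent_heun.ga_def Q2_def S1_def by (simp add: algebra_simps power2_eq_square)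
        have 1: "confluent_heun.al Q0 n * a (Suc n) = h n * (O.al n * c (Suc n))"
          unfolding alh a_def al using hS'[of n] by (simp add: mult_ac)
        have 2: "confluent_heun.ga Q2 S1 n * (case n of 0 \<Rightarrow> 0 | Suc m \<Rightarrow> a m) =
            h n * (O.ga n * (case n of 0 \<Rightarrow> 0 | Suc m \<Rightarrow> c m))"
        proof (cases n)
          case (Suc k)
          have "confluent_heun.ga Q2 S1 n * a k =
             (of_nat n + of_real s - \<i> * of_real x) * c k * (h k * (of_nat (Suc k) - of_real s - \<i> * of_real x))"
            unfolding gah a_def unfolding Suc by (simp only: mult_ac)
          also have "\<dots> = h n * (O.ga n * c k)"
            unfolding hS'[of k, symmetric] ga Suc by (simp only: mult_ac)
          finally show ?thesis using Suc by simp
        qed simp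
        have "confluent_heun.rec Q0 P1 Q2 R0 S1 a n =
          h n * (O.al n * c (Suc n) + O.be n * c n + O.ga n * (case n of 0 \<Rightarrow> 0 | Suc m \<Rightarrow> c m))"
          unfolding confluent_heun.rec_def 1 2 by (simp add: a_def algebra_simps)
        then show ?thesis unfolding crec by simp
      qed
      obtain B N where BN: "\<And>n. n \<ge> N \<Longrightarrow> norm (a n) \<le> B / real n ^ 3"
        using decay_gauge[of h "norm (h 1)" C c 0] hb decay unfolding a_def by auto
      have "a 0 = 0"
      proof (rule confluent_heun.flux_vanish_regular[OF arec BN])
        \<comment> \<open>The boundary values are -T / 2 at z = 0 and 2 \<eta> - x - T / 2 at z = 1;
          \<open>sign\<close> makes them opposite.\<close>
        let ?M = "\<lambda>z. - T / 2 + 2 * \<eta> * z - x * z\<^sup>2"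
        show "(?M has_real_derivative 2 * \<eta> - 2 * x * z) (at z)" for z
          by (auto intro!: derivative_eq_intros)
        show "Re (confluent_heun.P Q0 P1 Q2 (of_real z)) = (1 - z)\<^sup>2 - 2 * z * (1 - z)" for z
          unfolding confluent_heun.P_def Q0_def P1_def Q2_def by (simp add: algebra_simps power2_eq_square)
        show "Im (confluent_heun.P Q0 P1 Q2 (of_real z)) = 2 * ?M z" for z
          unfolding confluent_heun.P_def Q0_def P1_def Q2_def by (simp add: algebra_simps power2_eq_square)
        show "Im (confluent_heun.R R0 S1 (of_real z)) = 2 * \<eta> - 2 * x * z" for z
          unfolding confluent_heun.R_def R0_def S1_def by (simp add: algebra_simps power2_eq_square)
        show "?M 0 * ?M 1 < 0" using sign by (simp add: algebra_simps)
      qed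
      then show ?thesis by (simp add: a_def h0)
    qed
    \<comment> \<open>Forward recursion from c 0 = 0 works until \<open>al\<close> has a zero. A
      nonzero solution therefore forces the exceptional case.\<close>
    have zero_upto: "c k = 0" if "\<And>j. j < n \<Longrightarrow> O.al j \<noteq> 0" "k \<le> n" for k n
      using that(2)
    proof (induction k rule: less_induct)
      case (less k)
      show ?case
      proof (cases k)
        case (Suc j)
        have "O.al j * c (Suc j) = 0"
          using crec[of j] less Suc by (cases j) auto
        then show ?thesis using that(1)[of j] less Suc by auto
      qed (use c0 in simp)
    qed
    have "\<exists>n. O.al n = 0" using zero_upto not_flat by (metis le_refl)
    then obtain n where n: "O.al n = 0" by blast
    define S where "S = Suc n"
    have s: "s = real S" and x0: "x = 0" using al_S[OF n] by (simp_all add: S_def)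
    have al': "O.al k \<noteq> 0" if "k \<noteq> n" for k using al_S[of k] s that by (auto simp: S_def)
    have c_lt: "c k = 0" if "k < S" for k
      using zero_upto[of n k] al' that by (simp add: S_def)
    \<comment> \<open>Shifting the index by S removes a factor z^S. Then the factor k + 1 + S of the
      shifted \<open>al k\<close> is exchanged with the factor k + 1 + 2 S of the shifted
      \<open>ga (k + 1)\<close>. The new equation has exponents 0 and -2 S at z = 0, and a
      first-order coefficient of the form demanded by \<open>flux_const\<close>.\<close>
    define Q0 Q1 Q2 S0 S1 where "Q0 = 1 + 2 * complex_of_nat S" and "Q1 = - 4 * of_nat S - 4 + 4 * \<i> * complex_of_real \<eta>"
      and "Q2 = 3 + 2 * of_nat S - \<i> * complex_of_real T"
      and "S0 = - 2 * of_nat S * (of_nat S - 1) + P1 * of_nat S + R0"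
      and "S1 = (of_nat S + 1) * (of_nat S + 1 - \<i> * complex_of_real T)"
    define \<rho> where "\<rho> = (\<lambda>k. of_nat (Suc k + S) / of_nat (Suc k + 2 * S) :: complex)"
    define h where "h = rec_nat (1::complex) (\<lambda>k y. \<rho> k * y)"
    have h0: "h 0 = 1" and hS: "h (Suc k) = \<rho> k * h k" for k by (simp_all add: h_def)
    have hS': "h (Suc k) * of_nat (Suc k + 2 * S) = h k * of_nat (Suc k + S)" for k
      unfolding hS \<rho>_def by (simp del: of_nat_Suc of_nat_add add_Suc)
    have hb: "norm (h k) \<le> norm (h 1) * real k ^ 0" if "k \<ge> 1" for k
    proof (rule ratio_growth[of 1 h \<rho> 0 k])
      show "norm (\<rho> k) \<le> 1 + real 0 / real k" for k
        unfolding \<rho>_def norm_divide norm_of_nat by (simp add: field_simps)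
    qed (use hS that in auto)
    define a where "a = (\<lambda>k. h k * c (k + S))"
    have arec: "confluent_heun.rec Q0 Q1 Q2 S0 S1 a k = 0" for k
    proof -
      have alh: "confluent_heun.al Q0 k = of_nat (Suc k) * of_nat (Suc k + 2 * S)"
        unfolding confluent_heun.al_def Q0_def by (simp add: algebra_simps)
      have alo: "O.al (k + S) = of_nat (Suc k + S) * of_nat (Suc k)"
        unfolding al s x0 by (simp add: algebra_simps)
      have gah: "confluent_heun.ga Q2 S1 k = of_nat (k + S) * (of_nat (k + S) - \<i> * of_real T)"
        unfolding confluent_heun.ga_def Q2_def S1_def by (simp add: algebra_simps power2_eq_square)
      have gao: "O.ga (k + S) = of_nat (k + 2 * S) * (of_nat (k + S) - \<i> * of_real T)"
        unfolding ga s x0 by (simp add: algebra_simps)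
      have beh: "confluent_heun.be Q1 S0 k = O.be (k + S)"
        unfolding confluent_heun.be_def Q1_def S0_def P1_def by (simp add: algebra_simps)
      have 1: "confluent_heun.al Q0 k * a (Suc k) = h k * (O.al (k + S) * c (Suc (k + S)))"
      proof -
        have "confluent_heun.al Q0 k * a (Suc k) = of_nat (Suc k) * c (Suc (k + S)) * (h (Suc k) * of_nat (Suc k + 2 * S))"
          unfolding alh a_def by (simp only: mult_ac add_Suc)
        then show ?thesis unfolding hS' alo by (simp only: mult_ac)
      qed
      have 2: "confluent_heun.ga Q2 S1 k * (case k of 0 \<Rightarrow> 0 | Suc m \<Rightarrow> a m) =
          h k * (O.ga (k + S) * (case k + S of 0 \<Rightarrow> 0 | Suc m \<Rightarrow> c m))"
      proof (cases k)
        case 0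
        \<comment> \<open>For k = 0 the neighbour below is c (S - 1), which is zero.\<close>
        then show ?thesis using c_lt[of n] by (simp add: S_def)
      next
        case (Suc j)
        have "confluent_heun.ga Q2 S1 k * a j = (of_nat (k + S) - \<i> * of_real T) * c (j + S) * (h j * of_nat (Suc j + S))"
          unfolding gah a_def unfolding Suc by (simp only: mult_ac)
        also have "\<dots> = h k * (O.ga (k + S) * c (j + S))"
          unfolding hS'[symmetric] gao unfolding Suc by (simp only: mult_ac)
        finally show ?thesis using Suc by simp
      qed
      have "confluent_heun.rec Q0 Q1 Q2 S0 S1 a k =
        h k * (O.al (k + S) * c (Suc (k + S)) + O.be (k + S) * c (k + S) + O.ga (k + S) * (case k + S of 0 \<Rightarrow> 0 | Suc m \<Rightarrow> c m))"
        unfolding confluent_heun.rec_def 1 2 beh by (simp add: a_def algebra_simps)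
      then show ?thesis unfolding crec by simp
    qed
    obtain B N where BN: "\<And>n. n \<ge> N \<Longrightarrow> norm (a n) \<le> B / real n ^ 3"
      using decay_gauge[of h "norm (h 1)" 0 c S] hb decay unfolding a_def by auto
    have "a 0 = 0"
    proof (rule confluent_heun.flux_vanish_irregular[OF arec BN])
      let ?M = "\<lambda>z. 2 * \<eta> * z - T / 2 * z\<^sup>2"
      show "S \<ge> 1" by (simp add: S_def)
      show "(?M has_real_derivative 2 * \<eta> - T * z) (at z)" for z
        by (auto intro!: derivative_eq_intros)
      show "Re (confluent_heun.P Q0 Q1 Q2 (of_real z)) = (2 * real S + 1) * (1 - z)\<^sup>2 - 2 * z * (1 - z)" for z
        unfolding confluent_heun.P_def Q0_def Q1_def Q2_def by (simp add: algebra_simps power2_eq_square)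
      show "Im (confluent_heun.P Q0 Q1 Q2 (of_real z)) = 2 * ?M z" for z
        unfolding confluent_heun.P_def Q0_def Q1_def Q2_def by (simp add: algebra_simps power2_eq_square)
      show "z * Im (confluent_heun.R S0 S1 (of_real z)) = 2 * real S * ?M z + z * (2 * \<eta> - T * z)" for z
        unfolding confluent_heun.R_def S0_def S1_def R0_def P1_def by (simp add: algebra_simps power2_eq_square)
      show "?M 1 \<noteq> 0" using sign x0 by auto
    qed
    then have cS: "c S = 0" by (simp add: a_def h0)
    \<comment> \<open>The only zero of \<open>al\<close> is at n = S - 1, so forward recursion works
      again beyond index S.\<close>
    have "c k = 0" for k
    proof (induction k rule: less_induct)
      case (less k)
      show ?case
      proof (cases "k \<le> S")
        case True
        then show ?thesis using c_lt[of k] cS by (cases "k = S") auto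
      next
        case False
        then obtain j where j: "k = Suc j" "j \<noteq> n" by (cases k) (auto simp: S_def)
        have "O.al j * c (Suc j) = 0"
          using crec[of j] less j by (cases j) auto
        then show ?thesis using al'[OF j(2)] j by simp
      qed
    qed
    then show False using not_flat by blast
  qed
qed

section \<open>Reduction of the radial equation\<close>

lemma smooth_onE:
  assumes "smooth_on S f"
  obtains D where "\<And>x. x \<in> S \<Longrightarrow> D 0 x = f x"
    "\<And>n x. x \<in> S \<Longrightarrow> (D n has_vector_derivative D (Suc n) x) (at x within S)"
proof -
  from assms obtain D where *: "(\<forall>x\<in>S. D 0 x = f x) \<and> (\<forall>n. \<forall>x\<in>S. (D n has_vector_derivative D (Suc n) x) (at x within S))"
    unfolding smooth_on_def by (elim exE)
  show ?thesis
  proof (rule that[of D])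
    show "D 0 x = f x" if "x \<in> S" for x by (rule bspec[OF conjunct1[OF *] that])
    show "(D n has_vector_derivative D (Suc n) x) (at x within S)" if "x \<in> S" for n x
      by (rule bspec[OF spec[OF conjunct2[OF *]] that])
  qed
qed
text \<open>\<open>K\<close> may contain an endpoint of \<open>T\<close> at which derivatives are
  one-sided; continuity on the compact set \<open>K\<close> gives the bounds.\<close>

lemma smooth_on_symb:
  assumes f: "smooth_on S f" and T: "open T" "T \<subseteq> K" "compact K" "K \<subseteq> S"
  shows "symb (\<lambda>_. 1) T n f"
proof (rule smooth_onE[OF f])
  fix D
  assume D0: "\<And>x. x \<in> S \<Longrightarrow> D 0 x = f x"
    and D: "\<And>n x. x \<in> S \<Longrightarrow> (D n has_vector_derivative D (Suc n) x) (at x within S)"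
  have bdd: "bounded (D k ` T)" for k
  proof -
    have "continuous_on S (D k)"
      unfolding continuous_on_eq_continuous_within by (rule ballI, rule has_vector_derivative_continuous, rule D)
    then have "compact (D k ` K)" using T(4) by (intro compact_continuous_image[OF _ T(3)]) (rule continuous_on_subset)
    then show ?thesis by (rule bounded_subset[OF compact_imp_bounded image_mono[OF T(2)]])
  qed
  have "symb (\<lambda>_. 1) T n (D k)" for k
  proof (induction n arbitrary: k)
    case (Suc n)
    show ?case
    proof (rule symb_SucI[OF T(1) bdd])
      fix x assume x: "x \<in> T"
      have "x \<in> S" "T \<subseteq> S" using x T by auto
      then have "(D k has_vector_derivative D (Suc k) x) (at x within T)"
        using D has_vector_derivative_within_subset by blast
      then show "(D k has_vector_derivative D (Suc k) x) (at x)"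
        using at_within_open[OF x T(1)] by simp
    qed (use Suc in simp)
  qed (use bdd in simp)
  from this[of 0] show "symb (\<lambda>_. 1) T n f"
    by (rule symb_cong[OF T(1), THEN iffD1, rotated]) (use D0 T in blast)
qed

lemma symb_of_r_deriv:
  assumes "\<And>j. bounded ((r_deriv ^^ j) f ` S)" "\<And>j r. r \<in> S \<Longrightarrow> (r_deriv ^^ j) f differentiable (at r)"
  shows "symb (\<lambda>r. r) S n f"
  using assms
proof (induction n arbitrary: f)
  case 0
  then show ?case using 0(1)[of 0] by simp
next
  case (Suc n)
  have "symb (\<lambda>r. r) S n (r_deriv f)"
  proof (rule Suc.IH)
    show "bounded ((r_deriv ^^ j) (r_deriv f) ` S)" for j
      using Suc.prems(1)[of "Suc j"] by (simp add: funpow_swap1)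
    show "(r_deriv ^^ j) (r_deriv f) differentiable (at r)" if "r \<in> S" for j r
      using Suc.prems(2)[OF that, of "Suc j"] by (simp add: funpow_swap1)
  qed
  moreover have "r_deriv f = (\<lambda>r. of_real r * vector_derivative f (at r))" by (simp add: r_deriv_def fun_eq_iff)
  moreover have "bounded (f ` S)" "\<forall>r\<in>S. f differentiable (at r)"
    using Suc.prems(1)[of 0] Suc.prems(2)[of _ 0] by simp_all
  ultimately show ?case by simp
qed

lemma symb_r_deriv_differentiable:
  assumes "\<And>n. symb (\<lambda>r. r) S n f" "r \<in> S"
  shows "(r_deriv ^^ j) f differentiable (at r)"
proof -
  have "\<forall>n. symb (\<lambda>r. r) S n ((r_deriv ^^ j) f)"
  proof (induction j)
    case (Suc j)
    have eq: "r_deriv ((r_deriv ^^ j) f) = (\<lambda>r. of_real r * vector_derivative ((r_deriv ^^ j) f) (at r))"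
      by (simp add: r_deriv_def fun_eq_iff)
    show ?case
    proof
      fix n
      have "symb (\<lambda>r. r) S (Suc n) ((r_deriv ^^ j) f)" using Suc by blast
      from symb_SucD(3)[OF this] show "symb (\<lambda>r. r) S n ((r_deriv ^^ Suc j) f)" by (simp add: eq)
    qed
  qed (use assms in simp)
  then have "symb (\<lambda>r. r) S (Suc 0) ((r_deriv ^^ j) f)" by blast
  then show ?thesis using assms(2) by simp
qed

lemma symb_inverse_id:
  assumes "r0 > 0"
  shows "symb (\<lambda>r. r) {r0<..} n (\<lambda>r. inverse (of_real r))"
proof (induction n)
  have b: "bounded ((\<lambda>r. inverse (complex_of_real r)) ` {r0<..})"
    using assms by (intro boundedI[of _ "inverse r0"]) (auto simp: norm_inverse intro!: le_imp_inverse_le)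
  case 0
  show ?case using b by simp
  case (Suc n)
  show ?case
  proof (rule symb_SucI[OF _ b])
    show "((\<lambda>r. inverse (complex_of_real r)) has_vector_derivative - (inverse (of_real r) ^ 2)) (at r)" if "r \<in> {r0<..}" for r
      using that assms by (intro has_vector_derivative_real_field) (auto intro!: derivative_eq_intros simp: numeral_2_eq_2)
    show "symb (\<lambda>r. r) {r0<..} n (\<lambda>r. of_real r * - (inverse (complex_of_real r))\<^sup>2)"
      by (rule symb_uminus[OF _ Suc, THEN symb_cong[THEN iffD1, rotated 2]]) (use assms in \<open>auto simp: power2_eq_square\<close>)
  qed auto
qed

section \<open>Complex powers of z and 1 - z\<close>

lemma exp_ln_deriv:
  fixes a b :: complex
  assumes "z \<in> {0<..<1}"
  shows "((\<lambda>z. a * of_real (ln z) + b * of_real (ln (1 - z))) has_vector_derivative a / of_real z - b / of_real (1 - z)) (at z)"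
proof -
  have "((\<lambda>z. ln z) has_real_derivative 1 / z) (at z)" "((\<lambda>z. ln (1 - z)) has_real_derivative - 1 / (1 - z)) (at z)"
    using assms by (auto intro!: derivative_eq_intros simp: divide_inverse)
  then have "((\<lambda>z. complex_of_real (ln z)) has_vector_derivative of_real (1 / z)) (at z)"
    "((\<lambda>z. complex_of_real (ln (1 - z))) has_vector_derivative of_real (- 1 / (1 - z))) (at z)"
    by (simp_all add: has_vector_derivative_complex_iff has_real_derivative_iff_has_vector_derivative)
  from has_vector_derivative_add[OF has_vector_derivative_mult_right[OF this(1), of a] has_vector_derivative_mult_right[OF this(2), of b]]
  show ?thesis by (simp add: divide_inverse)
qed

lemma has_vector_derivative_exp:
  "(h has_vector_derivative h') (at x) \<Longrightarrow> ((\<lambda>x. exp (h x :: complex)) has_vector_derivative exp (h x) * h') (at x)"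
  using field_vector_diff_chain_at[OF _ DERIV_exp, of h h' x] by (simp add: o_def mult.commute)

text \<open>These are the powers z^a (1 - z)^b, which the field z (1 - z) d/dz merely multiplies by
  a (1 - z) - b z.\<close>

lemma bsym_exp_ln:
  assumes "Re a \<ge> 0" "Re b \<ge> 0"
  shows "bsym (\<lambda>z. exp (a * of_real (ln z) + b * of_real (ln (1 - z))))" (is "bsym ?f")
  unfolding bsym_def
proof
  have bd: "bounded (?f ` {0<..<1})"
  proof (rule boundedI)
    fix y assume "y \<in> ?f ` {0<..<1}"
    then obtain z where z: "z \<in> {0<..<1}" "y = ?f z" by blast
    have "Re a * ln z \<le> 0" "Re b * ln (1 - z) \<le> 0" using z assms by (auto intro!: mult_nonneg_nonpos)
    then show "norm y \<le> 1" using z by simp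
  qed
  fix n show "symb (\<lambda>z. z * (1 - z)) {0<..<1} n ?f"
  proof (induction n)
    case (Suc n)
    show ?case
    proof (rule symb_SucI[OF _ bd])
      fix z :: real assume z: "z \<in> {0<..<1}"
      show "(?f has_vector_derivative ?f z * (a / of_real z - b / of_real (1 - z))) (at z)"
        by (rule has_vector_derivative_exp[OF exp_ln_deriv[OF z]])
    next
      have "symb (\<lambda>z. z * (1 - z)) {0<..<1} n (\<lambda>z. ?f z * (a * of_real (1 - z) + (- b) * of_real z))"
        by (intro symb_mult Suc bsymD bsym_add bsym_mult bsym_const bsym_z bsym_z') auto
      then show "symb (\<lambda>z. z * (1 - z)) {0<..<1} n (\<lambda>z. of_real (z * (1 - z)) * (?f z * (a / of_real z - b / of_real (1 - z))))"
        by (rule symb_cong[THEN iffD1, rotated 2]) (auto simp: field_simps)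
    qed auto
  qed (use bd in simp)
qed

text \<open>The two squares combine into a difference divisible by z t, which removes the pole at z
  = 0 and leaves at most a simple pole at t = 0. Its residue vanishes because p + kp + km = 1 + 2 s,
  and a polynomial of degree one in z remains.\<close>

lemma potential_identity:
  fixes z t sg d m s x \<xi> rm rp ak \<Lambda> \<nu> \<eta> :: complex
  assumes t: "t = 1 - z" "t \<noteq> 0" "z \<noteq> 0"
    and x: "\<xi> = x / 2" and rp: "rp = rm + d" "2 * m = rm + rp" and \<eta>: "\<eta> = sg * rp + \<xi>"
    and \<nu>: "\<nu> = 8 * sg * \<xi> * rp - \<Lambda> - 1"
    and kp: "kp = s / 2 + \<i> * \<xi>" and km: "km = 2 * \<i> * m * sg + s - kp" and p: "p = 1 + s - 2 * \<i> * m * sg"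
  shows "t\<^sup>2 * (\<i> * sg * d * (1 + z) / t ^ 3 - p / t\<^sup>2 + (\<i> * sg * d * z / t\<^sup>2 - kp - p * z / t)\<^sup>2 / z)
     - ((\<i> * sg * d * z + kp * t + km * z * t)\<^sup>2 / (z * t\<^sup>2) - 4 * s * \<i> * (rm + d / t) * sg + \<Lambda>) =
     (\<nu> + 2 * \<i> * \<eta>) + (1 + s - \<i> * x) * (1 - 4 * \<i> * m * sg) * z"
proof -
  define A where "A = \<i> * sg * d"
  have "t\<^sup>2 * ((A * z / t\<^sup>2 - kp - p * z / t)\<^sup>2 / z) - (A * z + kp * t + km * z * t)\<^sup>2 / (z * t\<^sup>2) =
     ((A * z - kp * t\<^sup>2 - p * z * t)\<^sup>2 - (A * z + kp * t + km * z * t)\<^sup>2) / (z * t\<^sup>2)"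
    using t(2,3) by (simp add: field_simps power2_eq_square)
  also have "(A * z - kp * t\<^sup>2 - p * z * t)\<^sup>2 - (A * z + kp * t + km * z * t)\<^sup>2 =
     (z * t) * ((- 2 * kp + (kp - p - km) * z) * (2 * A + (kp + km - p) * t))"
  proof -
    have X: "A * z - kp * t\<^sup>2 - p * z * t = A * z - kp * t + (kp - p) * z * t"
      unfolding t(1) by (simp add: algebra_simps power2_eq_square)
    show ?thesis unfolding X by (simp add: algebra_simps power2_eq_square)
  qed
  also have "\<dots> / (z * t\<^sup>2) = ((- 2 * kp + (kp - p - km) * z) * (2 * A + (kp + km - p) * t)) / t"
    using t(2,3) by (simp add: power2_eq_square)
  finally have e1: "t\<^sup>2 * ((A * z / t\<^sup>2 - kp - p * z / t)\<^sup>2 / z) - (A * z + kp * t + km * z * t)\<^sup>2 / (z * t\<^sup>2) =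
    ((- 2 * kp + (kp - p - km) * z) * (2 * A + (kp + km - p) * t)) / t" .
  have e2: "t\<^sup>2 * (A * (1 + z) / t ^ 3 - p / t\<^sup>2) = (A * (1 + z) - p * t) / t"
    using t(2) by (simp add: field_simps power2_eq_square power3_eq_cube)
  have e3: "4 * s * \<i> * (rm + d / t) * sg = (4 * s * \<i> * rm * sg * t + 4 * s * A) / t"
    using t(2) by (simp add: A_def field_simps)
  have key: "(- 2 * kp + (kp - p - km) * z) * (2 * A + (kp + km - p) * t) + (A * (1 + z) - p * t) + (4 * s * \<i> * rm * sg * t + 4 * s * A)
     = ((\<nu> + 2 * \<i> * \<eta>) + \<Lambda> + (1 + s - \<i> * x) * (1 - 4 * \<i> * m * sg) * z) * t"
  proof -
    have m: "m = rm + d / 2" using rp by (simp add: field_simps)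
    show ?thesis unfolding \<nu> \<eta> km p kp A_def t(1) m rp(1) x
      by (simp add: algebra_simps)
  qed
  have "t\<^sup>2 * (A * (1 + z) / t ^ 3 - p / t\<^sup>2 + (A * z / t\<^sup>2 - kp - p * z / t)\<^sup>2 / z)
     - ((A * z + kp * t + km * z * t)\<^sup>2 / (z * t\<^sup>2) - 4 * s * \<i> * (rm + d / t) * sg + \<Lambda>) =
     ((- 2 * kp + (kp - p - km) * z) * (2 * A + (kp + km - p) * t)) / t + (A * (1 + z) - p * t) / t + (4 * s * \<i> * rm * sg * t + 4 * s * A) / t - \<Lambda>"
  proof -
    have "(a1 + a2) - (a3 - a4 + \<Lambda>) = b1 + b2 + b3 - \<Lambda>" if "a2 - a3 = b1" "a1 = b2" "a4 = b3" for a1 a2 a3 a4 b1 b2 b3 :: complex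
      using that by (auto simp: algebra_simps)
    from this[OF e1 e2 e3] show ?thesis by (subst distrib_left)
  qed
  also have "\<dots> = (\<nu> + 2 * \<i> * \<eta>) + (1 + s - \<i> * x) * (1 - 4 * \<i> * m * sg) * z"
    unfolding add_divide_distrib[symmetric] key nonzero_mult_div_cancel_right[OF t(2)] by (simp add: algebra_simps)
  finally show ?thesis unfolding A_def .
qed

lemma K_identities:
  fixes rm d t z m \<sigma> \<xi> A s :: real
  assumes "m = rm + d / 2" "t > 0" "z = 1 - t"
  shows "((rm + d / t)\<^sup>2 + A) * \<sigma> + (\<xi> * d - ((rm + d)\<^sup>2 + A) * \<sigma>) =
      d / t\<^sup>2 * (\<sigma> * d * z + \<xi> * t + (2 * m * \<sigma> - \<xi>) * z * t)"
    and "(rm + d / t - m) * s = d / t\<^sup>2 * (s / 2 * t + (s - s / 2) * z * t)"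
  unfolding assms(1,3) using assms(2) by (simp_all add: field_simps power2_eq_square)

section \<open>The compactified variable and the exponents of the radial equation\<close>

locale kerr_mode =
  fixes m a \<sigma> \<Lambda> s :: real and k :: int and H u v :: "real \<Rightarrow> complex"
  assumes m: "m > 0" "\<bar>a\<bar> < m" and \<sigma>: "\<sigma> \<noteq> 0"
    and H_smooth: "smooth_on {r_plus m a<..} H"
    and H_deriv: "\<And>r. r > r_plus m a \<Longrightarrow>
           (H has_vector_derivative kerr_K m a \<sigma> k s r / of_real (kerr_\<mu> m a r)) (at r)"
    and u_smooth: "smooth_on {r_plus m a<..} u"
    and u_ode: "\<And>r. r > r_plus m a \<Longrightarrow> kerr_P m a \<sigma> k \<Lambda> s u r = 0"
    and v_smooth: "smooth_on {r_plus m a..} v" and v_eq: "\<And>r. r > r_plus m a \<Longrightarrow> v r = exp (H r) * u r"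
    and conormal: "conormal_at_infinity (r_plus m a) (\<lambda>r. exp (- H r) * u r)"
begin

definition d :: real where "d = 2 * sqrt (m\<^sup>2 - a\<^sup>2)"
definition rp :: real where "rp = r_plus m a"
definition rm :: real where "rm = rp - d"

lemma two_m_eq: "2 * m = rm + rp" and rm_mult_rp: "rm * rp = a\<^sup>2" and d_pos: "d > 0" and rm_ge: "rm \<ge> 0" and rp_pos: "rp > 0"
proof -
  have "a\<^sup>2 < m\<^sup>2" using power_strict_mono[of "\<bar>a\<bar>" m 2] m by simp
  then have D: "sqrt (m\<^sup>2 - a\<^sup>2) > 0" "(sqrt (m\<^sup>2 - a\<^sup>2))\<^sup>2 = m\<^sup>2 - a\<^sup>2" by simp_all
  show "2 * m = rm + rp" by (simp add: rm_def rp_def d_def r_plus_def)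
  show "d > 0" using D by (simp add: d_def)
  show "rm * rp = a\<^sup>2" using D(2) by (simp add: rm_def rp_def d_def r_plus_def algebra_simps power2_eq_square)
  have "sqrt (m\<^sup>2 - a\<^sup>2) \<le> m" using m by (intro real_le_lsqrt) auto
  then show "rm \<ge> 0" by (simp add: rm_def rp_def d_def r_plus_def)
  show "rp > 0" unfolding rp_def r_plus_def using D(1) m(1) by (rule add_pos_pos[rotated])
qed

lemma rp_eq: "rp = rm + d" by (simp add: rm_def)

definition \<xi> :: real where "\<xi> = ((rp\<^sup>2 + a\<^sup>2) * \<sigma> + a * of_int k) / d"
definition kp :: complex where "kp = of_real s / 2 + \<i> * of_real \<xi>"
definition km :: complex where "km = 2 * \<i> * of_real m * of_real \<sigma> + of_real s - kp"
text \<open>Fixed by p + kp + km = 1 + 2 s, the relation that cancels the last pole at z = 1 in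
  \<open>potential_identity\<close>.\<close>

definition p :: complex where "p = 1 + of_real s - 2 * \<i> * of_real m * of_real \<sigma>"
text \<open>Inverse of the variable z = (r - rp) / (r - rm), for which 1 - z = d / (r - rm).\<close>

definition rr :: "real \<Rightarrow> real" where "rr z = rm + d / (1 - z)"

lemma rr_gt: "z \<in> {0<..<1} \<Longrightarrow> rr z > rp"
  using d_pos by (simp add: rr_def rp_eq field_simps)

lemma rr_minus: "z \<in> {0<..<1} \<Longrightarrow> rr z - rp = d * z / (1 - z)"
  by (simp add: rr_def rp_eq field_simps)

lemma rr_deriv: "z < 1 \<Longrightarrow> (rr has_real_derivative d / (1 - z)\<^sup>2) (at z)"
  unfolding rr_def by (auto intro!: derivative_eq_intros simp: power2_eq_square)

lemma rr_surj:
  assumes "r > rp"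
  obtains z where "z \<in> {0<..<1}" "rr z = r"
proof (rule that[of "(r - rp) / (r - rm)"])
  have "r - rm > 0" using assms rp_eq d_pos by simp
  then show "(r - rp) / (r - rm) \<in> {0<..<1}" using assms rp_eq d_pos by (simp add: field_simps)
  have "1 - (r - rp) / (r - rm) = d / (r - rm)" using \<open>r - rm > 0\<close> rp_eq by (simp add: field_simps)
  then show "rr ((r - rp) / (r - rm)) = r" unfolding rr_def using d_pos \<open>r - rm > 0\<close> by simp
qed

lemma \<mu>_rr:
  assumes "z \<in> {0<..<1}"
  shows "kerr_\<mu> m a (rr z) = d\<^sup>2 * z / (1 - z)\<^sup>2"
proof -
  have "kerr_\<mu> m a (rr z) = (rr z - rm) * (rr z - rp)"
    unfolding kerr_\<mu>_def rm_mult_rp[symmetric] two_m_eq by (simp add: algebra_simps power2_eq_square)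
  also have "rr z - rm = d / (1 - z)" by (simp add: rr_def)
  finally show ?thesis unfolding rr_minus[OF assms] by (simp add: power2_eq_square)
qed

lemma K_rr:
  assumes "z \<in> {0<..<1}"
  shows "kerr_K m a \<sigma> k s (rr z) =
    of_real (d / (1 - z)\<^sup>2) * (\<i> * of_real \<sigma> * of_real d * of_real z + kp * of_real (1 - z) + km * of_real z * of_real (1 - z))"
proof -
  define t where "t = 1 - z"
  have t: "t > 0" "z = 1 - t" using assms by (auto simp: t_def)
  have k: "a * of_int k = \<xi> * d - (rp\<^sup>2 + a\<^sup>2) * \<sigma>" using d_pos by (simp add: \<xi>_def)
  have mm: "m = rm + d / 2" using two_m_eq rp_eq by simp
  note 1 = K_identities(1)[OF mm t, of "a\<^sup>2" \<sigma> \<xi>] and 2 = K_identities(2)[OF mm t, of s]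
  have 3: "\<i> * of_real \<sigma> * of_real d * of_real z + kp * of_real t + km * of_real z * of_real t =
     \<i> * of_real (\<sigma> * d * z + \<xi> * t + (2 * m * \<sigma> - \<xi>) * z * t) + of_real (s / 2 * t + (s - s / 2) * z * t)"
    unfolding kp_def km_def by (simp add: algebra_simps)
  have "kerr_K m a \<sigma> k s (rr z) = \<i> * of_real (((rm + d / t)\<^sup>2 + a\<^sup>2) * \<sigma> + (\<xi> * d - ((rm + d)\<^sup>2 + a\<^sup>2) * \<sigma>)) +
     of_real ((rm + d / t - m) * s)"
    unfolding kerr_K_def rr_def k rp_eq t_def ..
  also have "\<dots> = of_real (d / t\<^sup>2) * (\<i> * of_real \<sigma> * of_real d * of_real z + kp * of_real t + km * of_real z * of_real t)"
  proof -
    have "\<i> * of_real (c * X) + of_real (c * Y) = of_real c * (\<i> * of_real X + of_real Y)" for c X Y :: real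
      by (simp add: algebra_simps)
    then show ?thesis unfolding 1 2 3 .
  qed
  finally show ?thesis unfolding t_def .
qed

text \<open>A primitive of \<open>H'\<close>, pulled back along \<open>rr\<close>; the residues of \<open>H'\<close> at \<open>r\<^sub>+\<close> and \<open>r\<^sub>-\<close> are \<open>kp\<close> and \<open>km\<close>.\<close>

definition hexp :: "real \<Rightarrow> complex" where
  "hexp z = \<i> * of_real (\<sigma> * d / (1 - z)) + (kp * of_real (ln z) + (- (kp + km)) * of_real (ln (1 - z)))"

lemma phase_deriv:
  assumes "z < 1"
  shows "((\<lambda>z. \<i> * of_real (c / (1 - z))) has_vector_derivative \<i> * of_real (c / (1 - z)\<^sup>2)) (at z)"
proof -
  have "((\<lambda>z. c / (1 - z)) has_real_derivative c / (1 - z)\<^sup>2) (at z)"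
    using assms by (auto intro!: derivative_eq_intros simp: power2_eq_square)
  then have "((\<lambda>z. complex_of_real (c / (1 - z))) has_vector_derivative of_real (c / (1 - z)\<^sup>2)) (at z)"
    by (simp add: has_vector_derivative_complex_iff has_real_derivative_iff_has_vector_derivative)
  from has_vector_derivative_mult_right[OF this, of \<i>] show ?thesis .
qed

lemma hexp_deriv:
  assumes "z \<in> {0<..<1}"
  shows "(hexp has_vector_derivative \<i> * of_real (\<sigma> * d / (1 - z)\<^sup>2) + (kp / of_real z - (- (kp + km)) / of_real (1 - z))) (at z)"
  unfolding hexp_def using assms by (intro has_vector_derivative_add phase_deriv exp_ln_deriv) auto

lemma compose_rr:
  assumes "z \<in> {0<..<1}" "(f has_vector_derivative f') (at (rr z))"
  shows "((\<lambda>z. f (rr z)) has_vector_derivative of_real (d / (1 - z)\<^sup>2) * f') (at z)"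
proof -
  have "(rr has_vector_derivative d / (1 - z)\<^sup>2) (at z)"
    using rr_deriv[of z] assms(1) by (simp add: has_real_derivative_iff_has_vector_derivative)
  from vector_diff_chain_at[OF this assms(2)] show ?thesis by (simp add: o_def scaleR_conv_of_real)
qed

lemma H_rr: "\<exists>c. \<forall>z\<in>{0<..<1}. H (rr z) = c + hexp z"
proof -
  have "((\<lambda>z. H (rr z) - hexp z) has_vector_derivative 0) (at z within {0<..<1})" if z: "z \<in> {0<..<1}" for z
  proof -
    define t where "t = complex_of_real (1 - z)"
    have nz: "t \<noteq> 0" "complex_of_real z \<noteq> 0" "complex_of_real d \<noteq> 0" using z d_pos by (auto simp: t_def simp del: of_real_diff)
    have tz: "complex_of_real z = 1 - t" by (simp add: t_def)
    have "(H has_vector_derivative kerr_K m a \<sigma> k s (rr z) / of_real (kerr_\<mu> m a (rr z))) (at (rr z))"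
      using rr_gt[OF z] by (intro H_deriv) (simp add: rp_def)
    from has_vector_derivative_diff[OF compose_rr[OF z this] hexp_deriv[OF z]]
    have "((\<lambda>z. H (rr z) - hexp z) has_vector_derivative
       of_real (d / (1 - z)\<^sup>2) * (kerr_K m a \<sigma> k s (rr z) / of_real (kerr_\<mu> m a (rr z))) -
       (\<i> * of_real (\<sigma> * d / (1 - z)\<^sup>2) + (kp / of_real z - (- (kp + km)) / of_real (1 - z)))) (at z)" .
    moreover have "of_real (d / (1 - z)\<^sup>2) * (kerr_K m a \<sigma> k s (rr z) / of_real (kerr_\<mu> m a (rr z))) -
       (\<i> * of_real (\<sigma> * d / (1 - z)\<^sup>2) + (kp / of_real z - (- (kp + km)) / of_real (1 - z))) = 0"
      unfolding K_rr[OF z] \<mu>_rr[OF z] of_real_divide of_real_mult of_real_power t_def[symmetric]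
      using nz by (simp add: field_simps power2_eq_square) (simp add: tz algebra_simps)
    ultimately have "((\<lambda>z. H (rr z) - hexp z) has_vector_derivative 0) (at z)" by simp
    then show ?thesis by (rule has_vector_derivative_at_within)
  qed
  then obtain c where "\<And>z. z \<in> {0<..<1} \<Longrightarrow> H (rr z) - hexp z = c"
    using has_vector_derivative_zero_constant[of "{0<..<1}" "\<lambda>z. H (rr z) - hexp z"] by auto
  then show ?thesis by (intro exI[of _ c]) (auto simp: algebra_simps)
qed

definition c0 :: complex where "c0 = (SOME c. \<forall>z\<in>{0<..<1}. H (rr z) = c + hexp z)"

lemma H_eq: "z \<in> {0<..<1} \<Longrightarrow> H (rr z) = c0 + hexp z"
  using someI_ex[OF H_rr] unfolding c0_def by blast

text \<open>
  \<open>1 / F\<close> is a multiple of \<open>e\<^sup>i\<^sup>\<sigma>\<^sup>r (r - r\<^sub>+)\<^sup>-\<^sup>k\<^sup>p (r - r\<^sub>-)\<^sup>k\<^sup>p\<^sup>-\<^sup>p\<close>, which has the admissible behaviour at both ends.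
\<close>

definition F :: "real \<Rightarrow> complex" where
  "F z = exp (- (\<i> * of_real (\<sigma> * d / (1 - z))) + (kp * of_real (ln z) + (- p) * of_real (ln (1 - z))))"

definition W :: "real \<Rightarrow> complex" where "W z = u (rr z) * F z"

lemma u_zero_iff: "(\<forall>r>r_plus m a. u r = 0) \<longleftrightarrow> (\<forall>z\<in>{0<..<1}. W z = 0)"
proof
  show "\<forall>z\<in>{0<..<1}. W z = 0" if "\<forall>r>r_plus m a. u r = 0"
    using that rr_gt by (auto simp: W_def rp_def)
  show "\<forall>r>r_plus m a. u r = 0" if W0: "\<forall>z\<in>{0<..<1}. W z = 0"
  proof (intro allI impI)
    fix r assume "r > r_plus m a"
    then obtain z where "z \<in> {0<..<1}" "rr z = r" using rr_surj[of r] by (auto simp: rp_def)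
    then show "u r = 0" using W0 by (auto simp: W_def F_def)
  qed
qed

definition u' :: "real \<Rightarrow> complex" where "u' r = vector_derivative u (at r)"
text \<open>This is z d/dz applied to the pull-back of u. It is taken as second unknown because the
  equation gives the derivative of \<mu> u' directly, without a second derivative of u.\<close>

definition q :: "real \<Rightarrow> complex" where "q z = of_real (kerr_\<mu> m a (rr z)) * u' (rr z) / of_real d"
definition V :: "real \<Rightarrow> complex" where
  "V r = (kerr_K m a \<sigma> k s r)\<^sup>2 / of_real (kerr_\<mu> m a r) - 4 * of_real s * \<i> * of_real r * of_real \<sigma> + of_real \<Lambda>"

lemma u_symb: 
  assumes "rp < r1" "r1 < r2"
  shows "symb (\<lambda>_. 1) {r1<..<r2} n u" "symb (\<lambda>_. 1) {r1<..<r2} n H"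
  by (rule smooth_on_symb[OF u_smooth, of _ "{r1..r2}"] smooth_on_symb[OF H_smooth, of _ "{r1..r2}"];
      use assms in \<open>auto simp: rp_def\<close>)+

lemma u_deriv:
  assumes "r > rp"
  shows "(u has_vector_derivative u' r) (at r)"
    "((\<lambda>x. of_real (kerr_\<mu> m a x) * u' x) has_vector_derivative V r * u r) (at r)"
proof -
  define S where "S = {(r + rp) / 2<..<r + 1}"
  have S: "r \<in> S" "rp < (r + rp) / 2" "(r + rp) / 2 < r + 1" using assms by (auto simp: S_def)
  note su = u_symb(1)[OF S(2,3), folded S_def]
  show "(u has_vector_derivative u' r) (at r)" unfolding u'_def by (rule symb_SucD(2)[OF su S(1)])
  have su': "symb (\<lambda>_. 1) S (Suc 0) u'" using symb_SucD(3)[OF su[of "Suc (Suc 0)"]] unfolding u'_def[abs_def] by (simp del: symb.simps)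
  have d\<mu>: "((\<lambda>x. complex_of_real (kerr_\<mu> m a x)) has_vector_derivative of_real (2 * r - 2 * m)) (at r)"
  proof -
    have "((\<lambda>x. kerr_\<mu> m a x) has_real_derivative 2 * r - 2 * m) (at r)"
      unfolding kerr_\<mu>_def by (auto intro!: derivative_eq_intros)
    then show ?thesis by (simp add: has_vector_derivative_complex_iff has_real_derivative_iff_has_vector_derivative)
  qed
  have "((\<lambda>x. of_real (kerr_\<mu> m a x) * u' x) has_vector_derivative
     of_real (kerr_\<mu> m a r) * vector_derivative u' (at r) + of_real (2 * r - 2 * m) * u' r) (at r)"
    by (rule has_vector_derivative_mult[OF d\<mu> symb_SucD(2)[OF su' S(1)]])
  then have "(\<lambda>x. of_real (kerr_\<mu> m a x) * u' x) differentiable (at r)" by (rule differentiableI_vector)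
  moreover have "vector_derivative (\<lambda>x. of_real (kerr_\<mu> m a x) * u' x) (at r) = V r * u r"
    using u_ode[of r] assms unfolding kerr_P_def V_def u'_def rp_def by (simp add: algebra_simps divide_inverse)
  ultimately show "((\<lambda>x. of_real (kerr_\<mu> m a x) * u' x) has_vector_derivative V r * u r) (at r)"
    by (simp add: vector_derivative_works)
qed

text \<open>The negative logarithmic derivative of \<open>F\<close>.\<close>

definition \<epsilon> :: "real \<Rightarrow> complex" where
  "\<epsilon> z = \<i> * of_real (\<sigma> * d / (1 - z)\<^sup>2) - kp / of_real z - p / of_real (1 - z)"

lemma z_derivs:
  assumes z: "z \<in> {0<..<1}"
  shows "((\<lambda>z. u (rr z)) has_vector_derivative q z / of_real z) (at z)"
    "(q has_vector_derivative V (rr z) * u (rr z) / of_real ((1 - z)\<^sup>2)) (at z)"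
    "(F has_vector_derivative F z * (- \<epsilon> z)) (at z)"
proof -
  have nz: "complex_of_real z \<noteq> 0" "complex_of_real d \<noteq> 0" "complex_of_real (1 - z) \<noteq> 0" using z d_pos by (auto simp del: of_real_diff)
  have "((\<lambda>z. u (rr z)) has_vector_derivative of_real (d / (1 - z)\<^sup>2) * u' (rr z)) (at z)"
    by (rule compose_rr[OF z u_deriv(1)[OF rr_gt[OF z]]])
  moreover have "q z / of_real z = of_real (d / (1 - z)\<^sup>2) * u' (rr z)"
    unfolding q_def \<mu>_rr[OF z] of_real_divide of_real_mult of_real_power using nz by (simp add: field_simps power2_eq_square del: of_real_diff)
  ultimately show "((\<lambda>z. u (rr z)) has_vector_derivative q z / of_real z) (at z)" by simp
  have "((\<lambda>z. of_real (kerr_\<mu> m a (rr z)) * u' (rr z)) has_vector_derivative of_real (d / (1 - z)\<^sup>2) * (V (rr z) * u (rr z))) (at z)"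
    by (rule compose_rr[OF z u_deriv(2)[OF rr_gt[OF z]]])
  from has_vector_derivative_mult_right[OF this, of "inverse (of_real d)"]
  show "(q has_vector_derivative V (rr z) * u (rr z) / of_real ((1 - z)\<^sup>2)) (at z)"
    unfolding q_def using nz by (simp add: field_simps del: of_real_diff)
  have "((\<lambda>z. - (\<i> * of_real (\<sigma> * d / (1 - z))) + (kp * of_real (ln z) + (- p) * of_real (ln (1 - z)))) has_vector_derivative
     - (\<i> * of_real (\<sigma> * d / (1 - z)\<^sup>2)) + (kp / of_real z - (- p) / of_real (1 - z))) (at z)"
    using z by (intro has_vector_derivative_add has_vector_derivative_minus phase_deriv exp_ln_deriv) auto
  from has_vector_derivative_exp[OF this]
  show "(F has_vector_derivative F z * (- \<epsilon> z)) (at z)"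
    unfolding F_def \<epsilon>_def by (simp add: algebra_simps)
qed

section \<open>The conjugated equation in confluent Heun form\<close>

definition x :: real where "x = 2 * \<xi>"
definition T :: real where "T = 4 * m * \<sigma>"
definition \<eta> :: real where "\<eta> = \<sigma> * rp + \<xi>"
definition \<nu> :: real where "\<nu> = 8 * \<sigma> * \<xi> * rp - \<Lambda> - 1"

definition P0 :: complex where "P0 = 1 - of_real s - \<i> * of_real x"
definition P1 :: complex where "P1 = - 4 + 4 * \<i> * of_real \<eta>"
definition P2 :: complex where "P2 = 3 + of_real s - \<i> * of_real x - \<i> * of_real T"
definition R0 :: complex where "R0 = of_real \<nu> + 2 * \<i> * of_real \<eta>"
definition R1 :: complex where "R1 = (1 + of_real s - \<i> * of_real x) * (1 - \<i> * of_real T)"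

sublocale heun: confluent_heun P0 P1 P2 R0 R1 .

lemma P_eq: "heun.P z = (1 - z)\<^sup>2 + 2 * (\<i> * of_real \<sigma> * of_real d * z - kp * (1 - z)\<^sup>2 - p * z * (1 - z))"
proof -
  have mc: "2 * complex_of_real m = 2 * of_real rp - of_real d"
  proof -
    have "2 * m = 2 * rp - d" using two_m_eq rp_eq by linarith
    from arg_cong[OF this, of complex_of_real] show ?thesis by simp
  qed
  have T: "complex_of_real T = (2 * (2 * of_real m)) * of_real \<sigma>" by (simp add: T_def)
  have p: "p = 1 + of_real s - \<i> * ((2 * of_real m) * of_real \<sigma>)" by (simp add: p_def)
  show ?thesis
    unfolding heun.P_def unfolding P0_def P1_def P2_def T p mc kp_def x_def \<eta>_def
    by (simp add: field_simps power2_eq_square)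
qed

lemma P_\<epsilon>:
  assumes "z \<in> {0<..<1}"
  shows "heun.P (of_real z) = of_real ((1 - z)\<^sup>2) + 2 * of_real ((1 - z)\<^sup>2) * of_real z * \<epsilon> z"
proof -
  define t where "t = complex_of_real (1 - z)"
  have nz: "t \<noteq> 0" "complex_of_real z \<noteq> 0" using assms by (auto simp: t_def simp del: of_real_diff)
  have t': "1 - complex_of_real z = t" by (simp add: t_def)
  show ?thesis
    unfolding P_eq \<epsilon>_def of_real_power of_real_divide of_real_mult t' t_def[symmetric]
    using nz by (simp add: field_simps power2_eq_square)
qed

text \<open>Conjugation with \<open>F\<close> produces the zeroth-order coefficient (1 - z)^2 ((z
  \<epsilon>)' + z \<epsilon>^2) - V; the first two terms in the bracket are (z \<epsilon>)' written
  out.\<close>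

lemma R_V:
  assumes "z \<in> {0<..<1}"
  shows "heun.R (of_real z) = of_real ((1 - z)\<^sup>2) * (\<i> * of_real \<sigma> * of_real d * (1 + of_real z) / of_real (1 - z) ^ 3
     - p / of_real (1 - z) ^ 2 + of_real z * (\<epsilon> z)\<^sup>2) - V (rr z)"
proof -
  define t where "t = complex_of_real (1 - z)"
  define y where "y = complex_of_real z"
  have nz: "t \<noteq> 0" "y \<noteq> 0" "complex_of_real d \<noteq> 0" using assms d_pos by (auto simp: t_def y_def simp del: of_real_diff)
  have ty: "t = 1 - y" by (simp add: t_def y_def)
  have V: "V (rr z) = (\<i> * of_real \<sigma> * of_real d * y + kp * t + km * y * t)\<^sup>2 / (y * t\<^sup>2) -
     4 * of_real s * \<i> * (of_real rm + of_real d / t) * of_real \<sigma> + of_real \<Lambda>"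
  proof -
    have "(of_real (d / (1 - z)\<^sup>2) * X)\<^sup>2 / of_real (d\<^sup>2 * z / (1 - z)\<^sup>2) = X\<^sup>2 / (y * t\<^sup>2)" for X :: complex
      unfolding of_real_divide of_real_mult of_real_power t_def[symmetric] y_def[symmetric]
      using nz by (simp add: field_simps power2_eq_square)
    moreover have "complex_of_real (rr z) = of_real rm + of_real d / t" by (simp add: rr_def t_def)
    ultimately show ?thesis unfolding V_def K_rr[OF assms] \<mu>_rr[OF assms] t_def[symmetric] y_def[symmetric] by simp
  qed
  have \<epsilon>: "y * (\<epsilon> z)\<^sup>2 = (\<i> * of_real \<sigma> * of_real d * y / t\<^sup>2 - kp - p * y / t)\<^sup>2 / y"
    unfolding \<epsilon>_def of_real_divide of_real_mult of_real_power t_def[symmetric] y_def[symmetric]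
    using nz by (simp add: field_simps power2_eq_square)
  have mc: "2 * complex_of_real m = of_real rm + of_real rp"
    using arg_cong[OF two_m_eq, of complex_of_real] by simp
  have "t\<^sup>2 * (\<i> * of_real \<sigma> * of_real d * (1 + y) / t ^ 3 - p / t\<^sup>2 + (\<i> * of_real \<sigma> * of_real d * y / t\<^sup>2 - kp - p * y / t)\<^sup>2 / y)
     - ((\<i> * of_real \<sigma> * of_real d * y + kp * t + km * y * t)\<^sup>2 / (y * t\<^sup>2) - 4 * of_real s * \<i> * (of_real rm + of_real d / t) * of_real \<sigma> + of_real \<Lambda>) =
     (of_real \<nu> + 2 * \<i> * of_real \<eta>) + (1 + of_real s - \<i> * of_real x) * (1 - 4 * \<i> * of_real m * of_real \<sigma>) * y"
    by (rule potential_identity[OF ty nz(1,2), of "of_real \<xi>" "of_real x" "of_real rp" "of_real rm" "of_real d" "of_real m"])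
      (simp_all add: x_def rp_eq mc[unfolded rp_eq] \<eta>_def \<nu>_def kp_def km_def p_def)
  also have "\<dots> = heun.R y"
    unfolding heun.R_def unfolding R0_def R1_def T_def by simp
  finally show ?thesis unfolding V \<epsilon>[symmetric] t_def[symmetric] y_def[symmetric] of_real_power by simp
qed

definition W1 :: "real \<Rightarrow> complex" where "W1 z = (q z / of_real z - \<epsilon> z * u (rr z)) * F z"

definition \<epsilon>' :: "real \<Rightarrow> complex" where
  "\<epsilon>' z = 2 * \<i> * of_real \<sigma> * of_real d / of_real (1 - z) ^ 3 + kp / (of_real z)\<^sup>2 - p / (of_real (1 - z))\<^sup>2"

definition W2 :: "real \<Rightarrow> complex" where
  "W2 z = (q z / of_real z - \<epsilon> z * u (rr z)) * (F z * (- \<epsilon> z)) +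
    ((q z * (- (inverse (of_real z))\<^sup>2) + V (rr z) * u (rr z) / of_real ((1 - z)\<^sup>2) * inverse (of_real z)) -
      (\<epsilon> z * (q z / of_real z) + \<epsilon>' z * u (rr z))) * F z"

lemma \<epsilon>_deriv:
  assumes "z \<in> {0<..<1}"
  shows "(\<epsilon> has_vector_derivative \<epsilon>' z) (at z)"
proof -
  have nz: "complex_of_real z \<noteq> 0" "1 - complex_of_real z \<noteq> 0" using assms by (auto simp: complex_eq_iff)
  have d1: "((\<lambda>w. inverse (1 - w)) has_field_derivative inverse (1 - of_real z) ^ 2) (at (complex_of_real z))"
    using nz(2) by (auto intro!: derivative_eq_intros simp: power2_eq_square)
  have d2: "((\<lambda>w. inverse w) has_field_derivative - (inverse (of_real z) ^ 2)) (at (complex_of_real z))"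
    using DERIV_inverse[OF nz(1)] by (simp add: numeral_2_eq_2)
  have d3: "((\<lambda>w. inverse (1 - w) ^ 2) has_field_derivative 2 * inverse (1 - of_real z) ^ 3) (at (complex_of_real z))"
    using DERIV_power[OF d1, of 2] by (simp add: power3_eq_cube power2_eq_square mult_ac)
  have "((\<lambda>w. \<i> * of_real (\<sigma> * d) * inverse (1 - w) ^ 2 - kp * inverse w - p * inverse (1 - w)) has_field_derivative
     \<i> * of_real (\<sigma> * d) * (2 * inverse (1 - of_real z) ^ 3) - kp * (- (inverse (of_real z) ^ 2)) - p * inverse (1 - of_real z) ^ 2)
     (at (complex_of_real z))"
    by (intro DERIV_diff DERIV_cmult d1 d2 d3)
  from has_vector_derivative_real_field[OF this]
  show ?thesis unfolding \<epsilon>_def[abs_def] \<epsilon>'_def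
    by (simp add: divide_inverse power_inverse mult_ac)
qed

lemma W_derivs:
  assumes z: "z \<in> {0<..<1}"
  shows "(W has_vector_derivative W1 z) (at z)" "(W1 has_vector_derivative W2 z) (at z)"
proof -
  show "(W has_vector_derivative W1 z) (at z)"
    using has_vector_derivative_mult[OF z_derivs(1,3)[OF z]] unfolding W_def[abs_def] W1_def
    by (simp add: algebra_simps)
  have inv: "((\<lambda>z. inverse (complex_of_real z)) has_vector_derivative - (inverse (of_real z))\<^sup>2) (at z)"
    using z by (intro has_vector_derivative_real_field) (auto intro!: derivative_eq_intros simp: numeral_2_eq_2)
  show "(W1 has_vector_derivative W2 z) (at z)"
    unfolding W1_def[abs_def] W2_def divide_inverse
    by (intro has_vector_derivative_mult has_vector_derivative_diff inv z_derivs(2)[OF z, unfolded divide_inverse]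
        z_derivs(3)[OF z] z_derivs(1)[OF z, unfolded divide_inverse] \<epsilon>_deriv[OF z])
qed

lemma W_ode:
  assumes z: "z \<in> {0<..<1}"
  shows "heun.op (of_real z) (W z) (W1 z) (W2 z) = 0"
proof -
  define t where "t = complex_of_real (1 - z)"
  define y where "y = complex_of_real z"
  define A where "A = \<i> * complex_of_real \<sigma> * of_real d"
  define U where "U = u (rr z)"
  have nz: "t \<noteq> 0" "y \<noteq> 0" using z by (auto simp: t_def y_def simp del: of_real_diff)
  have ty: "1 - y = t" by (simp add: t_def y_def)
  have P: "heun.P y = t\<^sup>2 + 2 * t\<^sup>2 * y * \<epsilon> z"
    using P_\<epsilon>[OF z] unfolding of_real_power t_def y_def .
  have R: "heun.R y = t\<^sup>2 * (A * (1 + y) / t ^ 3 - p / t\<^sup>2 + y * (\<epsilon> z)\<^sup>2) - V (rr z)"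
    using R_V[OF z] unfolding of_real_power t_def y_def A_def .
  have e: "y * \<epsilon>' z + \<epsilon> z = A * (1 + y) / t ^ 3 - p / t\<^sup>2"
  proof -
    have y: "y = 1 - t" using ty by (simp add: algebra_simps)
    show ?thesis
      unfolding \<epsilon>'_def \<epsilon>_def of_real_divide of_real_mult of_real_power t_def[symmetric] y_def[symmetric]
        mult.assoc[symmetric] A_def
      using nz by (simp add: divide_simps power2_eq_square power3_eq_cube) (simp add: y algebra_simps)
  qed
  have W2: "y * W2 z = (- q z / y + V (rr z) * U / t\<^sup>2 - 2 * \<epsilon> z * q z - y * \<epsilon>' z * U + y * (\<epsilon> z)\<^sup>2 * U) * F z"
    unfolding W2_def of_real_power t_def[symmetric] y_def[symmetric] U_def[symmetric]
    using nz by (simp add: field_simps power2_eq_square)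
  have W1: "W1 z = (q z / y - \<epsilon> z * U) * F z" by (simp add: W1_def U_def y_def)
  have "heun.op y (W z) (W1 z) (W2 z) = t\<^sup>2 * (y * W2 z) + heun.P y * W1 z + heun.R y * W z"
    unfolding heun.op_def ty by (simp add: algebra_simps)
  also have "\<dots> = U * F z * (V (rr z) - t\<^sup>2 * (y * \<epsilon>' z + \<epsilon> z) - t\<^sup>2 * y * (\<epsilon> z)\<^sup>2 + heun.R y)"
    unfolding W2 W1 P W_def U_def[symmetric] using nz by (simp add: field_simps power2_eq_square)
  also have "\<dots> = 0" unfolding R e by (simp add: algebra_simps)
  finally show ?thesis unfolding y_def .
qed

text \<open>With this value, \<open>osc \<kappa> z * G z\<close> is 1 / F^2, the weight created by
  conjugating a symmetric operator with \<open>F\<close>. The oscillating factor is kept apart from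
  \<open>G\<close> because it is not conormal at z = 1.\<close>

definition \<kappa> :: real where "\<kappa> = 2 * \<sigma> * d"
definition G :: "real \<Rightarrow> complex" where
  "G z = exp ((- 2 * kp) * of_real (ln z) + (2 * p) * of_real (ln (1 - z)))"

lemma G_ode:
  assumes z: "z \<in> {0<..<1}"
  shows "dd (\<lambda>z. of_real z * G z) z + \<i> * of_real \<kappa> * (of_real z * G z) = G z * heun.P (of_real z)"
proof -
  define t where "t = complex_of_real (1 - z)"
  define y where "y = complex_of_real z"
  have nz: "t \<noteq> 0" "y \<noteq> 0" using z by (auto simp: t_def y_def simp del: of_real_diff)
  have ty: "1 - y = t" by (simp add: t_def y_def)
  have "(of_real has_vector_derivative (1::complex)) (at z)" by (simp add: has_vector_derivative_complex_iff)
  from has_vector_derivative_mult[OF this has_vector_derivative_exp[OF exp_ln_deriv[OF z]]]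
  have "((\<lambda>z. of_real z * G z) has_vector_derivative
    of_real z * (G z * ((- 2 * kp) / of_real z - (2 * p) / of_real (1 - z))) + 1 * G z) (at z)"
    unfolding G_def .
  then have "dd (\<lambda>z. of_real z * G z) z = t\<^sup>2 * (y * (G z * ((- 2 * kp) / y - (2 * p) / t)) + 1 * G z)"
    unfolding dd_def t_def y_def by (simp add: vector_derivative_at)
  moreover have "t\<^sup>2 * (y * (G z * ((- 2 * kp) / y - (2 * p) / t)) + 1 * G z) = G z * (t\<^sup>2 - 2 * kp * t\<^sup>2 - 2 * p * y * t)"
    using nz by (simp add: field_simps power2_eq_square)
  ultimately show ?thesis
    unfolding P_eq y_def[symmetric] ty \<kappa>_def by (simp add: algebra_simps)
qed

lemma wsym_G: "\<exists>Q L. wsym (- int Q) (- int L) G"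
proof -
  \<comment> \<open>\<open>G\<close> has modulus z^(-s) (1 - z)^(2 + 2 s). The exponents are rounded
    so that the remaining powers have nonnegative real part.\<close>
  define Q where "Q = nat \<lceil>s\<rceil>"
  define L where "L = nat \<lceil>- (2 + 2 * s)\<rceil>"
  have QL: "real Q \<ge> s" "real L \<ge> - (2 + 2 * s)" unfolding Q_def L_def by linarith+
  have "bsym (\<lambda>z. exp ((of_nat Q - 2 * kp) * of_real (ln z) + (of_nat L + 2 * p) * of_real (ln (1 - z))))"
    by (rule bsym_exp_ln) (use QL in \<open>auto simp: kp_def p_def\<close>)
  then have "wsym (- int Q) (- int L) G"
  proof (rule wsymI)
    fix z :: real assume z: "z \<in> {0<..<1}"
    have "mon (- int Q) (- int L) z = exp (- real Q * ln z) * exp (- real L * ln (1 - z))"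
      using z by (simp add: mon_def power_int_minus exp_minus exp_of_nat_mult)
    then have "complex_of_real (mon (- int Q) (- int L) z) = exp (- of_nat Q * of_real (ln z)) * exp (- of_nat L * of_real (ln (1 - z)))"
      by (simp add: exp_of_real[symmetric])
    then show "G z = of_real (mon (- int Q) (- int L) z) *
       exp ((of_nat Q - 2 * kp) * of_real (ln z) + (of_nat L + 2 * p) * of_real (ln (1 - z)))"
      unfolding G_def by (simp add: exp_add[symmetric] algebra_simps)
  qed
  then show ?thesis by blast
qed

end

section \<open>Regularity of the conjugated solution at both ends\<close>

context kerr_mode
begin

text \<open>\<open>rr\<close> maps \<open>z1\<close> to rp + 1, where the conormality bounds begin,
  and \<open>z2\<close> to rp + 2, so that the regions near the two ends overlap.\<close>

definition z1 :: real where "z1 = 1 / (1 + d)"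
definition z2 :: real where "z2 = 2 / (2 + d)"

lemma z1_z2_bounds: "0 < z1" "z1 < z2" "z2 < 1"
  using d_pos by (auto simp: z1_def z2_def field_simps)

text \<open>In W = exp (-H) F v the power z^(-kp) of exp (-H) cancels z^kp of \<open>F\<close>; the
  other factors are smooth up to z = 0.\<close>

lemma W_near_horizon: "symb (\<lambda>_. 1) {0<..<z2} n W"
proof -
  have o: "open {0<..<z2}" by simp
  have rid: "symb (\<lambda>_. 1) {rp<..<rp + 2} n (\<lambda>r. of_real r)" for n by (rule symb_id) auto
  have "symb (\<lambda>_. 1) {rp<..<rp + 2} n v"
    by (rule smooth_on_symb[OF v_smooth, of _ "{rp..rp + 2}"]) (auto simp: rp_def)
  \<comment> \<open>This field is the image of d/dz under \<open>rr\<close>.\<close>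
  then have "symb (\<lambda>r. (r - rm)\<^sup>2 / d) {rp<..<rp + 2} n v"
  proof (rule symb_change_field[rotated 3])
    have "symb (\<lambda>_. 1) {rp<..<rp + 2} n (\<lambda>r. inverse (of_real d) * (of_real r - of_real rm)\<^sup>2)"
      by (intro symb_mult symb_power symb_diff rid symb_const) auto
    then show "symb (\<lambda>_. 1) {rp<..<rp + 2} n (\<lambda>r. of_real ((r - rm)\<^sup>2 / d))"
      by (simp add: divide_inverse mult.commute)
  qed auto
  then have vr: "symb (\<lambda>_. 1) {0<..<z2} n (\<lambda>z. v (rr z))"
  proof (rule symb_compose[OF o, rotated 3])
    fix z assume z: "z \<in> {0<..<z2}"
    then have z': "z \<in> {0<..<1}" using z1_z2_bounds by auto
    show "(rr has_real_derivative d / (1 - z)\<^sup>2) (at z)" using z' by (intro rr_deriv) auto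
    have "rr z - rp < 2" unfolding rr_minus[OF z'] using z z' d_pos by (simp add: z2_def field_simps)
    then show "rr z \<in> {rp<..<rp + 2}" using rr_gt[OF z'] by simp
    show "1 * (d / (1 - z)\<^sup>2) = (rr z - rm)\<^sup>2 / d" using z' d_pos by (simp add: rr_def power2_eq_square)
  qed
  have st: "symb (\<lambda>_. 1) {0<..<z2} n (\<lambda>z. of_real (1 - z))"
  proof -
    have "symb (\<lambda>_. 1) {0<..<z2} n (\<lambda>z. of_real z)" by (rule symb_id) auto
    from symb_diff[OF o symb_const[of _ _ _ 1] this] show ?thesis by simp
  qed
  have sln: "symb (\<lambda>_. 1) {0<..<z2} n (\<lambda>z. of_real (ln (1 - z)))"
    by (rule symb_ln[of _ "1 - z2" _ _ _ "\<lambda>_. -1"]) (use z1_z2_bounds st in \<open>auto intro!: derivative_eq_intros\<close>)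
  have sinv: "symb (\<lambda>_. 1) {0<..<z2} n (\<lambda>z. inverse (of_real (1 - z)))"
    by (rule symb_inverse[OF o, of "1 - z2"]) (use z1_z2_bounds st in \<open>auto simp del: of_real_diff\<close>)
  have "symb (\<lambda>_. 1) {0<..<z2} n (\<lambda>z. (exp (- c0) * v (rr z)) *
     exp ((- 2 * \<i> * of_real (\<sigma> * d)) * inverse (of_real (1 - z)) + (kp + km - p) * of_real (ln (1 - z))))"
    by (intro symb_mult symb_exp symb_add symb_const vr sln sinv o)
  then show ?thesis
  proof (rule symb_cong[OF o, THEN iffD1, rotated])
    fix z assume z: "z \<in> {0<..<z2}"
    then have z': "z \<in> {0<..<1}" using z1_z2_bounds by auto
    have "v (rr z) = exp (H (rr z)) * u (rr z)" using rr_gt[OF z'] by (intro v_eq) (simp add: rp_def)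
    then have "u (rr z) = exp (- H (rr z)) * v (rr z)" by (simp add: exp_minus)
    then have "W z = v (rr z) * (exp (- c0 - hexp z) * F z)"
      unfolding W_def H_eq[OF z'] by (simp add: mult_ac)
    also have "exp (- c0 - hexp z) * F z = exp (- c0) * exp ((- 2 * \<i> * of_real (\<sigma> * d)) * inverse (of_real (1 - z)) + (kp + km - p) * of_real (ln (1 - z)))"
      unfolding F_def hexp_def exp_add[symmetric]
      by (rule arg_cong[where f = exp]) (simp add: algebra_simps divide_inverse)
    finally show "(exp (- c0) * v (rr z)) *
     exp ((- 2 * \<i> * of_real (\<sigma> * d)) * inverse (of_real (1 - z)) + (kp + km - p) * of_real (ln (1 - z))) = W z"
      by (simp add: mult_ac)
  qed
qed

text \<open>In W = exp H F (exp (-H) u) the oscillating factors of exp H and \<open>F\<close>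
  cancel. What remains beside the conormal function is z^(2 kp) times the power -(1 + 2 s) of 1 - z,
  and r^(-\<beta>), which is of order (1 - z)^\<beta>.\<close>

lemma W_near_infinity:
  "\<exists>M. \<forall>n. symb (\<lambda>z. z * (1 - z)) {z1<..<1} n (\<lambda>z. of_real (1 - z) ^ M * W z)"
proof -
  define f where "f = (\<lambda>r. exp (- H r) * u r)"
  obtain \<beta> :: real where \<beta>: "\<And>j. bounded ((r_deriv ^^ j) (\<lambda>r. of_real (r powr \<beta>) * f r) ` {rp + 1<..})"
    using conormal unfolding conormal_at_infinity_def f_def rp_def by blast
  define f0 where "f0 = (\<lambda>r. of_real (r powr \<beta>) * f r)"
  \<comment> \<open>Boundedness of the iterated \<open>r_deriv\<close> says nothing about
    differentiability, as \<open>vector_derivative\<close> is a total function; this comes from the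
    smoothness of \<open>u\<close> and \<open>H\<close>.\<close>
  have "(r_deriv ^^ j) f0 differentiable (at r)" if r: "r \<in> {rp + 1<..}" for j r
  proof (rule symb_r_deriv_differentiable)
    define r1 r2 where "r1 = rp + 1/2" and "r2 = r + 1"
    have r12: "rp < r1" "r1 < r2" "0 < r1" using r rp_pos by (auto simp: r1_def r2_def)
    show "r \<in> {r1<..<r2}" using r by (auto simp: r1_def r2_def)
    have o: "open {r1<..<r2}" by simp
    have rid: "symb (\<lambda>_. 1) {r1<..<r2} n (\<lambda>r. of_real r)" for n by (rule symb_id) auto
    fix n
    have sln: "symb (\<lambda>_. 1) {r1<..<r2} n (\<lambda>r. of_real (ln r))"
      by (rule symb_ln[of _ r1 _ _ _ "\<lambda>_. 1"]) (use r12 rid in \<open>auto intro!: derivative_eq_intros\<close>)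
    have "symb (\<lambda>_. 1) {r1<..<r2} n (\<lambda>r. exp (of_real \<beta> * of_real (ln r)) * (exp (- H r) * u r))"
      by (intro symb_mult symb_exp symb_uminus symb_const sln u_symb r12 o)
    then have "symb (\<lambda>_. 1) {r1<..<r2} n f0"
      by (rule symb_cong[OF o, THEN iffD1, rotated])
        (use r12 in \<open>auto simp: f0_def f_def powr_def simp flip: exp_of_real\<close>)
    then show "symb (\<lambda>r. r) {r1<..<r2} n f0"
      by (rule symb_change_field[of _ _ "\<lambda>r. r" "\<lambda>_. 1", rotated 3]) (use rid in auto)
  qed
  then have sf0: "symb (\<lambda>r. r) {rp + 1<..} n f0" for n
    using \<beta> unfolding f0_def by (intro symb_of_r_deriv) auto
  \<comment> \<open>\<open>rr\<close> carries z (1 - z) d/dz to (r - rp) d/dr, which for r > rp + 1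
    is a symbol multiple of r d/dr.\<close>
  have "symb (\<lambda>r. r - rp) {rp + 1<..} n f0" for n
  proof (rule symb_change_field[where \<rho> = "\<lambda>r. 1 - rp * inverse r", OF _ _ _ sf0])
    have "symb (\<lambda>r. r) {rp + 1<..} n (\<lambda>r. 1 - of_real rp * inverse (of_real r))"
      by (intro symb_diff symb_mult symb_const symb_inverse_id) (use rp_pos in auto)
    then show "symb (\<lambda>r. r) {rp + 1<..} n (\<lambda>r. of_real (1 - rp * inverse r))" by simp
    show "r - rp = (1 - rp * inverse r) * r" if "r \<in> {rp + 1<..}" for r
      using that rp_pos by (simp add: field_simps)
  qed auto
  then have fr: "symb (\<lambda>z. z * (1 - z)) {z1<..<1} n (\<lambda>z. f0 (rr z))" for n
  proof (rule symb_compose[rotated 4])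
    fix z assume z: "z \<in> {z1<..<1}"
    then have z': "z \<in> {0<..<1}" using z1_z2_bounds by auto
    show "(rr has_real_derivative d / (1 - z)\<^sup>2) (at z)" using z' by (intro rr_deriv) auto
    have "rr z - rp > 1" unfolding rr_minus[OF z'] using z z' d_pos by (simp add: z1_def field_simps)
    then show "rr z \<in> {rp + 1<..}" by simp
    show "z * (1 - z) * (d / (1 - z)\<^sup>2) = rr z - rp" unfolding rr_minus[OF z'] using z' by (simp add: power2_eq_square)
  qed auto
  have o: "open {z1<..<1}" by simp
  have sub: "symb (\<lambda>z. z * (1 - z)) {z1<..<1} n b" if "bsym b" for n b
    by (rule symb_subset[OF bsymD[OF that]]) (use z1_z2_bounds in auto)
  \<comment> \<open>Makes the total exponent M + \<beta> - (1 + 2 s) of 1 - z nonnegative.\<close>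
  define M where "M = nat \<lceil>1 + 2 * s - \<beta>\<rceil>"
  have M: "real M + \<beta> - (1 + 2 * s) \<ge> 0" unfolding M_def by linarith
  have pos: "rm * (1 - z) + d \<ge> d" if "z \<in> {z1<..<1}" for z
    using that rm_ge by (auto intro: mult_nonneg_nonneg)
  have "symb (\<lambda>z. z * (1 - z)) {z1<..<1} n (\<lambda>z. of_real (1 - z) ^ M * W z)" for n
  proof -
    have sz: "symb (\<lambda>z. z * (1 - z)) {z1<..<1} n (\<lambda>z. of_real (ln z))"
      by (rule symb_ln[of _ z1 _ _ _ "\<lambda>_. 1"]) (use z1_z2_bounds sub[OF bsym_z] in \<open>auto intro!: derivative_eq_intros\<close>)
    have "symb (\<lambda>z. z * (1 - z)) {z1<..<1} n (\<lambda>z. of_real rm * of_real (1 - z) + of_real d)"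
      by (intro symb_add symb_mult symb_const sub[OF bsym_z'] o)
    then have srm: "symb (\<lambda>z. z * (1 - z)) {z1<..<1} n (\<lambda>z. of_real (rm * (1 - z) + d))" by simp
    have sr: "symb (\<lambda>z. z * (1 - z)) {z1<..<1} n (\<lambda>z. of_real (ln (rm * (1 - z) + d)))"
      by (rule symb_ln[OF o d_pos pos srm, of "\<lambda>_. - rm"]) (auto intro!: derivative_eq_intros)
    have "bsym (\<lambda>z. exp (0 * of_real (ln z) + of_real (real M + \<beta> - (1 + 2 * s)) * of_real (ln (1 - z))))"
      by (rule bsym_exp_ln) (use M in auto)
    note E = sub[OF this]
    have A: "symb (\<lambda>z. z * (1 - z)) {z1<..<1} n (\<lambda>z. exp (- of_real \<beta> * of_real (ln (rm * (1 - z) + d)) + 2 * kp * of_real (ln z)))"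
      by (intro symb_mult symb_exp symb_add symb_const sr sz o)
    have "symb (\<lambda>z. z * (1 - z)) {z1<..<1} n (\<lambda>z. (exp c0 * f0 (rr z)) *
        (exp (- of_real \<beta> * of_real (ln (rm * (1 - z) + d)) + 2 * kp * of_real (ln z)) *
         exp (0 * of_real (ln z) + of_real (real M + \<beta> - (1 + 2 * s)) * of_real (ln (1 - z)))))"
      by (rule symb_mult[OF o symb_mult[OF o symb_const fr] symb_mult[OF o A E]])
    then show ?thesis
    proof (rule symb_cong[OF o, THEN iffD1, rotated])
      fix z assume z: "z \<in> {z1<..<1}"
      then have z': "z \<in> {0<..<1}" using z1_z2_bounds by auto
      have r0: "rr z > 0" using rr_gt[OF z'] rp_pos by simp
      have "rr z = (rm * (1 - z) + d) / (1 - z)" using z' by (simp add: rr_def field_simps)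
      then have lnr: "ln (rr z) = ln (rm * (1 - z) + d) - ln (1 - z)"
        using z' pos[OF z] d_pos by (simp add: ln_div)
      have f0: "f0 (rr z) = exp (of_real \<beta> * of_real (ln (rr z))) * (exp (- H (rr z)) * u (rr z))"
        using r0 by (simp add: f0_def f_def powr_def flip: exp_of_real)
      have tM: "of_real (1 - z) ^ M = exp (of_nat M * complex_of_real (ln (1 - z)))"
      proof -
        have "(1 - z) ^ M = exp (real M * ln (1 - z))" using z' by (simp add: exp_of_nat_mult)
        from arg_cong[OF this, of complex_of_real] show ?thesis by (simp flip: exp_of_real)
      qed
      have ks: "kp + km + p = 1 + 2 * of_real s" by (simp add: km_def p_def)
      have "(exp c0 * f0 (rr z)) *
        (exp (- of_real \<beta> * of_real (ln (rm * (1 - z) + d)) + 2 * kp * of_real (ln z)) *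
         exp (0 * of_real (ln z) + of_real (real M + \<beta> - (1 + 2 * s)) * of_real (ln (1 - z)))) =
        u (rr z) * exp (c0 + of_real \<beta> * of_real (ln (rr z)) - H (rr z)
          + (- of_real \<beta> * of_real (ln (rm * (1 - z) + d)) + 2 * kp * of_real (ln z))
          + of_real (real M + \<beta> - (1 + 2 * s)) * of_real (ln (1 - z)))"
        unfolding f0 exp_add exp_diff by (simp add: exp_minus field_simps)
      also have "c0 + of_real \<beta> * of_real (ln (rr z)) - H (rr z)
          + (- of_real \<beta> * of_real (ln (rm * (1 - z) + d)) + 2 * kp * of_real (ln z))
          + of_real (real M + \<beta> - (1 + 2 * s)) * of_real (ln (1 - z)) =
         of_nat M * of_real (ln (1 - z)) +
         (- (\<i> * of_real (\<sigma> * d / (1 - z))) + (kp * of_real (ln z) + (- p) * of_real (ln (1 - z))))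
         + (kp + km + p - (1 + 2 * of_real s)) * of_real (ln (1 - z))"
        unfolding H_eq[OF z'] hexp_def lnr by (simp add: algebra_simps)
      also have "\<dots> = of_nat M * of_real (ln (1 - z)) +
         (- (\<i> * of_real (\<sigma> * d / (1 - z))) + (kp * of_real (ln z) + (- p) * of_real (ln (1 - z))))"
        unfolding ks by simp
      also have "u (rr z) * exp (of_nat M * of_real (ln (1 - z)) +
         (- (\<i> * of_real (\<sigma> * d / (1 - z))) + (kp * of_real (ln z) + (- p) * of_real (ln (1 - z))))) = of_real (1 - z) ^ M * W z"
        unfolding exp_add[of "of_nat M * of_real (ln (1 - z))"] tM W_def F_def by (simp only: mult_ac)
      finally show "(exp c0 * f0 (rr z)) *
        (exp (- of_real \<beta> * of_real (ln (rm * (1 - z) + d)) + 2 * kp * of_real (ln z)) *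
         exp (0 * of_real (ln z) + of_real (real M + \<beta> - (1 + 2 * s)) * of_real (ln (1 - z)))) = of_real (1 - z) ^ M * W z" .
    qed
  qed
  then show ?thesis by blast
qed

lemma wsym_W: "\<exists>M. wsym 0 (- int M) W"
proof -
  obtain M where M: "\<And>n. symb (\<lambda>z. z * (1 - z)) {z1<..<1} n (\<lambda>z. of_real (1 - z) ^ M * W z)"
    using W_near_infinity by blast
  have "bsym (\<lambda>z. of_real (1 - z) ^ M * W z)" unfolding bsym_def
  proof
    fix n
    have "symb (\<lambda>z. z * (1 - z)) {0<..<z2} n (\<lambda>z. of_real (1 - z) ^ M * W z)"
    proof (rule symb_mult)
      show "symb (\<lambda>z. z * (1 - z)) {0<..<z2} n (\<lambda>z. of_real (1 - z) ^ M)"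
        by (rule symb_subset[OF bsymD[OF bsym_power[OF bsym_z']]]) (use z1_z2_bounds in auto)
      show "symb (\<lambda>z. z * (1 - z)) {0<..<z2} n W"
        by (rule symb_bsym_field[OF _ _ W_near_horizon]) (use z1_z2_bounds in auto)
    qed auto
    from symb_Un[OF this M] have "symb (\<lambda>z. z * (1 - z)) ({0<..<z2} \<union> {z1<..<1}) n (\<lambda>z. of_real (1 - z) ^ M * W z)" .
    moreover have "{0<..<z2} \<union> {z1<..<1} = {0<..<1}" using z1_z2_bounds by auto
    ultimately show "symb (\<lambda>z. z * (1 - z)) {0<..<1} n (\<lambda>z. of_real (1 - z) ^ M * W z)" by simp
  qed
  then have "wsym 0 (- int M) W"
    by (rule wsymI) (auto simp: mon_def power_int_minus simp del: of_real_diff)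
  then show ?thesis by blast
qed

lemma mode_zero: "\<forall>r>r_plus m a. u r = 0"
proof -
  obtain M where M: "wsym 0 (- int M) W" using wsym_W by blast
  obtain Q L where QL: "wsym (- int Q) (- int L) G" using wsym_G by blast
  have dW: "vector_derivative W (at z) = W1 z" if "z \<in> {0<..<1}" for z
    using W_derivs(1)[OF that] by (rule vector_derivative_at)
  have sol: "heun_weighted P0 P1 P2 R0 R1 W c g M z2 G \<kappa> Q L"
    if g: "\<And>N n. symb (\<lambda>_. 1) {0<..<z2} n (g N)"
    and c: "\<And>N z. z \<in> {0<..<z2} \<Longrightarrow> W z = (\<Sum>i<N. c i * of_real z ^ i) + of_real z ^ N * g N z"
    for c g
  proof unfold_locales
    fix z :: real assume z: "z \<in> {0<..<1}"
    have "vector_derivative (\<lambda>z. vector_derivative W (at z)) (at z) = W2 z"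
      using vector_derivative_cong_open(2)[of "{0<..<1}" "\<lambda>z. vector_derivative W (at z)" W1 z] dW z
        vector_derivative_at[OF W_derivs(2)[OF z]] by simp
    then show "heun.op (of_real z) (W z) (vector_derivative W (at z)) (vector_derivative (\<lambda>z. vector_derivative W (at z)) (at z)) = 0"
      using W_ode[OF z] dW[OF z] by simp
    show "dd (\<lambda>z. of_real z * G z) z + \<i> * of_real \<kappa> * (of_real z * G z) = G z * heun.P (of_real z)" by (rule G_ode[OF z])
    show "G z \<noteq> 0" by (simp add: G_def)
  qed (use M QL g c z1_z2_bounds \<sigma> d_pos in \<open>auto simp: \<kappa>_def\<close>)
  \<comment> \<open>Since 2 \<eta> - x = 2 \<sigma> rp, the horizon quantity \<xi> drops out, so the
    sign is the same for superradiant frequencies; it is positive because rp - m = d / 2.\<close>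
  have sgn: "T * (2 * \<eta> - x - T / 2) > 0"
  proof -
    have "rp - m = d / 2" using two_m_eq rp_eq by simp
    moreover have "T * (2 * \<eta> - x - T / 2) = 8 * m * \<sigma>\<^sup>2 * (rp - m)"
      by (simp add: T_def \<eta>_def x_def algebra_simps power2_eq_square)
    ultimately show ?thesis using m(1) \<sigma> d_pos by simp
  qed
  have "W z = 0" if z: "z \<in> {0<..<1}" for z
  proof (rule taylor_remainders[of z2 W])
    fix c :: "nat \<Rightarrow> complex" and g
    assume "\<And>N n. symb (\<lambda>_. 1) {0<..<z2} n (g N)"
      "\<And>N z. z \<in> {0<..<z2} \<Longrightarrow> W z = (\<Sum>i<N. c i * of_real z ^ i) + of_real z ^ N * g N z"
    from sol[OF this] show "W z = 0"
      unfolding P0_def P1_def P2_def R0_def R1_def by (rule heun_mode_zero[OF _ sgn z])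
  qed (use z1_z2_bounds W_near_horizon in auto)
  then show ?thesis unfolding u_zero_iff by blast
qed

end

theorem theorem1p6:
  fixes m a \<sigma> \<Lambda> s :: real and k :: int and H u :: "real \<Rightarrow> complex"
  assumes "m > 0" and "\<bar>a\<bar> < m"
    and "\<sigma> \<noteq> 0" and "\<Lambda> > 0"
    and "smooth_on {r_plus m a<..} H"
    and "\<And>r. r > r_plus m a \<Longrightarrow>
           (H has_vector_derivative kerr_K m a \<sigma> k s r / of_real (kerr_\<mu> m a r)) (at r)"
    and "smooth_on {r_plus m a<..} u"
    and "\<And>r. r > r_plus m a \<Longrightarrow> kerr_P m a \<sigma> k \<Lambda> s u r = 0"
    and "\<exists>v. smooth_on {r_plus m a..} v \<and> (\<forall>r > r_plus m a. v r = exp (H r) * u r)"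
    and "conormal_at_infinity (r_plus m a) (\<lambda>r. exp (- H r) * u r)"
  shows "\<forall>r > r_plus m a. u r = 0"
proof -
  obtain v where v: "smooth_on {r_plus m a..} v" "\<And>r. r > r_plus m a \<Longrightarrow> v r = exp (H r) * u r"
    using assms(9) by blast
  interpret kerr_mode m a \<sigma> \<Lambda> s k H u v
    by unfold_locales (use assms v in auto)
  show ?thesis by (rule mode_zero)
qed

end
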